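(* Let $r,p,n$ be positive integers with $p\mid r$ and $\mathrm{GCD}(p,n)\in\{1,2\}$. Let $C_p=\langle \zeta_p I\rangle\subseteq G(r,n)$ (the scalar element $\zeta_p I$ is the element with trivial permutation and all colors equal to $r/p$), and let $I(r,p,n)^*$ be the set of absolute involutions of the quotient group $G(r,n)/C_p$, i.e. classes $v$ with $v\bar v=1$ in $G(r,n)/C_p$; each such $v$ is either symmetric or antisymmetric. Let $M(r,p,n)^*$ be the complex vector space with basis $\{C_v : v\in I(r,p,n)^*\}$ and define $\varrho: G(r,p,n)\to GL(M(r,p,n)^* )$ by $$\varrho(g)(C_v)=\begin{cases}\zeta_r^{\langle g,v\rangle}(-1)^{\mathrm{inv}_v(g)}\,C_{|g|v|g|^{-1}} & \text{if } v \text{ is symmetric},\\ \zeta_r^{\langle g,v\rangle}\,\zeta_r^{u(g,v)}\,C_{|g|v|g|^{-1}} & \text{if } v \text{ is antisymmetric}.\end{cases}$$ Then $(M(r,p,n)^*,\varrho)$ is a $G(r,p,n)$-model, i.e. $\varrho$ is a representation of $G(r,p,n)$ whose character is the sum of the characters of all irreducible complex representations of $G(r,p,n)$, each with multiplicity one.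
   Context: Let $\zeta_m=e^{2\pi i/m}$ and $\mathbb Z_r=\mathbb Z/r\mathbb Z$. The group $G(r,n)$ (the $n\times n$ monomial matrices with nonzero entries $r$-th roots of unity) is described as the group of colored permutations: an element $g$ is determined by a permutation $|g|\in S_n$ and colors $z_1(g),\dots,z_n(g)\in\mathbb Z_r$, and acts on the set $\{\zeta_r^k i: k\in\mathbb Z_r, i\in[n]\}$ by $g(\zeta_r^k i)=\zeta_r^{k+z_i(g)}|g|(i)$; the product in $G(r,n)$ is composition of these maps. $S_n$ is identified with the elements all of whose colors are $0$; in particular $|g|\in G(r,n)$ and $|g|v|g|^{-1}$ is a product in $G(r,n)$ (on classes modulo $C_p$ it is taken on any lift). The conjugate $\bar g$ has $|\bar g|=|g|$ and $z_i(\bar g)=-z_i(g)$. $G(r,p,n)=\{g\in G(r,n):\sum_i z_i(g)\equiv 0 \bmod p\}$. An element $w\in G(r,n)$ is symmetric if $|w|^2=1$ and $z_{|w|(i)}(w)=z_i(w)$ for all $i$; for $r$ even it is antisymmetric if $|w|^2=1$ and $z_{|w|(i)}(w)=z_i(w)+r/2$ for all $i$. A class in $G(r,n)/C_p$ is (anti)symmetric if one (equivalently every) lift $\tilde v$ is. For $\sigma,\tau\in S_n$ with $\tau^2=1$: $\mathrm{Inv}(\sigma)=\{\{i,j\}:(j-i)(\sigma(j)-\sigma(i))<0\}$, $\mathrm{Pair}(\tau)=\{\{i,j\}:\tau(i)=j\neq i\}$, and $\mathrm{inv}_v(g)=|\mathrm{Inv}(|g|)\cap\mathrm{Pair}(|\tilde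 v|)|$. Further $\langle g,v\rangle=\sum_i z_i(g)z_i(\tilde v)\in\mathbb Z_r$ and $u(g,v)=z_1(\tilde v)-z_{|g|^{-1}(1)}(\tilde v)\in\mathbb Z_r$, for any lift $\tilde v\in G(r,n)$ of $v$ (these do not depend on the lift when $g\in G(r,p,n)$). *)

theory Defs
  imports "HOL-Algebra.Algebra" "HOL-Library.Function_Algebras" Complex_Main
begin

section \<open>Finite-dimensional complex representations\<close>

text \<open>
  The complex vector space with basis \<open>B\<close> is realised as the space of functions
  vanishing outside \<open>B\<close>; the basis element indexed by \<open>b\<close> is \<open>basis_vec b\<close>.
  Up to isomorphism, every finite-dimensional space is of this form with \<open>B = {..<d}\<close>.
\<close>

definition cscale :: "complex \<Rightarrow> ('b \<Rightarrow> complex) \<Rightarrow> 'b \<Rightarrow> complex" where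
  "cscale c f = (\<lambda>b. c * f b)"

interpretation cfun: vector_space cscale
  by unfold_locales (auto simp: cscale_def fun_eq_iff algebra_simps)

definition free_space :: "'b set \<Rightarrow> ('b \<Rightarrow> complex) set" where
  "free_space B = {f. \<forall>b. b \<notin> B \<longrightarrow> f b = 0}"

definition basis_vec :: "'b \<Rightarrow> 'b \<Rightarrow> complex" where
  "basis_vec b = (\<lambda>x. if x = b then 1 else 0)"

definition linear_on :: "('b \<Rightarrow> complex) set \<Rightarrow> (('b \<Rightarrow> complex) \<Rightarrow> ('c \<Rightarrow> complex)) \<Rightarrow> bool" where
  "linear_on V T \<longleftrightarrow>
     (\<forall>x\<in>V. \<forall>y\<in>V. T (x + y) = T x + T y) \<and> (\<forall>c. \<forall>x\<in>V. T (cscale c x) = cscale c (T x))"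

definition GL :: "'b set \<Rightarrow> (('b \<Rightarrow> complex) \<Rightarrow> ('b \<Rightarrow> complex)) monoid" where
  "GL B = BijGroup (free_space B)
     \<lparr>carrier := {T \<in> Bij (free_space B). linear_on (free_space B) T}\<rparr>"

definition is_rep :: "('g, 'm) monoid_scheme \<Rightarrow> 'b set \<Rightarrow>
    ('g \<Rightarrow> ('b \<Rightarrow> complex) \<Rightarrow> ('b \<Rightarrow> complex)) \<Rightarrow> bool" where
  "is_rep G B \<rho> \<longleftrightarrow> finite B \<and> \<rho> \<in> hom G (GL B)"

definition trace_on :: "'b set \<Rightarrow> (('b \<Rightarrow> complex) \<Rightarrow> ('b \<Rightarrow> complex)) \<Rightarrow> complex" where
  "trace_on B T = (\<Sum>b\<in>B. T (basis_vec b) b)"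

definition is_irrep :: "('g, 'm) monoid_scheme \<Rightarrow> 'b set \<Rightarrow>
    ('g \<Rightarrow> ('b \<Rightarrow> complex) \<Rightarrow> ('b \<Rightarrow> complex)) \<Rightarrow> bool" where
  "is_irrep G B \<rho> \<longleftrightarrow> is_rep G B \<rho> \<and> B \<noteq> {} \<and>
     (\<forall>W. cfun.subspace W \<and> W \<subseteq> free_space B \<and> (\<forall>g\<in>carrier G. \<rho> g ` W \<subseteq> W)
        \<longrightarrow> W = {0} \<or> W = free_space B)"

definition rep_iso :: "('g, 'm) monoid_scheme \<Rightarrow>
    'b set \<Rightarrow> ('g \<Rightarrow> ('b \<Rightarrow> complex) \<Rightarrow> ('b \<Rightarrow> complex)) \<Rightarrow>
    'c set \<Rightarrow> ('g \<Rightarrow> ('c \<Rightarrow> complex) \<Rightarrow> ('c \<Rightarrow> complex)) \<Rightarrow> bool" where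
  "rep_iso G B \<rho> B' \<rho>' \<longleftrightarrow>
     (\<exists>T. bij_betw T (free_space B) (free_space B') \<and> linear_on (free_space B) T \<and>
          (\<forall>g\<in>carrier G. \<forall>x\<in>free_space B. T (\<rho> g x) = \<rho>' g (T x)))"

text \<open>
  \<open>R\<close> is a system of representatives of the isomorphism classes of irreducible
  representations; the element \<open>(d, \<sigma>)\<close> is a representation on the space with basis \<open>{..<d}\<close>.
\<close>

definition irrep_reps :: "('g, 'm) monoid_scheme \<Rightarrow>
    (nat \<times> ('g \<Rightarrow> (nat \<Rightarrow> complex) \<Rightarrow> (nat \<Rightarrow> complex))) set \<Rightarrow> bool" where
  "irrep_reps G R \<longleftrightarrow> (\<forall>(d, \<sigma>)\<in>R. is_irrep G {..<d} \<sigma>) \<and>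
     (\<forall>(d::nat) \<sigma>. is_irrep G {..<d} \<sigma> \<longrightarrow>
        (\<exists>!x. x \<in> R \<and> rep_iso G {..<d} \<sigma> {..<fst x} (snd x)))"

definition is_model :: "('g, 'm) monoid_scheme \<Rightarrow> 'b set \<Rightarrow>
    ('g \<Rightarrow> ('b \<Rightarrow> complex) \<Rightarrow> ('b \<Rightarrow> complex)) \<Rightarrow> bool" where
  "is_model G B \<rho> \<longleftrightarrow> is_rep G B \<rho> \<and>
     (\<exists>R. finite R \<and> irrep_reps G R \<and>
        (\<forall>g\<in>carrier G. trace_on B (\<rho> g) = (\<Sum>(d, \<sigma>)\<in>R. trace_on {..<d} (\<sigma> g))))"


section \<open>Colored permutations\<close>

text \<open>
  An element \<open>g\<close> is the pair of \<open>|g|\<close> and its color function \<open>i \<mapsto> z\<^sub>i(g)\<close>; elements of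
  \<open>\<int>/r\<int>\<close> are represented by the integers in \<open>{0..<r}\<close>.
\<close>

type_synonym colperm = "(nat \<Rightarrow> nat) \<times> (nat \<Rightarrow> int)"

abbreviation perm :: "colperm \<Rightarrow> nat \<Rightarrow> nat" where "perm \<equiv> fst"
abbreviation color :: "colperm \<Rightarrow> nat \<Rightarrow> int" where "color \<equiv> snd"

definition G_rn :: "nat \<Rightarrow> nat \<Rightarrow> colperm monoid" where
  "G_rn r n =
     \<lparr>carrier = {\<sigma>. \<sigma> permutes {1..n}} \<times> ({1..n} \<rightarrow>\<^sub>E {0..<int r}),
      monoid.mult = (\<lambda>g h. (perm g \<circ> perm h,
                             \<lambda>i\<in>{1..n}. (color h i + color g (perm h i)) mod int r)),
      one = (id, \<lambda>i\<in>{1..n}. 0)\<rparr>"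

text \<open>
  The point \<open>\<zeta>\<^sub>r\<^sup>k i\<close> is encoded as \<open>(k, i)\<close>; the lemma \<open>act_mult\<close> below shows that the
  multiplication above is composition of these maps.
\<close>

definition act :: "nat \<Rightarrow> colperm \<Rightarrow> int \<times> nat \<Rightarrow> int \<times> nat" where
  "act r g = (\<lambda>(k, i). ((k + color g i) mod int r, perm g i))"

lemma act_mult:
  assumes "g \<in> carrier (G_rn r n)" "h \<in> carrier (G_rn r n)" "i \<in> {1..n}"
  shows "act r (g \<otimes>\<^bsub>G_rn r n\<^esub> h) (k, i) = act r g (act r h (k, i))"
  using assms by (simp add: act_def G_rn_def mod_simps algebra_simps)

lemma group_G_rn:
  assumes "0 < r"
  shows "group (G_rn r n)"
proof (rule groupI)
  fix x y assume "x \<in> carrier (G_rn r n)" "y \<in> carrier (G_rn r n)"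
  then show "x \<otimes>\<^bsub>G_rn r n\<^esub> y \<in> carrier (G_rn r n)"
    using assms by (auto simp: G_rn_def permutes_compose)
next
  show "\<one>\<^bsub>G_rn r n\<^esub> \<in> carrier (G_rn r n)"
    using assms by (auto simp: G_rn_def permutes_id)
next
  fix x y z
  assume *: "x \<in> carrier (G_rn r n)" "y \<in> carrier (G_rn r n)" "z \<in> carrier (G_rn r n)"
  then have "perm z i \<in> {1..n}" if "i \<in> {1..n}" for i
    using that permutes_in_image[of "perm z" "{1..n}" i] by (auto simp: G_rn_def)
  then show "x \<otimes>\<^bsub>G_rn r n\<^esub> y \<otimes>\<^bsub>G_rn r n\<^esub> z = x \<otimes>\<^bsub>G_rn r n\<^esub> (y \<otimes>\<^bsub>G_rn r n\<^esub> z)"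
    by (auto simp: G_rn_def fun_eq_iff mod_simps algebra_simps restrict_def)
next
  fix x assume "x \<in> carrier (G_rn r n)"
  then have "color x \<in> {1..n} \<rightarrow>\<^sub>E {0..<int r}" by (auto simp: G_rn_def)
  then show "\<one>\<^bsub>G_rn r n\<^esub> \<otimes>\<^bsub>G_rn r n\<^esub> x = x"
    using \<open>x \<in> carrier (G_rn r n)\<close> permutes_in_image[of "perm x" "{1..n}"]
    by (cases x) (auto simp: G_rn_def fun_eq_iff restrict_def PiE_iff extensional_def)
next
  fix x assume x: "x \<in> carrier (G_rn r n)"
  define y where "y = (inv_into UNIV (perm x), \<lambda>i\<in>{1..n}. (- color x (inv_into UNIV (perm x) i)) mod int r)"
  have p: "perm x permutes {1..n}" using x by (auto simp: G_rn_def)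
  have "y \<in> carrier (G_rn r n)"
    using assms p by (auto simp: y_def G_rn_def permutes_inv)
  moreover have "y \<otimes>\<^bsub>G_rn r n\<^esub> x = \<one>\<^bsub>G_rn r n\<^esub>"
    using p permutes_in_image[OF p] permutes_inv_o[OF p] permutes_inverses[OF p]
    by (auto simp: y_def G_rn_def fun_eq_iff restrict_def mod_simps)
  ultimately show "\<exists>y\<in>carrier (G_rn r n). y \<otimes>\<^bsub>G_rn r n\<^esub> x = \<one>\<^bsub>G_rn r n\<^esub>" by blast
qed

definition G_rpn :: "nat \<Rightarrow> nat \<Rightarrow> nat \<Rightarrow> colperm monoid" where
  "G_rpn r p n = (G_rn r n)
     \<lparr>carrier := {g \<in> carrier (G_rn r n). int p dvd (\<Sum>i=1..n. color g i)}\<rparr>"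

text \<open>The generator is the scalar \<open>\<zeta>\<^sub>p I\<close>; for \<open>p = 1\<close> its color \<open>r/p = r\<close> reduces to \<open>0\<close>.\<close>
definition C_p :: "nat \<Rightarrow> nat \<Rightarrow> nat \<Rightarrow> colperm set" where
  "C_p r p n = generate (G_rn r n) {(id, \<lambda>i\<in>{1..n}. int (r div p) mod int r)}"

lemma dvd_mult_mod_iff:
  "int r dvd x * (y mod int r) \<longleftrightarrow> int r dvd x * y"
  by (simp add: dvd_eq_mod_eq_0 mod_mult_right_eq)

lemma finite_G_rn: "finite (carrier (G_rn r n))"
  by (auto simp: G_rn_def intro!: finite_cartesian_product finite_permutations finite_PiE)

lemma C_p_elt:
  assumes "0 < r" "p dvd r" "c \<in> C_p r p n"
  shows "\<exists>k\<in>{0..<int r}. int r dvd int p * k \<and> c = (id, \<lambda>i\<in>{1..n}. k)"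
proof -
  interpret G: group "G_rn r n" using assms(1) by (rule group_G_rn)
  have gen: "int r dvd int p * (int (r div p) mod int r)"
    using assms(2) by (simp add: dvd_mult_mod_iff flip: of_nat_mult)
  have carr: "(id, \<lambda>i\<in>{1..n}. k) \<in> carrier (G_rn r n)" if "k \<in> {0..<int r}" for k
    using that by (auto simp: G_rn_def permutes_id)
  have inv_scalar: "inv\<^bsub>G_rn r n\<^esub> (id, \<lambda>i\<in>{1..n}. k) = (id, \<lambda>i\<in>{1..n}. (- k) mod int r)"
    if "k \<in> {0..<int r}" for k
    using that assms(1) carr[of k] carr[of "(- k) mod int r"]
    by (intro G.inv_equality) (auto simp: G_rn_def fun_eq_iff mod_simps)
  have base: "int (r div p) mod int r \<in> {0..<int r}" using assms(1) by auto
  show ?thesis using assms(3) unfolding C_p_def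
  proof (induction rule: generate.induct)
    case one
    show ?case using assms(1) by (auto simp: G_rn_def intro!: bexI[of _ 0])
  next
    case (incl h)
    then show ?case using gen base by blast
  next
    case (inv h)
    have "int r dvd int p * ((- (int (r div p) mod int r)) mod int r)"
      using gen by (simp add: dvd_mult_mod_iff)
    moreover have "inv\<^bsub>G_rn r n\<^esub> h
        = (id, \<lambda>i\<in>{1..n}. (- (int (r div p) mod int r)) mod int r)"
      using inv inv_scalar[OF base] by simp
    moreover have "(- (int (r div p) mod int r)) mod int r \<in> {0..<int r}"
      using assms(1) by simp
    ultimately show ?case by blast
  next
    case (eng h1 h2)
    then obtain k l where "k \<in> {0..<int r}" "l \<in> {0..<int r}"
      "int r dvd int p * k" "int r dvd int p * l"
      "h1 = (id, \<lambda>i\<in>{1..n}. k)" "h2 = (id, \<lambda>i\<in>{1..n}. l)" by blast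
    then have "h1 \<otimes>\<^bsub>G_rn r n\<^esub> h2 = (id, \<lambda>i\<in>{1..n}. (k + l) mod int r)"
      by (simp add: G_rn_def fun_eq_iff restrict_def add.commute)
    moreover have "int r dvd int p * ((k + l) mod int r)"
      using \<open>int r dvd int p * k\<close> \<open>int r dvd int p * l\<close>
      by (simp add: dvd_mult_mod_iff distrib_left)
    moreover have "(k + l) mod int r \<in> {0..<int r}" using assms(1) by simp
    ultimately show ?case by blast
  qed
qed

text \<open>The element \<open>|g|\<close>, regarded as an element of \<open>G(r,n)\<close>.\<close>
definition abs_elt :: "nat \<Rightarrow> colperm \<Rightarrow> colperm" where
  "abs_elt n g = (perm g, \<lambda>i\<in>{1..n}. 0)"

definition conj_elt :: "nat \<Rightarrow> nat \<Rightarrow> colperm \<Rightarrow> colperm" where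
  "conj_elt r n g = (perm g, \<lambda>i\<in>{1..n}. (- color g i) mod int r)"

definition symmetric :: "nat \<Rightarrow> colperm \<Rightarrow> bool" where
  "symmetric n w \<longleftrightarrow> perm w \<circ> perm w = id \<and> (\<forall>i\<in>{1..n}. color w (perm w i) = color w i)"

definition antisymmetric :: "nat \<Rightarrow> nat \<Rightarrow> colperm \<Rightarrow> bool" where
  "antisymmetric r n w \<longleftrightarrow> even r \<and> perm w \<circ> perm w = id \<and>
     (\<forall>i\<in>{1..n}. color w (perm w i) = (color w i + int (r div 2)) mod int r)"


section \<open>Absolute involutions of the quotient\<close>

text \<open>
  The elements of the quotient group are the cosets of \<open>C_p\<close>, so the lifts of a class \<open>v\<close>
  are its elements.
\<close>

definition abs_involutions :: "nat \<Rightarrow> nat \<Rightarrow> nat \<Rightarrow> colperm set set" where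
  "abs_involutions r p n =
     {v \<in> carrier (G_rn r n Mod C_p r p n).
        v \<otimes>\<^bsub>G_rn r n Mod C_p r p n\<^esub> (conj_elt r n ` v) = \<one>\<^bsub>G_rn r n Mod C_p r p n\<^esub>}"

definition symmetric_class :: "nat \<Rightarrow> colperm set \<Rightarrow> bool" where
  "symmetric_class n v \<longleftrightarrow> (\<exists>w\<in>v. symmetric n w)"

definition antisymmetric_class :: "nat \<Rightarrow> nat \<Rightarrow> colperm set \<Rightarrow> bool" where
  "antisymmetric_class r n v \<longleftrightarrow> (\<exists>w\<in>v. antisymmetric r n w)"

definition lift_elt :: "colperm set \<Rightarrow> colperm" where
  "lift_elt v = (SOME w. w \<in> v)"

definition inv_set :: "nat \<Rightarrow> (nat \<Rightarrow> nat) \<Rightarrow> nat set set" where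
  "inv_set n \<sigma> = {{i, j} | i j. i \<in> {1..n} \<and> j \<in> {1..n} \<and>
                 (int j - int i) * (int (\<sigma> j) - int (\<sigma> i)) < 0}"

definition pair_set :: "nat \<Rightarrow> (nat \<Rightarrow> nat) \<Rightarrow> nat set set" where
  "pair_set n \<tau> = {{i, j} | i j. i \<in> {1..n} \<and> \<tau> i = j \<and> j \<noteq> i}"

text \<open>
  The next three functions take a lift \<open>w\<close> of a class as second argument;
  \<open>lift_independence\<close> below shows that the choice of lift does not matter.
\<close>

definition inv_stat :: "nat \<Rightarrow> colperm \<Rightarrow> colperm \<Rightarrow> nat" where
  "inv_stat n g w = card (inv_set n (perm g) \<inter> pair_set n (perm w))"

definition pairing :: "nat \<Rightarrow> nat \<Rightarrow> colperm \<Rightarrow> colperm \<Rightarrow> int" where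
  "pairing r n g w = (\<Sum>i=1..n. color g i * color w i) mod int r"

definition u_stat :: "nat \<Rightarrow> colperm \<Rightarrow> colperm \<Rightarrow> int" where
  "u_stat r g w = (color w 1 - color w (inv_into UNIV (perm g) 1)) mod int r"

lemma lift_differ:
  assumes "0 < r" "p dvd r" "v \<in> carrier (G_rn r n Mod C_p r p n)" "w \<in> v" "w' \<in> v"
  shows "\<exists>k. int r dvd int p * k \<and> perm w' = perm w \<and>
           (\<forall>i\<in>{1..n}. color w' i mod int r = (color w i + k) mod int r)"
proof -
  obtain a where a: "a \<in> carrier (G_rn r n)" "v = C_p r p n #>\<^bsub>G_rn r n\<^esub> a"
    using assms(3) by (auto simp: FactGroup_def RCOSETS_def)
  have perm_a: "perm a permutes {1..n}" using a(1) by (auto simp: G_rn_def)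
  have "\<exists>k. int r dvd int p * k \<and> x = (perm a, \<lambda>i\<in>{1..n}. (color a i + k) mod int r)"
    if x: "x \<in> v" for x
  proof -
    obtain c where c: "c \<in> C_p r p n" "x = c \<otimes>\<^bsub>G_rn r n\<^esub> a"
      using x a(2) by (auto simp: r_coset_def)
    obtain k where k: "k \<in> {0..<int r}" "int r dvd int p * k" "c = (id, \<lambda>i\<in>{1..n}. k)"
      using C_p_elt[OF assms(1,2) c(1)] by blast
    have "\<And>i. i \<in> {1..n} \<Longrightarrow> perm a i \<in> {1..n}"
      using perm_a by (auto simp: permutes_in_image simp del: atLeastAtMost_iff)
    then show ?thesis using c k
      by (intro exI[of _ k]) (auto simp: G_rn_def fun_eq_iff restrict_def)
  qed
  then obtain k l where kl: "int r dvd int p * k" "int r dvd int p * l"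
     "w = (perm a, \<lambda>i\<in>{1..n}. (color a i + k) mod int r)"
     "w' = (perm a, \<lambda>i\<in>{1..n}. (color a i + l) mod int r)"
    using assms(4,5) by meson
  then show ?thesis
    by (intro exI[of _ "l - k"]) (auto simp: right_diff_distrib mod_simps)
qed

lemma lift_independence:
  assumes "0 < r" "p dvd r" "0 < n" "v \<in> carrier (G_rn r n Mod C_p r p n)" "w \<in> v" "w' \<in> v"
    and g: "g \<in> carrier (G_rpn r p n)"
  shows "inv_stat n g w' = inv_stat n g w" "pairing r n g w' = pairing r n g w"
    "u_stat r g w' = u_stat r g w"
proof -
  obtain k where k: "int r dvd int p * k" "perm w' = perm w"
    "\<And>i. i \<in> {1..n} \<Longrightarrow> color w' i mod int r = (color w i + k) mod int r"
    using lift_differ[OF assms(1,2,4-6)] by blast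
  show "inv_stat n g w' = inv_stat n g w" using k(2) by (simp add: inv_stat_def)
  have gp: "perm g permutes {1..n}" "int p dvd (\<Sum>i=1..n. color g i)"
    using g by (auto simp: G_rpn_def G_rn_def)
  then have "int p * k dvd (\<Sum>i=1..n. color g i) * k" by simp
  with k(1) have "int r dvd (\<Sum>i=1..n. color g i) * k" using dvd_trans by blast
  then have *: "(\<Sum>i=1..n. color g i * k) mod int r = 0" by (simp add: sum_distrib_right)
  have "(\<Sum>i=1..n. color g i * color w' i) mod int r
      = (\<Sum>i=1..n. color g i * color w' i mod int r) mod int r" by (simp add: mod_sum_eq)
  also have "\<dots> = (\<Sum>i=1..n. color g i * (color w i + k) mod int r) mod int r"
  proof -
    have "color g i * color w' i mod int r = color g i * (color w i + k) mod int r"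
      if "i \<in> {1..n}" for i using k(3)[OF that] by (metis mod_mult_right_eq)
    then show ?thesis by simp
  qed
  also have "\<dots> = (\<Sum>i=1..n. color g i * color w i + color g i * k) mod int r"
    by (simp add: mod_sum_eq distrib_left)
  also have "\<dots> = (\<Sum>i=1..n. color g i * color w i) mod int r"
    using * mod_add_right_eq[of "\<Sum>i=1..n. color g i * color w i"
        "\<Sum>i=1..n. color g i * k" "int r"]
    by (simp add: sum.distrib)
  finally show "pairing r n g w' = pairing r n g w" by (simp add: pairing_def)
  have "1 \<in> {1..n}" using assms(3) by simp
  moreover from this have "inv_into UNIV (perm g) 1 \<in> {1..n}"
    using permutes_in_image[OF permutes_inv[OF gp(1)]] by blast
  ultimately have "color w' 1 mod int r = (color w 1 + k) mod int r"
    "color w' (inv_into UNIV (perm g) 1) mod int r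
       = (color w (inv_into UNIV (perm g) 1) + k) mod int r" using k(3) by blast+
  then have "u_stat r g w' =
      (color w 1 + k - (color w (inv_into UNIV (perm g) 1) + k)) mod int r"
    unfolding u_stat_def by (rule mod_diff_cong)
  then show "u_stat r g w' = u_stat r g w" by (simp add: u_stat_def)
qed

definition zeta :: "nat \<Rightarrow> complex" where
  "zeta m = exp (2 * of_real pi * \<i> / of_nat m)"

text \<open>The class \<open>|g| v |g|\<^sup>-\<^sup>1\<close>.\<close>
definition conj_class :: "nat \<Rightarrow> nat \<Rightarrow> colperm \<Rightarrow> colperm set \<Rightarrow> colperm set" where
  "conj_class r n g v =
     (\<lambda>w. abs_elt n g \<otimes>\<^bsub>G_rn r n\<^esub> w \<otimes>\<^bsub>G_rn r n\<^esub> inv\<^bsub>G_rn r n\<^esub> (abs_elt n g)) ` v"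

definition rho_coeff :: "nat \<Rightarrow> nat \<Rightarrow> colperm \<Rightarrow> colperm set \<Rightarrow> complex" where
  "rho_coeff r n g v =
     (if symmetric_class n v
      then zeta r powi pairing r n g (lift_elt v) * (- 1) ^ inv_stat n g (lift_elt v)
      else zeta r powi pairing r n g (lift_elt v) * zeta r powi u_stat r g (lift_elt v))"

text \<open>
  Linear extension of \<open>C\<^sub>v \<mapsto> rho_coeff r n g v \<cdot> C\<^sub>w\<close> with \<open>w = |g| v |g|\<^sup>-\<^sup>1\<close>,
  where \<open>C\<^sub>v = basis_vec v\<close>.
\<close>
definition rho :: "nat \<Rightarrow> nat \<Rightarrow> nat \<Rightarrow> colperm \<Rightarrow>
    (colperm set \<Rightarrow> complex) \<Rightarrow> (colperm set \<Rightarrow> complex)" where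
  "rho r p n g = (\<lambda>f\<in>free_space (abs_involutions r p n).
     \<Sum>v\<in>abs_involutions r p n.
       cscale (f v) (cscale (rho_coeff r n g v) (basis_vec (conj_class r n g v))))"

lemma rho_basis_vec:
  assumes "v \<in> abs_involutions r p n"
  shows "rho r p n g (basis_vec v) = cscale (rho_coeff r n g v) (basis_vec (conj_class r n g v))"
proof -
  let ?I = "abs_involutions r p n"
  let ?t = "\<lambda>w. cscale (rho_coeff r n g w) (basis_vec (conj_class r n g w))"
  have "?I \<subseteq> (\<lambda>a. C_p r p n #>\<^bsub>G_rn r n\<^esub> a) ` carrier (G_rn r n)"
    by (auto simp: abs_involutions_def FactGroup_def RCOSETS_def)
  then have fin: "finite ?I"
    by (rule finite_subset) (rule finite_imageI[OF finite_G_rn])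
  have "(\<Sum>w\<in>?I. cscale (basis_vec v w) (?t w)) = (\<Sum>w\<in>?I. if w = v then ?t w else 0)"
    by (intro sum.cong refl) (simp add: basis_vec_def[of v])
  also have "\<dots> = ?t v" using fin assms by simp
  finally have "(\<Sum>w\<in>?I. cscale (basis_vec v w) (?t w)) = ?t v" .
  moreover have "basis_vec v \<in> free_space ?I"
    using assms by (auto simp: free_space_def basis_vec_def)
  ultimately show ?thesis by (simp add: rho_def)
qed

end

theory Submission
  imports Defs "Jordan_Normal_Form.Char_Poly" "HOL-Combinatorics.Cycles"
begin

text \<open>
  Let \<open>H = G(r,p,n)\<close> and let \<open>\<tau>\<close> be the automorphism that negates the colors. By the twisted
  Frobenius--Schur theorem, \<open>g \<mapsto> #{h \<in> H. h \<tau>(h) = g}\<close> is the sum of the irreducible characters with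
  coefficients in \<open>{0, 1, -1}\<close>, and no coefficient vanishes if \<open>\<tau>(g)\<close> is conjugate to \<open>g\<^sup>-\<^sup>1\<close> for all
  \<open>g\<close>. Here \<open>GCD(p,n) \<le> 2\<close> guarantees this: the conjugating element reverses the cycles of \<open>|g|\<close>,
  and its color sum can be made divisible by \<open>p\<close>. Since multiplicities in a representation are not
  negative, a representation with character \<open>#{h. h \<tau>(h) = g}\<close> is a model.

  It remains to compute the character of \<open>\<rho>\<close>. Fourier inversion turns \<open>p #{h. h \<tau>(h) = g}\<close> into
  a sum over colorings \<open>z\<close> of \<open>\<zeta>\<^sub>r\<close> to the power \<open>\<Sum>i. z\<^sub>i(g) z\<^sub>i\<close>, times the number of square
  roots of \<open>|g|\<close> that shift \<open>z\<close> by a constant; the trace of \<open>\<rho>(g)\<close> is the same sum with the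
  square roots replaced by signed involutions commuting with \<open>|g|\<close>. For a fixed \<open>z\<close> the two
  counts agree: an involution that acts as a half turn on a cycle of \<open>|g|\<close> cancels against the one
  that fixes this cycle, and the remaining involutions correspond to the square roots by twisting
  with powers of \<open>|g|\<close> on the cycles.
\<close>

section \<open>Representations and their matrix entries\<close>

text \<open>The bound on the gcd acts a second time, in the comparison of the two counts. If a
  permutation shifts a coloring of \<open>{1..n}\<close> by a constant \<open>k\<close> such that
  \<open>r\<close> divides \<open>p * k\<close>, then summing over all positions shows that
  \<open>r\<close> also divides \<open>n * k\<close>, hence \<open>2 * k\<close>. So the only
  possible shifts are 0 and, for even \<open>r\<close>, \<open>r div 2\<close>. Let
  \<open>\<sigma>\<close> be \<open>|g|\<close>. If \<open>\<sigma>\<close> preserves the coloring,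
  its square roots of shift 0 are counted by the signed symmetric involutions, and those of shift
  \<open>r div 2\<close> by the antisymmetric ones, on which the factor \<open>\<zeta>^u\<close> is
  1. If \<open>\<sigma>\<close> shifts the coloring by \<open>r div 2\<close>, it has no such square
  root, because the square of any candidate has shift 0; there \<open>\<zeta>^u\<close> is -1, and
  the antisymmetric involutions cancel the symmetric ones. This is the origin of the factor
  \<open>\<zeta>^u\<close>. A coloring that \<open>\<sigma>\<close> does not shift by such a
  constant contributes to neither side.\<close>

lemma basis_vec_in_free_space: "b \<in> B \<Longrightarrow> basis_vec b \<in> free_space B"
  by (auto simp: free_space_def basis_vec_def)

lemma subspace_free_space: "cfun.subspace (free_space B)"
  by (auto simp: cfun.subspace_def free_space_def cscale_def)

lemma sum_fun_apply: "(\<Sum>a\<in>A. f a) x = (\<Sum>a\<in>A. f a x)" for f :: "'a \<Rightarrow> 'b \<Rightarrow> complex"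
  by (induction A rule: infinite_finite_induct) auto

lemma free_space_expand:
  assumes "finite B" "x \<in> free_space B"
  shows "x = (\<Sum>b\<in>B. cscale (x b) (basis_vec b))"
proof
  fix i
  have "(\<Sum>b\<in>B. cscale (x b) (basis_vec b)) i = (\<Sum>b\<in>B. if b = i then x b else 0)"
    by (simp add: sum_fun_apply cscale_def basis_vec_def) (intro sum.cong, auto)
  then show "x i = (\<Sum>b\<in>B. cscale (x b) (basis_vec b)) i"
    using assms by (auto simp: free_space_def)
qed

lemma linear_on_zero: "linear_on V T \<Longrightarrow> 0 \<in> V \<Longrightarrow> T 0 = 0"
  unfolding linear_on_def by (metis cfun.scale_zero_left)

lemma linear_on_sum:
  assumes "linear_on V T" "cfun.subspace V" "\<And>a. a \<in> A \<Longrightarrow> f a \<in> V"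
  shows "T (\<Sum>a\<in>A. cscale (c a) (f a)) = (\<Sum>a\<in>A. cscale (c a) (T (f a)))"
  using assms(3)
proof (induction A rule: infinite_finite_induct)
  case (insert a A)
  then have "(\<Sum>a\<in>A. cscale (c a) (f a)) \<in> V" "cscale (c a) (f a) \<in> V"
    using assms(2) by (auto intro!: cfun.subspace_sum cfun.subspace_scale)
  then have "T (cscale (c a) (f a) + (\<Sum>a\<in>A. cscale (c a) (f a)))
      = cscale (c a) (T (f a)) + T (\<Sum>a\<in>A. cscale (c a) (f a))"
    using insert.prems assms(1) unfolding linear_on_def by simp
  with insert show ?case by (simp del: plus_fun_apply)
qed (use linear_on_zero[OF assms(1) cfun.subspace_0[OF assms(2)]] in auto)

lemma linear_on_apply:
  assumes "linear_on (free_space B) T" "finite B" "x \<in> free_space B"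
  shows "T x i = (\<Sum>j\<in>B. T (basis_vec j) i * x j)"
proof -
  have "T x = T (\<Sum>b\<in>B. cscale (x b) (basis_vec b))" using free_space_expand assms(2,3) by metis
  also have "\<dots> = (\<Sum>b\<in>B. cscale (x b) (T (basis_vec b)))"
    by (rule linear_on_sum[OF assms(1) subspace_free_space]) (rule basis_vec_in_free_space)
  finally show ?thesis by (simp add: sum_fun_apply cscale_def mult.commute)
qed

text \<open>Restricted to \<open>free_space B\<close> because the elements of \<open>Bij\<close>,
  and so those of \<open>GL B\<close>, are extensional; cut off outside \<open>C\<close> so that the
  values lie in \<open>free_space C\<close>.\<close>

definition op_of :: "'c set \<Rightarrow> 'b set \<Rightarrow> ('c \<Rightarrow> 'b \<Rightarrow> complex) \<Rightarrow> ('b \<Rightarrow> complex) \<Rightarrow> 'c \<Rightarrow> complex" where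
  "op_of C B M = (\<lambda>x\<in>free_space B. \<lambda>i. if i \<in> C then \<Sum>j\<in>B. M i j * x j else 0)"

lemma op_of_apply: "x \<in> free_space B \<Longrightarrow> op_of C B M x i = (if i \<in> C then \<Sum>j\<in>B. M i j * x j else 0)"
  by (simp add: op_of_def)

lemma op_of_in: "x \<in> free_space B \<Longrightarrow> op_of C B M x \<in> free_space C"
  by (simp add: op_of_def free_space_def)

lemma linear_on_op_of: "linear_on (free_space B) (op_of C B M)"
proof -
  have "x + y \<in> free_space B" "cscale c x \<in> free_space B" if "x \<in> free_space B" "y \<in> free_space B" for x y c
    using that by (auto simp: free_space_def cscale_def)
  then show ?thesis
    by (auto simp: linear_on_def op_of_def fun_eq_iff sum.distrib algebra_simps cscale_def sum_distrib_left)
qed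

lemma op_of_basis_vec:
  assumes "finite B" "j \<in> B"
  shows "op_of C B M (basis_vec j) i = (if i \<in> C then M i j else 0)"
  using assms by (simp add: op_of_apply basis_vec_in_free_space)
    (simp add: basis_vec_def if_distrib cong: if_cong)

lemma op_of_comp:
  assumes "finite B" "finite C" "x \<in> free_space B"
  shows "op_of D C M (op_of C B N x) = op_of D B (\<lambda>i j. \<Sum>l\<in>C. M i l * N l j) x"
proof
  fix i
  have "(\<Sum>l\<in>C. M i l * (\<Sum>j\<in>B. N l j * x j)) = (\<Sum>j\<in>B. (\<Sum>l\<in>C. M i l * N l j) * x j)"
    by (simp add: sum_distrib_left sum_distrib_right sum.swap[of _ C] mult.assoc)
  then show "op_of D C M (op_of C B N x) i = op_of D B (\<lambda>i j. \<Sum>l\<in>C. M i l * N l j) x i"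
    using assms by (simp add: op_of_apply[OF assms(3)] op_of_apply[OF op_of_in[OF assms(3)]])
qed

lemma op_of_id:
  assumes "finite B" "x \<in> free_space B" "\<And>i j. i \<in> B \<Longrightarrow> j \<in> B \<Longrightarrow> M i j = (if i = j then 1 else 0)"
  shows "op_of B B M x = x"
proof
  fix i
  have "(\<Sum>j\<in>B. M i j * x j) = (\<Sum>j\<in>B. if j = i then x j else 0)" if "i \<in> B"
    using that assms(3) by (intro sum.cong) auto
  then show "op_of B B M x i = x i" using assms(1,2) by (auto simp: op_of_apply free_space_def)
qed

lemma GL_memD:
  assumes "T \<in> carrier (GL B)"
  shows "bij_betw T (free_space B) (free_space B)"
    "linear_on (free_space B) T" "x \<in> free_space B \<Longrightarrow> T x \<in> free_space B"
  using assms bij_betwE[of T "free_space B"] by (auto simp: GL_def Bij_def BijGroup_def)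

definition ent :: "('g \<Rightarrow> ('b \<Rightarrow> complex) \<Rightarrow> 'c \<Rightarrow> complex) \<Rightarrow> 'g \<Rightarrow> 'c \<Rightarrow> 'b \<Rightarrow> complex" where
  "ent \<rho> g i j = \<rho> g (basis_vec j) i"

section \<open>Homomorphisms into the general linear group and their matrices\<close>

locale rep = group G for G :: "('g, 'm) monoid_scheme" (structure) +
  fixes B :: "'b set" and \<rho>
  assumes rep: "is_rep G B \<rho>"
begin

lemma finite_index: "finite B" using rep by (simp add: is_rep_def)

lemma GL: "g \<in> carrier G \<Longrightarrow> \<rho> g \<in> carrier (GL B)"
  using rep by (auto simp: is_rep_def hom_def)

lemmas bij = GL_memD(1)[OF GL] and lin = GL_memD(2)[OF GL] and closed_space = GL_memD(3)[OF GL]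

lemma mult_apply:
  assumes "g \<in> carrier G" "h \<in> carrier G" "x \<in> free_space B"
  shows "\<rho> (g \<otimes> h) x = \<rho> g (\<rho> h x)"
proof -
  have "\<rho> (g \<otimes> h) = \<rho> g \<otimes>\<^bsub>GL B\<^esub> \<rho> h" using rep assms by (auto simp: is_rep_def hom_def)
  then show ?thesis using GL[OF assms(1)] GL[OF assms(2)] assms(3)
    by (simp add: GL_def BijGroup_def compose_def)
qed

text \<open>Membership in \<open>hom\<close> says nothing about the unit; but
  \<open>\<rho> \<one>\<close> is idempotent and injective, hence the identity.\<close>

lemma one_apply: "x \<in> free_space B \<Longrightarrow> \<rho> \<one> x = x"
  using mult_apply[OF one_closed one_closed, of x] bij[OF one_closed] closed_space[OF one_closed, of x]
  by (metis bij_betw_def inj_onD one_closed r_one)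

lemma apply_ent: "g \<in> carrier G \<Longrightarrow> x \<in> free_space B \<Longrightarrow> \<rho> g x i = (\<Sum>j\<in>B. ent \<rho> g i j * x j)"
  unfolding ent_def by (rule linear_on_apply[OF lin finite_index])

lemma ent_mult:
  assumes "g \<in> carrier G" "h \<in> carrier G" "j \<in> B"
  shows "ent \<rho> (g \<otimes> h) i j = (\<Sum>l\<in>B. ent \<rho> g i l * ent \<rho> h l j)"
  using assms mult_apply[OF assms(1,2) basis_vec_in_free_space[OF assms(3)]]
   apply_ent[OF assms(1) closed_space[OF assms(2) basis_vec_in_free_space[OF assms(3)]]]
  by (simp add: ent_def)

lemma ent_one: "j \<in> B \<Longrightarrow> ent \<rho> \<one> i j = (if i = j then 1 else 0)"
  by (simp add: ent_def one_apply basis_vec_in_free_space) (simp add: basis_vec_def)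

lemma trace_ent: "trace_on B (\<rho> g) = (\<Sum>i\<in>B. ent \<rho> g i i)"
  by (simp add: trace_on_def ent_def)

end

text \<open>Bijectivity is a consequence of the two matrix identities: the operator of the inverse
  group element is the inverse map.\<close>

lemma is_rep_op_of:
  assumes "group G" "finite B"
    and mult: "\<And>g h i j. g \<in> carrier G \<Longrightarrow> h \<in> carrier G \<Longrightarrow> i \<in> B \<Longrightarrow> j \<in> B \<Longrightarrow>
       M (g \<otimes>\<^bsub>G\<^esub> h) i j = (\<Sum>l\<in>B. M g i l * M h l j)"
    and one: "\<And>i j. i \<in> B \<Longrightarrow> j \<in> B \<Longrightarrow> M \<one>\<^bsub>G\<^esub> i j = (if i = j then 1 else 0)"
    and \<rho>: "\<And>g. g \<in> carrier G \<Longrightarrow> \<rho> g = op_of B B (M g)"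
  shows "is_rep G B \<rho>"
proof -
  interpret group G by fact
  have comp: "\<rho> g (\<rho> h x) = \<rho> (g \<otimes>\<^bsub>G\<^esub> h) x" if "g \<in> carrier G" "h \<in> carrier G" "x \<in> free_space B" for g h x
    using that assms(2) mult by (auto simp: \<rho> op_of_comp op_of_apply fun_eq_iff intro!: sum.cong)
  have id: "\<rho> \<one>\<^bsub>G\<^esub> x = x" if "x \<in> free_space B" for x
    using that assms(2) one by (simp add: \<rho> op_of_id)
  have in_space: "\<rho> g x \<in> free_space B" if "g \<in> carrier G" "x \<in> free_space B" for g x
    using that by (simp add: \<rho> op_of_in)
  have bij: "bij_betw (\<rho> g) (free_space B) (free_space B)" if g: "g \<in> carrier G" for g
    by (rule bij_betw_byWitness[where f' = "\<rho> (inv\<^bsub>G\<^esub> g)"]) (use g in \<open>auto simp: comp id in_space\<close>)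
  have "\<rho> g \<in> carrier (GL B)" if g: "g \<in> carrier G" for g
    using bij[OF g] linear_on_op_of[of B B "M g"] g
    by (auto simp: GL_def Bij_def \<rho> extensional_def op_of_def)
  moreover have "\<rho> (g \<otimes>\<^bsub>G\<^esub> h) = \<rho> g \<otimes>\<^bsub>GL B\<^esub> \<rho> h" if "g \<in> carrier G" "h \<in> carrier G" for g h
  proof -
    have "\<rho> g \<otimes>\<^bsub>GL B\<^esub> \<rho> h = compose (free_space B) (\<rho> g) (\<rho> h)"
      using calculation[OF that(1)] calculation[OF that(2)] by (simp add: GL_def BijGroup_def)
    moreover have "\<rho> (g \<otimes>\<^bsub>G\<^esub> h) \<in> extensional (free_space B)"
      using that by (simp add: \<rho> op_of_def)
    ultimately show ?thesis
      using comp[OF that] by (intro extensionalityI[of _ "free_space B"]) (auto simp: compose_def)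
  qed
  ultimately show ?thesis using assms(2) by (auto simp: is_rep_def hom_def)
qed

text \<open>The algebraic closedness of the complex numbers enters Schur's lemma here: the
  characteristic polynomial has positive degree and therefore a root.\<close>

lemma eigenvector_exists:
  fixes M :: "nat \<Rightarrow> nat \<Rightarrow> complex"
  assumes "0 < d"
  shows "\<exists>c x. x \<in> free_space {..<d} \<and> x \<noteq> 0 \<and> (\<forall>i<d. (\<Sum>j<d. M i j * x j) = c * x i)"
proof -
  let ?A = "mat d d (\<lambda>(i,j). M i j)"
  have A: "?A \<in> carrier_mat d d" by simp
  have "degree (char_poly ?A) = d" using degree_monic_char_poly[OF A] by simp
  then have "\<not> constant (poly (char_poly ?A))" using assms by (simp add: constant_degree)
  then obtain c where "poly (char_poly ?A) c = 0" using fundamental_theorem_of_algebra by blast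
  then obtain v where v: "v \<in> carrier_vec d" "v \<noteq> 0\<^sub>v d" "?A *\<^sub>v v = c \<cdot>\<^sub>v v"
    using eigenvalue_root_char_poly[OF A] A by (auto simp: eigenvalue_def eigenvector_def)
  let ?x = "\<lambda>i. if i < d then v $ i else 0"
  have "?x \<noteq> 0"
  proof
    assume "?x = 0"
    then have "v $ i = 0" if "i < d" for i using that by (auto simp: fun_eq_iff split: if_splits)
    then have "v = 0\<^sub>v d" using v(1) by auto
    with v(2) show False by simp
  qed
  moreover have "(\<Sum>j<d. M i j * ?x j) = c * ?x i" if "i < d" for i
  proof -
    have "(?A *\<^sub>v v) $ i = (c \<cdot>\<^sub>v v) $ i" using v(3) by simp
    then show ?thesis using that v(1)
      by (simp add: scalar_prod_def lessThan_atLeast0 carrier_vecD)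
  qed
  ultimately show ?thesis by (intro exI[of _ c] exI[of _ ?x]) (auto simp: free_space_def)
qed

text \<open>Supplies the inverse \<open>P\<close> of an injective intertwiner \<open>Q\<close>; a
  second intertwiner \<open>Q'\<close> is then compared with \<open>Q\<close> through an eigenvector
  of \<open>P * Q'\<close>.\<close>

lemma inverse_of_injective:
  fixes Q :: "nat \<Rightarrow> nat \<Rightarrow> complex"
  assumes "\<And>x. x \<in> free_space {..<d} \<Longrightarrow> (\<forall>i<d. (\<Sum>j<d. Q i j * x j) = 0) \<Longrightarrow> x = 0"
  shows "\<exists>P. (\<forall>i<d. \<forall>j<d. (\<Sum>l<d. Q i l * P l j) = (if i = j then 1 else 0))"
proof -
  let ?A = "mat d d (\<lambda>(i,j). Q i j)"
  have A: "?A \<in> carrier_mat d d" by simp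
  have "det ?A \<noteq> 0"
  proof
    assume "det ?A = 0"
    then obtain v where v: "v \<in> carrier_vec d" "v \<noteq> 0\<^sub>v d" "?A *\<^sub>v v = 0\<^sub>v d"
      using det_0_iff_vec_prod_zero[OF A] by auto
    let ?x = "\<lambda>i. if i < d then v $ i else 0"
    have "(\<Sum>j<d. Q i j * ?x j) = 0" if "i < d" for i
    proof -
      have "(?A *\<^sub>v v) $ i = 0\<^sub>v d $ i" using v(3) by simp
      then show ?thesis using that v(1)
        by (simp add: scalar_prod_def lessThan_atLeast0 carrier_vecD)
    qed
    moreover have "?x \<in> free_space {..<d}" by (simp add: free_space_def)
    ultimately have "?x = 0" using assms by blast
    then have "v $ i = 0" if "i < d" for i using that by (auto simp: fun_eq_iff split: if_splits)
    then have "v = 0\<^sub>v d" using v(1) by auto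
    with v(2) show False by simp
  qed
  then have "?A \<in> Units (ring_mat TYPE(complex) d ())" by (rule det_non_zero_imp_unit[OF A])
  then obtain N where N: "N \<in> carrier_mat d d" "?A * N = 1\<^sub>m d"
    unfolding Units_def ring_mat_simps by blast
  have "(\<Sum>l<d. Q i l * N $$ (l, j)) = (if i = j then 1 else 0)" if "i < d" "j < d" for i j
  proof -
    have "(?A * N) $$ (i, j) = 1\<^sub>m d $$ (i, j)" by (simp only: N(2))
    then show ?thesis using that N(1)
      by (simp add: scalar_prod_def lessThan_atLeast0)
  qed
  then show ?thesis by (intro exI[of _ "\<lambda>l j. N $$ (l, j)"]) simp
qed

section \<open>Schur's lemma\<close>

text \<open>In matrix notation \<open>N g * A = A * M g\<close>. Here \<open>N\<close> is an
  arbitrary family of matrices, so that transposes such as the one in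
  \<open>twisted_frobenius_schur\<close> can be inserted directly.\<close>

definition intertwines :: "('g, 'm) monoid_scheme \<Rightarrow> 'c set \<Rightarrow> 'b set \<Rightarrow>
    ('g \<Rightarrow> 'c \<Rightarrow> 'c \<Rightarrow> complex) \<Rightarrow> ('g \<Rightarrow> 'b \<Rightarrow> 'b \<Rightarrow> complex) \<Rightarrow> ('c \<Rightarrow> 'b \<Rightarrow> complex) \<Rightarrow> bool" where
  "intertwines G C B N M A \<longleftrightarrow>
     (\<forall>g\<in>carrier G. \<forall>i\<in>C. \<forall>j\<in>B. (\<Sum>l\<in>C. N g i l * A l j) = (\<Sum>l\<in>B. A i l * M g l j))"

lemma intertwines_diff:
  assumes "intertwines G C B N M A" "intertwines G C B N M Y"
  shows "intertwines G C B N M (\<lambda>i j. Y i j - c * A i j)"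
proof -
  have "(\<Sum>l\<in>C. N g i l * (Y l j - c * A l j)) = (\<Sum>l\<in>B. (Y i l - c * A i l) * M g l j)"
    if "g \<in> carrier G" "i \<in> C" "j \<in> B" for g i j
  proof -
    have "(\<Sum>l\<in>C. N g i l * (Y l j - c * A l j)) = (\<Sum>l\<in>C. N g i l * Y l j) - c * (\<Sum>l\<in>C. N g i l * A l j)"
      by (simp add: sum_subtractf right_diff_distrib sum_distrib_left mult.left_commute)
    also have "\<dots> = (\<Sum>l\<in>B. Y i l * M g l j) - c * (\<Sum>l\<in>B. A i l * M g l j)"
      using assms that by (simp add: intertwines_def)
    finally show ?thesis by (simp add: sum_subtractf left_diff_distrib sum_distrib_left mult.assoc)
  qed
  then show ?thesis by (simp add: intertwines_def)
qed

locale irrep = group G for G :: "('g, 'm) monoid_scheme" (structure) +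
  fixes B :: "'b set" and \<rho>
  assumes irrep: "is_irrep G B \<rho>"

sublocale irrep \<subseteq> rep
  using irrep by unfold_locales (simp add: is_irrep_def)

lemma (in rep) intertwines_apply:
  assumes A: "intertwines G C B N (ent \<rho>) A" and "g \<in> carrier G" "i \<in> C" "x \<in> free_space B" "finite C"
  shows "(\<Sum>j\<in>B. A i j * \<rho> g x j) = (\<Sum>l\<in>C. N g i l * (\<Sum>k\<in>B. A l k * x k))"
proof -
  have "(\<Sum>j\<in>B. A i j * \<rho> g x j) = (\<Sum>k\<in>B. (\<Sum>j\<in>B. A i j * ent \<rho> g j k) * x k)"
    using assms(2,4) by (simp add: apply_ent sum_distrib_left sum_distrib_right mult.assoc) (rule sum.swap)
  also have "\<dots> = (\<Sum>k\<in>B. (\<Sum>l\<in>C. N g i l * A l k) * x k)"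
    using assms(2,3) A by (intro sum.cong) (auto simp: intertwines_def)
  also have "\<dots> = (\<Sum>l\<in>C. N g i l * (\<Sum>k\<in>B. A l k * x k))"
    by (simp add: sum_distrib_left sum_distrib_right mult.assoc) (rule sum.swap)
  finally show ?thesis .
qed

context irrep
begin

lemma invariant_subspace:
  assumes "cfun.subspace W" "W \<subseteq> free_space B" "\<And>g. g \<in> carrier G \<Longrightarrow> \<rho> g ` W \<subseteq> W"
  shows "W = {0} \<or> W = free_space B"
  using assms irrep by (simp add: is_irrep_def)

lemma nonempty: "B \<noteq> {}" using irrep by (simp add: is_irrep_def)

text \<open>The kernel of \<open>A\<close> is an invariant subspace. As it contains
  \<open>x\<close>, which is nonzero, it is the whole space.\<close>

lemma intertwiner_eq_zero:
  assumes A: "intertwines G C B N (ent \<rho>) A" and fC: "finite C"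
    and x: "x \<in> free_space B" "x \<noteq> 0" "\<And>i. i \<in> C \<Longrightarrow> (\<Sum>j\<in>B. A i j * x j) = 0"
    and "i \<in> C" "j \<in> B"
  shows "A i j = 0"
proof -
  define W where "W = {x \<in> free_space B. \<forall>i\<in>C. (\<Sum>j\<in>B. A i j * x j) = 0}"
  have "cfun.subspace W"
    using subspace_free_space[of B]
    by (auto simp: cfun.subspace_def W_def cscale_def distrib_left sum.distrib
         mult.left_commute[of _ c for c] simp flip: sum_distrib_left)
  moreover have "\<rho> g ` W \<subseteq> W" if "g \<in> carrier G" for g
    using that intertwines_apply[OF A that] fC closed_space[OF that] by (auto simp: W_def)
  ultimately have "W = {0} \<or> W = free_space B" by (intro invariant_subspace) (auto simp: W_def)
  moreover have "x \<in> W" using x by (simp add: W_def)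
  ultimately have "W = free_space B" using x(2) by blast
  then have "basis_vec j \<in> W" using assms by (simp add: basis_vec_in_free_space)
  then have "(\<Sum>k\<in>B. A i k * basis_vec j k) = 0" using assms by (simp add: W_def)
  moreover have "(\<Sum>k\<in>B. A i k * basis_vec j k) = A i j"
    using finite_index assms by (simp add: basis_vec_def if_distrib cong: if_cong)
  ultimately show ?thesis by simp
qed

end

text \<open>Since \<open>A\<close> is nonzero, irreducibility of the source makes its kernel
  trivial, and irreducibility of the target makes its image everything.\<close>

lemma rep_iso_of_intertwiner:
  assumes "irrep G B \<rho>" "irrep G C \<sigma>" and A: "intertwines G C B (ent \<sigma>) (ent \<rho>) A"
    and nz: "i0 \<in> C" "j0 \<in> B" "A i0 j0 \<noteq> 0"
  shows "rep_iso G B \<rho> C \<sigma>"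
proof -
  interpret B: irrep G B \<rho> by fact
  interpret C: irrep G C \<sigma> by fact
  let ?T = "op_of C B A"
  note lin = linear_on_op_of[of B C A]
  have comm: "?T (\<rho> g x) = \<sigma> g (?T x)" if "g \<in> carrier G" "x \<in> free_space B" for g x
  proof
    fix i
    show "?T (\<rho> g x) i = \<sigma> g (?T x) i"
    proof (cases "i \<in> C")
      case True
      then show ?thesis
        using B.intertwines_apply[OF A that(1) True that(2) C.finite_index] that
        by (simp add: op_of_apply B.closed_space C.apply_ent op_of_in)
    next
      case False
      then show ?thesis using that C.closed_space[OF that(1) op_of_in[OF that(2)]]
        by (simp add: op_of_apply B.closed_space) (simp add: free_space_def)
    qed
  qed
  have inj: "inj_on ?T (free_space B)"
  proof (rule inj_onI)
    fix x y assume xy: "x \<in> free_space B" "y \<in> free_space B" "?T x = ?T y"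
    have "x - y \<in> free_space B" using xy cfun.subspace_diff[OF subspace_free_space] by blast
    moreover have "(\<Sum>j\<in>B. A i j * (x - y) j) = 0" if "i \<in> C" for i
      using xy that op_of_apply[OF xy(1), of C A i] op_of_apply[OF xy(2), of C A i]
      by (simp add: right_diff_distrib sum_subtractf)
    ultimately have "x - y = 0"
      using B.intertwiner_eq_zero[OF A C.finite_index _ _ _ nz(1,2)] nz(3) by blast
    then show "x = y" by simp
  qed
  let ?W = "?T ` free_space B"
  have "cfun.subspace ?W"
  proof (rule cfun.subspaceI)
    show "0 \<in> ?W" using linear_on_zero[OF lin] cfun.subspace_0[OF subspace_free_space] by (metis imageI)
  next
    fix x y assume "x \<in> ?W" "y \<in> ?W"
    then obtain a b where ab: "a \<in> free_space B" "b \<in> free_space B" "x = ?T a" "y = ?T b" by blast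
    then have "x + y = ?T (a + b)" using lin by (simp add: linear_on_def del: plus_fun_apply)
    then show "x + y \<in> ?W" using ab cfun.subspace_add[OF subspace_free_space] by (metis imageI)
  next
    fix c x assume "x \<in> ?W"
    then obtain a where a: "a \<in> free_space B" "x = ?T a" by blast
    then have "cscale c x = ?T (cscale c a)" using lin by (simp add: linear_on_def)
    then show "cscale c x \<in> ?W" using a cfun.subspace_scale[OF subspace_free_space] by (metis imageI)
  qed
  moreover have "?W \<subseteq> free_space C" by (auto intro: op_of_in)
  moreover have "\<sigma> g ` ?W \<subseteq> ?W" if "g \<in> carrier G" for g
    using comm[OF that, symmetric] B.closed_space[OF that] by auto
  ultimately have "?W = {0} \<or> ?W = free_space C" by (rule C.invariant_subspace)
  moreover have "?T (basis_vec j0) \<in> ?W" "?T (basis_vec j0) \<noteq> 0"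
    using nz op_of_basis_vec[OF B.finite_index nz(2), of C A i0]
    by (auto simp: basis_vec_in_free_space)
  ultimately have "?W = free_space C" by blast
  then show ?thesis unfolding rep_iso_def using inj comm lin by (intro exI[of _ ?T]) (auto simp: bij_betw_def)
qed

text \<open>If \<open>c\<close> is an eigenvalue of \<open>Q^-1 * Q'\<close>, then
  \<open>Q' - c * Q\<close> is an intertwiner that kills an eigenvector, so it vanishes.\<close>

lemma intertwiners_proportional:
  fixes Q :: "nat \<Rightarrow> nat \<Rightarrow> complex"
  assumes "irrep G {..<d} \<rho>"
    and Q: "intertwines G {..<d} {..<d} N (ent \<rho>) Q" and Q': "intertwines G {..<d} {..<d} N (ent \<rho>) Q'"
    and nz: "i0 < d" "j0 < d" "Q i0 j0 \<noteq> 0"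
  shows "\<exists>c. \<forall>i<d. \<forall>j<d. Q' i j = c * Q i j"
proof -
  interpret irrep G "{..<d}" \<rho> by fact
  have "x = 0" if "x \<in> free_space {..<d}" "\<forall>i<d. (\<Sum>j<d. Q i j * x j) = 0" for x
    using intertwiner_eq_zero[OF Q finite_lessThan, of x i0 j0] that nz by auto
  then obtain P where P: "\<forall>i<d. \<forall>j<d. (\<Sum>l<d. Q i l * P l j) = (if i = j then 1 else 0)"
    using inverse_of_injective[of d Q] by blast
  obtain c x where x: "x \<in> free_space {..<d}" "x \<noteq> 0"
    "\<forall>i<d. (\<Sum>j<d. (\<Sum>l<d. P i l * Q' l j) * x j) = c * x i"
    using eigenvector_exists[of d "\<lambda>i j. \<Sum>l<d. P i l * Q' l j"] nz(1) by auto
  have "(\<Sum>j<d. (Q' i j - c * Q i j) * x j) = 0" if i: "i < d" for i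
  proof -
    \<comment> \<open>Apply \<open>Q\<close> to the eigenvector equation:
      \<open>c * Q x = Q P Q' x = Q' x\<close>.\<close>
    have "c * (\<Sum>j<d. Q i j * x j) = (\<Sum>j<d. Q i j * (\<Sum>k<d. (\<Sum>l<d. P j l * Q' l k) * x k))"
      using x(3) by (simp add: sum_distrib_left mult.left_commute)
    also have "\<dots> = (\<Sum>j<d. Q i j * (\<Sum>l<d. P j l * (\<Sum>k<d. Q' l k * x k)))"
    proof -
      have "(\<Sum>k<d. (\<Sum>l<d. P j l * Q' l k) * x k) = (\<Sum>l<d. P j l * (\<Sum>k<d. Q' l k * x k))" for j
        by (simp add: sum_distrib_left sum_distrib_right mult.assoc) (rule sum.swap)
      then show ?thesis by simp
    qed
    also have "\<dots> = (\<Sum>l<d. (\<Sum>j<d. Q i j * P j l) * (\<Sum>k<d. Q' l k * x k))"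
    proof -
      have "(\<Sum>j<d. Q i j * (\<Sum>l<d. P j l * y l)) = (\<Sum>l<d. (\<Sum>j<d. Q i j * P j l) * y l)" for y
        by (simp add: sum_distrib_left sum_distrib_right mult.assoc) (rule sum.swap)
      then show ?thesis .
    qed
    also have "\<dots> = (\<Sum>l<d. if l = i then \<Sum>k<d. Q' l k * x k else 0)"
      using P i by (intro sum.cong) auto
    also have "\<dots> = (\<Sum>k<d. Q' i k * x k)" using i by simp
    finally show ?thesis by (simp add: left_diff_distrib sum_subtractf sum_distrib_left mult.assoc)
  qed
  then have "Q' i j - c * Q i j = 0" if "i < d" "j < d" for i j
    using intertwiner_eq_zero[OF intertwines_diff[OF Q Q'] finite_lessThan, of x c i j] x that by auto
  then show ?thesis by (intro exI[of _ c]) auto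
qed

lemma (in group) sum_left_translate:
  assumes "h \<in> carrier G"
  shows "(\<Sum>g\<in>carrier G. f (h \<otimes> g)) = (\<Sum>g\<in>carrier G. f g)"
  using assms by (intro sum.reindex_bij_witness[of _ "\<lambda>g. inv h \<otimes> g" "\<lambda>g. h \<otimes> g"]) (auto simp flip: m_assoc)

lemma (in group) sum_right_translate:
  assumes "h \<in> carrier G"
  shows "(\<Sum>g\<in>carrier G. f (g \<otimes> h)) = (\<Sum>g\<in>carrier G. f g)"
  using assms by (intro sum.reindex_bij_witness[of _ "\<lambda>g. g \<otimes> inv h" "\<lambda>g. g \<otimes> h"]) (auto simp: m_assoc)

text \<open>This is the sum of \<open>\<sigma> g * E * \<rho> (g^-1)\<close> over the group, where
  \<open>E\<close> is the matrix unit at position \<open>(j, k)\<close>. Translation of the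
  summation variable proves the claim.\<close>

lemma intertwines_average:
  assumes "rep G C \<sigma>" "rep G B \<rho>" "j \<in> C" "k \<in> B"
  shows "intertwines G C B (ent \<sigma>) (ent \<rho>) (\<lambda>i l. \<Sum>g\<in>carrier G. ent \<sigma> g i j * ent \<rho> (inv\<^bsub>G\<^esub> g) k l)"
  unfolding intertwines_def
proof (intro ballI)
  interpret C: rep G C \<sigma> by fact
  interpret B: rep G B \<rho> by fact
  fix h i l assume h: "h \<in> carrier G" and il: "i \<in> C" "l \<in> B"
  let ?inv = "\<lambda>g. inv\<^bsub>G\<^esub> g" and ?m = "\<lambda>g h. g \<otimes>\<^bsub>G\<^esub> h"
  have "(\<Sum>m\<in>C. ent \<sigma> h i m * (\<Sum>g\<in>carrier G. ent \<sigma> g m j * ent \<rho> (?inv g) k l))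
      = (\<Sum>g\<in>carrier G. (\<Sum>m\<in>C. ent \<sigma> h i m * ent \<sigma> g m j) * ent \<rho> (?inv g) k l)"
    by (simp add: sum_distrib_left sum_distrib_right mult.assoc) (rule sum.swap)
  also have "\<dots> = (\<Sum>g\<in>carrier G. ent \<sigma> (?m h g) i j * ent \<rho> (?m (?inv (?m h g)) h) k l)"
    using h assms(3) by (intro sum.cong) (auto simp: C.ent_mult C.inv_mult_group C.m_assoc)
  also have "\<dots> = (\<Sum>g\<in>carrier G. ent \<sigma> g i j * ent \<rho> (?m (?inv g) h) k l)"
    by (rule C.sum_left_translate[OF h])
  also have "\<dots> = (\<Sum>g\<in>carrier G. ent \<sigma> g i j * (\<Sum>m\<in>B. ent \<rho> (?inv g) k m * ent \<rho> h m l))"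
    using h il by (intro sum.cong) (auto simp: B.ent_mult)
  also have "\<dots> = (\<Sum>m\<in>B. (\<Sum>g\<in>carrier G. ent \<sigma> g i j * ent \<rho> (?inv g) k m) * ent \<rho> h m l)"
    by (simp add: sum_distrib_left sum_distrib_right mult.assoc) (rule sum.swap)
  finally show "(\<Sum>m\<in>C. ent \<sigma> h i m * (\<Sum>g\<in>carrier G. ent \<sigma> g m j * ent \<rho> (?inv g) k l))
     = (\<Sum>m\<in>B. (\<Sum>g\<in>carrier G. ent \<sigma> g i j * ent \<rho> (?inv g) k m) * ent \<rho> h m l)" .
qed

section \<open>Orthogonality of characters\<close>

lemma trace_on_comp_commute:
  assumes "finite B" "finite C" "linear_on (free_space B) T" "linear_on (free_space C) S"
    "\<And>x. x \<in> free_space B \<Longrightarrow> T x \<in> free_space C" "\<And>y. y \<in> free_space C \<Longrightarrow> S y \<in> free_space B"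
  shows "trace_on B (\<lambda>x. S (T x)) = trace_on C (\<lambda>y. T (S y))"
proof -
  have "trace_on B (\<lambda>x. S (T x)) = (\<Sum>b\<in>B. \<Sum>c\<in>C. S (basis_vec c) b * T (basis_vec b) c)"
    using assms by (simp add: trace_on_def linear_on_apply[OF assms(4,2)] basis_vec_in_free_space)
  also have "\<dots> = (\<Sum>c\<in>C. \<Sum>b\<in>B. T (basis_vec b) c * S (basis_vec c) b)"
    by (subst sum.swap) (simp add: mult.commute)
  also have "\<dots> = trace_on C (\<lambda>y. T (S y))"
    using assms by (simp add: trace_on_def linear_on_apply[OF assms(3,1)] basis_vec_in_free_space)
  finally show ?thesis .
qed

lemma rep_iso_trace_eq:
  assumes "rep G B \<rho>" "rep G C \<sigma>" "rep_iso G B \<rho> C \<sigma>" and g: "g \<in> carrier G"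
  shows "trace_on B (\<rho> g) = trace_on C (\<sigma> g)"
proof -
  interpret B: rep G B \<rho> by fact
  interpret C: rep G C \<sigma> by fact
  obtain T where bij: "bij_betw T (free_space B) (free_space C)" and lin: "linear_on (free_space B) T"
    and comm: "\<And>x. x \<in> free_space B \<Longrightarrow> T (\<rho> g x) = \<sigma> g (T x)"
    using assms(3) g unfolding rep_iso_def by blast
  define S where "S = inv_into (free_space B) T"
  have S_in: "S y \<in> free_space B" and TS: "T (S y) = y" if "y \<in> free_space C" for y
    using that bij unfolding S_def
    by (auto simp: bij_betw_def inv_into_into f_inv_into_f)
  have ST: "S (T x) = x" if "x \<in> free_space B" for x
    using that bij by (simp add: S_def bij_betw_def)
  have T_in: "T x \<in> free_space C" if "x \<in> free_space B" for x using that bij bij_betwE by blast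
  have S_lin: "linear_on (free_space C) S"
    unfolding linear_on_def
  proof (intro conjI ballI allI)
    fix x y assume xy: "x \<in> free_space C" "y \<in> free_space C"
    then have "x + y = T (S x + S y)" using lin S_in TS by (simp add: linear_on_def del: plus_fun_apply)
    then show "S (x + y) = S x + S y"
      using ST xy S_in cfun.subspace_add[OF subspace_free_space] by metis
  next
    fix c y assume y: "y \<in> free_space C"
    then have "cscale c y = T (cscale c (S y))" using lin S_in TS by (simp add: linear_on_def)
    then show "S (cscale c y) = cscale c (S y)"
      using ST y S_in cfun.subspace_scale[OF subspace_free_space] by metis
  qed
  have "linear_on (free_space B) (\<lambda>x. \<sigma> g (T x))"
    using lin C.lin[OF g] T_in by (auto simp: linear_on_def simp del: plus_fun_apply)
  then have "trace_on B (\<lambda>x. S (\<sigma> g (T x))) = trace_on C (\<lambda>y. \<sigma> g (T (S y)))"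
    using trace_on_comp_commute[OF B.finite_index C.finite_index _ S_lin] T_in S_in C.closed_space[OF g] by blast
  moreover have "trace_on B (\<lambda>x. S (\<sigma> g (T x))) = trace_on B (\<rho> g)"
    using ST B.closed_space[OF g] by (simp add: trace_on_def basis_vec_in_free_space flip: comm)
  moreover have "trace_on C (\<lambda>y. \<sigma> g (T (S y))) = trace_on C (\<sigma> g)"
    using TS by (simp add: trace_on_def basis_vec_in_free_space)
  ultimately show ?thesis by simp
qed

text \<open>Every product of diagonal entries sums to an entry of an averaged intertwiner, and a
  nonzero entry would yield an isomorphism.\<close>

lemma character_orthogonal:
  assumes "irrep G B \<rho>" "irrep G C \<sigma>" "\<not> rep_iso G B \<rho> C \<sigma>"
  shows "(\<Sum>g\<in>carrier G. trace_on C (\<sigma> g) * trace_on B (\<rho> (inv\<^bsub>G\<^esub> g))) = 0"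
proof -
  interpret B: irrep G B \<rho> by fact
  interpret C: irrep G C \<sigma> by fact
  have "(\<Sum>g\<in>carrier G. ent \<sigma> g i i * ent \<rho> (inv\<^bsub>G\<^esub> g) k k) = 0" if "i \<in> C" "k \<in> B" for i k
    using rep_iso_of_intertwiner[OF assms(1,2) intertwines_average[OF C.rep_axioms B.rep_axioms that], of i k]
      that assms(3) by blast
  then have "(\<Sum>i\<in>C. \<Sum>k\<in>B. \<Sum>g\<in>carrier G. ent \<sigma> g i i * ent \<rho> (inv\<^bsub>G\<^esub> g) k k) = 0" by simp
  moreover have "(\<Sum>g\<in>carrier G. trace_on C (\<sigma> g) * trace_on B (\<rho> (inv\<^bsub>G\<^esub> g)))
     = (\<Sum>i\<in>C. \<Sum>k\<in>B. \<Sum>g\<in>carrier G. ent \<sigma> g i i * ent \<rho> (inv\<^bsub>G\<^esub> g) k k)"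
    unfolding C.trace_ent B.trace_ent sum_product
    by (subst sum.swap, rule sum.cong[OF refl], rule sum.swap)
  ultimately show ?thesis by simp
qed

text \<open>The identity is an intertwiner, so each average \<open>A j k\<close> is a scalar matrix
  with some factor \<open>c j k\<close>. Taking the trace of \<open>A j j\<close> shows that
  \<open>d * c j j\<close> is the group order, and the norm is the sum of the
  \<open>c i i\<close>.\<close>

lemma character_norm:
  assumes "irrep G {..<d::nat} \<rho>"
  shows "(\<Sum>g\<in>carrier G. trace_on {..<d} (\<rho> g) * trace_on {..<d} (\<rho> (inv\<^bsub>G\<^esub> g))) = of_nat (card (carrier G))"
proof -
  interpret irrep G "{..<d}" \<rho> by fact
  define A where "A = (\<lambda>j k i l. \<Sum>g\<in>carrier G. ent \<rho> g i j * ent \<rho> (inv\<^bsub>G\<^esub> g) k l)"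
  have d: "0 < d" using nonempty by (cases d) auto
  have A: "intertwines G {..<d} {..<d} (ent \<rho>) (ent \<rho>) (A j k)" if "j < d" "k < d" for j k
    using intertwines_average[OF rep_axioms rep_axioms, of j k] that by (simp add: A_def)
  have I: "intertwines G {..<d} {..<d} (ent \<rho>) (ent \<rho>) (\<lambda>i j. if i = j then 1 else 0)"
    by (auto simp: intertwines_def if_distrib[of "(*) _"] if_distrib[of "\<lambda>x. x * _"] cong: if_cong)
  have "\<exists>c. \<forall>i<d. \<forall>l<d. A j k i l = c * (if i = l then 1 else 0)" if "j < d" "k < d" for j k
    using intertwiners_proportional[OF assms I A[OF that], of 0 0] d by simp
  then obtain c where c: "\<And>j k i l. j < d \<Longrightarrow> k < d \<Longrightarrow> i < d \<Longrightarrow> l < d \<Longrightarrow>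
      A j k i l = c j k * (if i = l then 1 else 0)" by metis
  have cjj: "of_nat d * c j j = of_nat (card (carrier G))" if j: "j < d" for j
  proof -
    have "of_nat d * c j j = (\<Sum>i<d. A j j i i)" using c j by simp
    also have "\<dots> = (\<Sum>g\<in>carrier G. \<Sum>i<d. ent \<rho> (inv\<^bsub>G\<^esub> g) j i * ent \<rho> g i j)"
      unfolding A_def by (subst sum.swap) (simp add: mult.commute)
    also have "\<dots> = (\<Sum>g\<in>carrier G. ent \<rho> (inv\<^bsub>G\<^esub> g \<otimes>\<^bsub>G\<^esub> g) j j)"
      using j by (intro sum.cong refl) (simp add: ent_mult[symmetric])
    also have "\<dots> = of_nat (card (carrier G))" using j by (simp add: ent_one)
    finally show ?thesis .
  qed
  have "(\<Sum>g\<in>carrier G. trace_on {..<d} (\<rho> g) * trace_on {..<d} (\<rho> (inv\<^bsub>G\<^esub> g)))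
      = (\<Sum>i<d. \<Sum>k<d. A i k i k)"
    unfolding trace_ent sum_product A_def
    by (subst sum.swap, rule sum.cong[OF refl], rule sum.swap)
  also have "\<dots> = (\<Sum>i<d. \<Sum>k<d. if i = k then c i i else 0)"
    using c by (intro sum.cong) auto
  also have "\<dots> = (\<Sum>i<d. c i i)" by simp
  also have "\<dots> = (\<Sum>i<d. of_nat (card (carrier G)) / of_nat d)"
    using cjj d by (intro sum.cong refl) (simp add: field_simps)
  also have "\<dots> = of_nat (card (carrier G))" using d by simp
  finally show ?thesis .
qed

text \<open>
  The twisted Frobenius--Schur indicator is \<open>\<plusminus>1\<close>: if \<open>\<tau> g\<close> is conjugate to \<open>g\<^sup>-\<^sup>1\<close>, then up to
  a factor there is exactly one bilinear form \<open>Q\<close> with \<open>Q (\<rho> (\<tau> g) x) (\<rho> g y) = Q x y\<close>, so that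
  its transpose is \<open>\<plusminus>Q\<close>.
\<close>
lemma twisted_frobenius_schur:
  assumes "irrep G {..<d::nat} \<rho>" and fin: "finite (carrier G)"
    and \<tau>: "\<tau> \<in> hom G G" "\<And>g. g \<in> carrier G \<Longrightarrow> \<tau> (\<tau> g) = g"
    and conj: "\<And>g. g \<in> carrier G \<Longrightarrow> \<exists>h\<in>carrier G. h \<otimes>\<^bsub>G\<^esub> inv\<^bsub>G\<^esub> g = \<tau> g \<otimes>\<^bsub>G\<^esub> h"
  shows "\<exists>c\<in>{1, -1}. (\<Sum>h\<in>carrier G. trace_on {..<d} (\<rho> (h \<otimes>\<^bsub>G\<^esub> \<tau> h))) = c * of_nat (card (carrier G))"
proof -
  interpret irrep G "{..<d}" \<rho> by fact
  have \<tau>_in: "\<tau> g \<in> carrier G" if "g \<in> carrier G" for g using \<tau>(1) that by (auto simp: hom_def)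
  have \<tau>_mult: "\<tau> (g \<otimes>\<^bsub>G\<^esub> h) = \<tau> g \<otimes>\<^bsub>G\<^esub> \<tau> h" if "g \<in> carrier G" "h \<in> carrier G" for g h
    using \<tau>(1) that by (auto simp: hom_def)
  have sum_\<tau>: "(\<Sum>g\<in>carrier G. f (\<tau> g)) = (\<Sum>g\<in>carrier G. f g)" for f :: "_ \<Rightarrow> complex"
    by (intro sum.reindex_bij_witness[of _ \<tau> \<tau>]) (auto simp: \<tau> \<tau>_in)
  have trace_\<tau>: "trace_on {..<d} (\<rho> (\<tau> g)) = trace_on {..<d} (\<rho> (inv\<^bsub>G\<^esub> g))" if g: "g \<in> carrier G" for g
  proof -
    obtain h where h: "h \<in> carrier G" "h \<otimes>\<^bsub>G\<^esub> inv\<^bsub>G\<^esub> g = \<tau> g \<otimes>\<^bsub>G\<^esub> h" using conj[OF g] by blast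
    then have \<tau>g: "\<tau> g = h \<otimes>\<^bsub>G\<^esub> inv\<^bsub>G\<^esub> g \<otimes>\<^bsub>G\<^esub> inv\<^bsub>G\<^esub> h"
      using g \<tau>_in[OF g] by (simp add: m_assoc)
    have "trace_on {..<d} (\<rho> (\<tau> g)) = (\<Sum>i<d. \<Sum>l<d. ent \<rho> (h \<otimes>\<^bsub>G\<^esub> inv\<^bsub>G\<^esub> g) i l * ent \<rho> (inv\<^bsub>G\<^esub> h) l i)"
      using h g by (simp add: trace_ent \<tau>g ent_mult)
    also have "\<dots> = (\<Sum>l<d. \<Sum>i<d. ent \<rho> (inv\<^bsub>G\<^esub> h) l i * ent \<rho> (h \<otimes>\<^bsub>G\<^esub> inv\<^bsub>G\<^esub> g) i l)"
      by (subst sum.swap) (simp add: mult.commute)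
    also have "\<dots> = (\<Sum>l<d. ent \<rho> (inv\<^bsub>G\<^esub> h \<otimes>\<^bsub>G\<^esub> (h \<otimes>\<^bsub>G\<^esub> inv\<^bsub>G\<^esub> g)) l l)"
      using h(1) g by (intro sum.cong refl) (simp add: ent_mult[of "inv\<^bsub>G\<^esub> h"])
    also have "\<dots> = trace_on {..<d} (\<rho> (inv\<^bsub>G\<^esub> g))"
      using h(1) g by (simp add: trace_ent flip: m_assoc)
    finally show ?thesis .
  qed
  \<comment> \<open>For fixed \<open>j\<close> and \<open>k\<close> this is the matrix of the
    bilinear form obtained by averaging the product of the \<open>j\<close>-th coordinate of
    \<open>\<rho> (\<tau> g) x\<close> and the \<open>k\<close>-th coordinate of
    \<open>\<rho> g y\<close>.\<close>
  define A where "A j k i l = (\<Sum>g\<in>carrier G. ent \<rho> (\<tau> g) j i * ent \<rho> g k l)" for j k i l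
  have A_swap: "A j k i l = A k j l i" for j k i l
    unfolding A_def by (subst sum_\<tau>[symmetric]) (simp add: \<tau> mult.commute)
  \<comment> \<open>Invariance of the form, written as an intertwining relation: on the left stands
    the transpose of the matrix of \<open>\<tau> (h^-1)\<close>.\<close>
  have A: "intertwines G {..<d} {..<d} (\<lambda>h i l. ent \<rho> (\<tau> (inv\<^bsub>G\<^esub> h)) l i) (ent \<rho>) (A j k)"
    if jk: "j < d" "k < d" for j k
    unfolding intertwines_def
  proof (intro ballI)
    fix h i l assume h: "h \<in> carrier G" and il: "i \<in> {..<d}" "l \<in> {..<d}"
    have "(\<Sum>m<d. ent \<rho> (\<tau> (inv\<^bsub>G\<^esub> h)) m i * A j k m l)
        = (\<Sum>g\<in>carrier G. (\<Sum>m<d. ent \<rho> (\<tau> g) j m * ent \<rho> (\<tau> (inv\<^bsub>G\<^esub> h)) m i) * ent \<rho> g k l)"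
      unfolding A_def sum_distrib_left sum_distrib_right by (subst sum.swap) (simp add: mult_ac)
    also have "\<dots> = (\<Sum>g\<in>carrier G. ent \<rho> (\<tau> (g \<otimes>\<^bsub>G\<^esub> inv\<^bsub>G\<^esub> h)) j i * ent \<rho> g k l)"
      using h il by (intro sum.cong) (auto simp: ent_mult \<tau>_mult \<tau>_in)
    also have "\<dots> = (\<Sum>g\<in>carrier G. ent \<rho> (\<tau> (g \<otimes>\<^bsub>G\<^esub> h \<otimes>\<^bsub>G\<^esub> inv\<^bsub>G\<^esub> h)) j i * ent \<rho> (g \<otimes>\<^bsub>G\<^esub> h) k l)"
      by (rule sum_right_translate[OF h, symmetric])
    also have "\<dots> = (\<Sum>g\<in>carrier G. ent \<rho> (\<tau> g) j i * (\<Sum>m<d. ent \<rho> g k m * ent \<rho> h m l))"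
      using h il by (intro sum.cong) (auto simp: ent_mult m_assoc)
    also have "\<dots> = (\<Sum>m<d. A j k i m * ent \<rho> h m l)"
      unfolding A_def sum_distrib_left sum_distrib_right by (subst sum.swap) (simp add: mult_ac)
    finally show "(\<Sum>m<d. ent \<rho> (\<tau> (inv\<^bsub>G\<^esub> h)) m i * A j k m l) = (\<Sum>m<d. A j k i m * ent \<rho> h m l)" .
  qed
  \<comment> \<open>Conjugacy of \<open>\<tau> g\<close> to the inverse of \<open>g\<close> turns
    this sum into the norm of the character; being nonzero, it provides a nonzero form
    \<open>A j0 k0\<close>.\<close>
  have card: "(\<Sum>j<d. \<Sum>k<d. A j k j k) = of_nat (card (carrier G))"
  proof -
    have "(\<Sum>j<d. \<Sum>k<d. A j k j k) = (\<Sum>g\<in>carrier G. trace_on {..<d} (\<rho> (\<tau> g)) * trace_on {..<d} (\<rho> g))"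
      unfolding trace_ent sum_product A_def
      by (subst (2) sum.swap, rule sum.cong[OF refl], rule sum.swap)
    also have "\<dots> = (\<Sum>g\<in>carrier G. trace_on {..<d} (\<rho> g) * trace_on {..<d} (\<rho> (inv\<^bsub>G\<^esub> g)))"
      by (intro sum.cong refl) (simp add: trace_\<tau>)
    also have "\<dots> = of_nat (card (carrier G))" by (rule character_norm[OF assms(1)])
    finally show ?thesis .
  qed
  have "carrier G \<noteq> {}" by blast
  then have "(\<Sum>j<d. \<Sum>k<d. A j k j k) \<noteq> 0" using card fin by simp
  then obtain j0 where "j0 \<in> {..<d}" "(\<Sum>k<d. A j0 k j0 k) \<noteq> 0" by (meson sum.neutral)
  moreover from this obtain k0 where "k0 \<in> {..<d}" "A j0 k0 j0 k0 \<noteq> 0" by (meson sum.neutral)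
  ultimately have jk0: "j0 < d" "k0 < d" "A j0 k0 j0 k0 \<noteq> 0" by auto
  have "\<exists>c. \<forall>i<d. \<forall>l<d. A j k i l = c * A j0 k0 i l" if "j < d" "k < d" for j k
    by (rule intertwiners_proportional[OF assms(1) A[OF jk0(1,2)] A[OF that] jk0])
  then obtain c where c: "\<And>j k i l. j < d \<Longrightarrow> k < d \<Longrightarrow> i < d \<Longrightarrow> l < d \<Longrightarrow>
      A j k i l = c j k * A j0 k0 i l" by metis
  \<comment> \<open>Transposing \<open>A j0 k0\<close> gives \<open>A k0 j0\<close> by
    \<open>A_swap\<close>, which is \<open>s\<close> times \<open>A j0 k0\<close>. Transposing twice
    gives \<open>s * s = 1\<close>, and the same factor carries the norm sum over into the
    indicator.\<close>
  define s where "s = c k0 j0"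
  have s: "A j0 k0 l i = s * A j0 k0 i l" if "i < d" "l < d" for i l
    using A_swap[of j0 k0 l i] c[OF jk0(2,1) that] by (simp add: s_def)
  have "A j0 k0 j0 k0 = s * s * A j0 k0 j0 k0"
    using s[of k0 j0] s[of j0 k0] jk0(1,2) by (metis mult.assoc)
  then have "s * s = 1" using jk0(3) by simp
  then have "s \<in> {1, -1}" by (simp add: square_eq_1_iff)
  moreover have "(\<Sum>h\<in>carrier G. trace_on {..<d} (\<rho> (h \<otimes>\<^bsub>G\<^esub> \<tau> h))) = s * of_nat (card (carrier G))"
  proof -
    have "(\<Sum>h\<in>carrier G. trace_on {..<d} (\<rho> (h \<otimes>\<^bsub>G\<^esub> \<tau> h)))
        = (\<Sum>h\<in>carrier G. \<Sum>i<d. \<Sum>j<d. ent \<rho> h i j * ent \<rho> (\<tau> h) j i)"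
      by (intro sum.cong refl) (simp add: trace_ent ent_mult \<tau>_in)
    also have "\<dots> = (\<Sum>i<d. \<Sum>j<d. A j i i j)"
      unfolding A_def by (subst sum.swap, rule sum.cong[OF refl], subst sum.swap) (simp add: mult.commute)
    also have "\<dots> = (\<Sum>i<d. \<Sum>j<d. s * A j i j i)"
    proof (intro sum.cong refl)
      fix i j assume "i \<in> {..<d}" "j \<in> {..<d}"
      then have "i < d" "j < d" by auto
      then have "A j i i j = c j i * (s * A j0 k0 j i)" "A j i j i = c j i * A j0 k0 j i"
        using c s by metis+
      then show "A j i i j = s * A j i j i" by (simp only: mult.left_commute)
    qed
    also have "\<dots> = s * (\<Sum>j<d. \<Sum>k<d. A j k j k)"
      by (subst sum.swap) (simp add: sum_distrib_left)
    finally show ?thesis by (simp add: card)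
  qed
  ultimately show ?thesis by blast
qed

section \<open>A criterion for models\<close>

lemma repI: "group G \<Longrightarrow> is_rep G B \<rho> \<Longrightarrow> rep G B \<rho>"
  by (simp add: rep_def rep_axioms_def)

lemma irrepI: "group G \<Longrightarrow> is_irrep G B \<rho> \<Longrightarrow> irrep G B \<rho>"
  by (simp add: irrep_def irrep_axioms_def)

text \<open>Renumbers the index set, because the irreducible representations in
  \<open>irrep_reps\<close> live on bases of the form \<open>{..<d}\<close>.\<close>

lemma rep_of_matrices:
  assumes "group G" "finite S"
    and mult: "\<And>g h a b. g \<in> carrier G \<Longrightarrow> h \<in> carrier G \<Longrightarrow> a \<in> S \<Longrightarrow> b \<in> S \<Longrightarrow>
       M (g \<otimes>\<^bsub>G\<^esub> h) a b = (\<Sum>l\<in>S. M g a l * M h l b)"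
    and one: "\<And>a b. a \<in> S \<Longrightarrow> b \<in> S \<Longrightarrow> M \<one>\<^bsub>G\<^esub> a b = (if a = b then 1 else 0)"
  shows "\<exists>\<sigma>. is_rep G {..<card S} \<sigma> \<and> (\<forall>g. trace_on {..<card S} (\<sigma> g) = (\<Sum>a\<in>S. M g a a))"
proof -
  obtain f where f: "bij_betw f {..<card S} S"
    using ex_bij_betw_nat_finite[OF assms(2)] by (auto simp: lessThan_atLeast0)
  then have fS: "f i \<in> S" if "i < card S" for i using that bij_betwE by fastforce
  have f_eq: "f i = f j \<longleftrightarrow> i = j" if "i < card S" "j < card S" for i j
    using f that by (auto simp: bij_betw_def inj_on_eq_iff)
  define \<sigma> where "\<sigma> g = op_of {..<card S} {..<card S} (\<lambda>i j. M g (f i) (f j))" for g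
  have "M (g \<otimes>\<^bsub>G\<^esub> h) (f i) (f j) = (\<Sum>l<card S. M g (f i) (f l) * M h (f l) (f j))"
    if "g \<in> carrier G" "h \<in> carrier G" "i < card S" "j < card S" for g h i j
    using mult[OF that(1,2) fS[OF that(3)] fS[OF that(4)]]
      sum.reindex_bij_betw[OF f, of "\<lambda>l. M g (f i) l * M h l (f j)"] by simp
  then have "is_rep G {..<card S} \<sigma>"
    by (intro is_rep_op_of[OF assms(1), where M = "\<lambda>g i j. M g (f i) (f j)"])
      (auto simp: \<sigma>_def one fS f_eq)
  moreover have "trace_on {..<card S} (\<sigma> g) = (\<Sum>a\<in>S. M g a a)" for g
  proof -
    have "trace_on {..<card S} (\<sigma> g) = (\<Sum>i<card S. M g (f i) (f i))"
      by (simp add: trace_on_def \<sigma>_def op_of_basis_vec)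
    also have "\<dots> = (\<Sum>a\<in>S. M g a a)" by (rule sum.reindex_bij_betw[OF f])
    finally show ?thesis .
  qed
  ultimately show ?thesis by (intro exI[of _ \<sigma>] conjI allI)
qed

text \<open>In a basis \<open>S\<close> of the space that extends a basis \<open>S1\<close> of
  \<open>W\<close>, all matrices are block triangular. The diagonal blocks describe \<open>W\<close>
  and the quotient by \<open>W\<close>, and the trace is the sum of their traces.\<close>

lemma split_invariant_subspace:
  assumes "group G" "is_rep G B \<rho>" and W: "cfun.subspace W" "W \<subseteq> free_space B" "\<And>g. g \<in> carrier G \<Longrightarrow> \<rho> g ` W \<subseteq> W"
    and proper: "W \<noteq> {0}" "W \<noteq> free_space B"
  shows "\<exists>d e \<sigma> \<tau>. d < card B \<and> e < card B \<and> is_rep G {..<d::nat} \<sigma> \<and> is_rep G {..<e::nat} \<tau> \<and>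
     (\<forall>g\<in>carrier G. trace_on B (\<rho> g) = trace_on {..<d} (\<sigma> g) + trace_on {..<e} (\<tau> g))"
proof -
  interpret rep G B \<rho> by (rule repI) fact+
  obtain S1 where S1: "S1 \<subseteq> W" "cfun.independent S1" "W \<subseteq> cfun.span S1"
    using cfun.maximal_independent_subset by blast
  obtain S where S: "S1 \<subseteq> S" "S \<subseteq> free_space B" "cfun.independent S" "free_space B \<subseteq> cfun.span S"
    by (elim cfun.maximal_independent_subset_extend[OF order_trans[OF S1(1) W(2)] S1(2)])
  have "x \<in> cfun.span (basis_vec ` B)" if "x \<in> free_space B" for x
  proof -
    have "(\<Sum>b\<in>B. cscale (x b) (basis_vec b)) \<in> cfun.span (basis_vec ` B)"
      by (intro cfun.span_sum cfun.span_scale cfun.span_base) auto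
    then show ?thesis using free_space_expand[OF finite_index that] by simp
  qed
  then have "S \<subseteq> cfun.span (basis_vec ` B)" using S(2) by blast
  then have "finite S \<and> card S \<le> card (basis_vec ` B)"
    using cfun.independent_span_bound[of "basis_vec ` B" S] finite_index S(3) by blast
  then have finS: "finite S" and cardS: "card S \<le> card B"
    using card_image_le[OF finite_index, of basis_vec] by auto
  have "S1 \<noteq> {}" using S1(3) proper(1) cfun.subspace_0[OF W(1)] by auto
  moreover have "S1 \<noteq> S"
    using S1(1) S(4) cfun.span_minimal[OF S1(1) W(1)] W(2) proper(2) by auto
  ultimately have card1: "card S1 < card S" and card2: "card (S - S1) < card S"
    using psubset_card_mono[OF finS] S(1) by blast+
  define M where "M g b c = cfun.representation S (\<rho> g c) b" for g b c
  have in_span: "\<rho> g c \<in> cfun.span S" if "g \<in> carrier G" "c \<in> S" for g c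
    using that closed_space S(2,4) by blast
  have expand: "(\<Sum>b\<in>S. cscale (cfun.representation S x b) b) = x" if "x \<in> free_space B" for x
    using that S(3,4) finS cfun.sum_representation_eq[of S x S] by auto
  have mult: "M (g \<otimes>\<^bsub>G\<^esub> h) b c = (\<Sum>l\<in>S. M g b l * M h l c)"
    if "g \<in> carrier G" "h \<in> carrier G" "c \<in> S" for g h b c
  proof -
    have "\<rho> (g \<otimes>\<^bsub>G\<^esub> h) c = \<rho> g (\<rho> h c)" using that S(2) mult_apply by blast
    also have "\<dots> = \<rho> g (\<Sum>l\<in>S. cscale (M h l c) l)"
      using expand[of "\<rho> h c"] that S(2) closed_space by (simp add: M_def subset_iff)
    also have "\<dots> = (\<Sum>l\<in>S. cscale (M h l c) (\<rho> g l))"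
      by (rule linear_on_sum[OF lin[OF that(1)] subspace_free_space]) (use S(2) in blast)
    finally have "M (g \<otimes>\<^bsub>G\<^esub> h) b c = cfun.representation S (\<Sum>l\<in>S. cscale (M h l c) (\<rho> g l)) b"
      by (simp add: M_def)
    also have "\<dots> = (\<Sum>l\<in>S. cfun.representation S (cscale (M h l c) (\<rho> g l)) b)"
      using S(3) in_span[OF that(1)] by (simp add: cfun.representation_sum cfun.span_scale)
    also have "\<dots> = (\<Sum>l\<in>S. M g b l * M h l c)"
      using S(3) in_span[OF that(1)]
      by (intro sum.cong refl) (simp add: cfun.representation_scale M_def mult.commute)
    finally show ?thesis .
  qed
  have one: "M \<one>\<^bsub>G\<^esub> b c = (if b = c then 1 else 0)" if "b \<in> S" "c \<in> S" for b c
    using that S(2,3) by (simp add: M_def one_apply cfun.representation_basis subset_iff)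
  have block: "M g b c = 0" if "g \<in> carrier G" "b \<in> S - S1" "c \<in> S1" for g b c
  proof -
    have "\<rho> g c \<in> cfun.span S1" using that W(3) S1(1,3) by blast
    then have "M g b c = cfun.representation S1 (\<rho> g c) b"
      using cfun.representation_extend[OF S(3) _ S(1)] by (simp add: M_def)
    then show ?thesis using cfun.representation_ne_zero[of S1] that(2) by auto
  qed
  have "M (g \<otimes>\<^bsub>G\<^esub> h) b c = (\<Sum>l\<in>S1. M g b l * M h l c)"
    if "g \<in> carrier G" "h \<in> carrier G" "b \<in> S1" "c \<in> S1" for g h b c
  proof -
    have "M (g \<otimes>\<^bsub>G\<^esub> h) b c = (\<Sum>l\<in>S. M g b l * M h l c)" using mult that S(1) by blast
    then show ?thesis using block[OF that(2) _ that(4)]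
        sum.mono_neutral_right[OF finS S(1), of "\<lambda>l. M g b l * M h l c"] by simp
  qed
  moreover have finS1: "finite S1" using finS S(1) finite_subset by blast
  moreover have "M \<one>\<^bsub>G\<^esub> a b = (if a = b then 1 else 0)" if "a \<in> S1" "b \<in> S1" for a b
    using one that S(1) by blast
  ultimately have "\<exists>\<sigma>. is_rep G {..<card S1} \<sigma> \<and> (\<forall>g. trace_on {..<card S1} (\<sigma> g) = (\<Sum>a\<in>S1. M g a a))"
    by (intro rep_of_matrices is_group)
  then obtain \<sigma> where \<sigma>: "is_rep G {..<card S1} \<sigma>" "\<And>g. trace_on {..<card S1} (\<sigma> g) = (\<Sum>a\<in>S1. M g a a)"
    by (elim exE conjE) (rule that, assumption, rule spec)
  have "M (g \<otimes>\<^bsub>G\<^esub> h) b c = (\<Sum>l\<in>S - S1. M g b l * M h l c)"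
    if "g \<in> carrier G" "h \<in> carrier G" "b \<in> S - S1" "c \<in> S - S1" for g h b c
  proof -
    have "M (g \<otimes>\<^bsub>G\<^esub> h) b c = (\<Sum>l\<in>S. M g b l * M h l c)" using mult that by blast
    then show ?thesis
      using block[OF that(1,3)]
        sum.mono_neutral_right[OF finS Diff_subset, of S1 "\<lambda>l. M g b l * M h l c"] by auto
  qed
  then have "\<exists>\<tau>. is_rep G {..<card (S - S1)} \<tau> \<and>
      (\<forall>g. trace_on {..<card (S - S1)} (\<tau> g) = (\<Sum>a\<in>S - S1. M g a a))"
    by (intro rep_of_matrices is_group) (use one finS in auto)
  then obtain \<tau> where \<tau>: "is_rep G {..<card (S - S1)} \<tau>"
      "\<And>g. trace_on {..<card (S - S1)} (\<tau> g) = (\<Sum>a\<in>S - S1. M g a a)"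
    by (elim exE conjE) (rule that, assumption, rule spec)
  have "trace_on B (\<rho> g) = (\<Sum>a\<in>S. M g a a)" if g: "g \<in> carrier G" for g
  proof -
    have basis_span: "basis_vec j \<in> cfun.span S" if "j \<in> B" for j
      by (rule subsetD[OF S(4) basis_vec_in_free_space[OF that]])
    \<comment> \<open>Change of basis for the trace: expand the vectors \<open>basis_vec j\<close>
      in \<open>S\<close>, exchange the sums, and collect the coordinates of
      \<open>\<rho> g b\<close>.\<close>
    have "trace_on B (\<rho> g) = (\<Sum>j\<in>B. \<Sum>b\<in>S. cfun.representation S (basis_vec j) b * \<rho> g b j)"
    proof (unfold trace_on_def, rule sum.cong[OF refl])
      fix j assume j: "j \<in> B"
      have "\<rho> g (basis_vec j) = \<rho> g (\<Sum>b\<in>S. cscale (cfun.representation S (basis_vec j) b) b)"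
        using expand j by (simp add: basis_vec_in_free_space)
      also have "\<dots> = (\<Sum>b\<in>S. cscale (cfun.representation S (basis_vec j) b) (\<rho> g b))"
        by (rule linear_on_sum[OF lin[OF g] subspace_free_space]) (use S(2) in blast)
      finally show "\<rho> g (basis_vec j) j = (\<Sum>b\<in>S. cfun.representation S (basis_vec j) b * \<rho> g b j)"
        by (simp add: sum_fun_apply cscale_def)
    qed
    also have "\<dots> = (\<Sum>b\<in>S. \<Sum>j\<in>B. cfun.representation S (cscale (\<rho> g b j) (basis_vec j)) b)"
    proof (subst sum.swap, intro sum.cong refl)
      fix b j assume "j \<in> B"
      then have "cfun.representation S (cscale (\<rho> g b j) (basis_vec j))
          = (\<lambda>b'. \<rho> g b j * cfun.representation S (basis_vec j) b')"
        by (rule cfun.representation_scale[OF S(3) basis_span])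
      then show "cfun.representation S (basis_vec j) b * \<rho> g b j
          = cfun.representation S (cscale (\<rho> g b j) (basis_vec j)) b" by simp
    qed
    also have "\<dots> = (\<Sum>b\<in>S. cfun.representation S (\<Sum>j\<in>B. cscale (\<rho> g b j) (basis_vec j)) b)"
      using S(3) basis_span
      by (intro sum.cong refl, subst cfun.representation_sum) (auto intro!: cfun.span_scale)
    also have "\<dots> = (\<Sum>b\<in>S. M g b b)"
      using free_space_expand[OF finite_index closed_space[OF g], symmetric] S(2)
      by (intro sum.cong refl) (auto simp: M_def)
    finally show ?thesis .
  qed
  also have "(\<Sum>a\<in>S. M g a a) = (\<Sum>a\<in>S - S1. M g a a) + (\<Sum>a\<in>S1. M g a a)" for g
    by (rule sum.subset_diff[OF S(1) finS])
  finally show ?thesis using \<sigma> \<tau> card1 card2 cardS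
    by (intro exI[of _ "card S1"] exI[of _ "card (S - S1)"] exI[of _ \<sigma>] exI[of _ \<tau>]) auto
qed

text \<open>A list rather than a set, because a factor may occur several times.\<close>

lemma composition_factors:
  assumes "group G" "is_rep G {..<d::nat} \<rho>"
  shows "\<exists>L. (\<forall>(e, \<sigma>)\<in>set L. is_irrep G {..<e::nat} \<sigma>) \<and>
     (\<forall>g\<in>carrier G. trace_on {..<d} (\<rho> g) = (\<Sum>(e, \<sigma>)\<leftarrow>L. trace_on {..<e} (\<sigma> g)))"
  using assms(2)
proof (induction d arbitrary: \<rho> rule: less_induct)
  case (less d)
  interpret rep G "{..<d}" \<rho> using assms(1) less.prems by (rule repI)
  consider "d = 0" | "is_irrep G {..<d} \<rho>" | "d \<noteq> 0" "\<not> is_irrep G {..<d} \<rho>" by blast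
  then show ?case
  proof cases
    case 1
    then show ?thesis by (intro exI[of _ "[]"]) (simp add: trace_on_def)
  next
    case 2
    then show ?thesis by (intro exI[of _ "[(d, \<rho>)]"]) simp
  next
    case 3
    then obtain W where "cfun.subspace W" "W \<subseteq> free_space {..<d}" "\<forall>g\<in>carrier G. \<rho> g ` W \<subseteq> W"
      "W \<noteq> {0}" "W \<noteq> free_space {..<d}"
      using 3(1) rep by (auto simp: is_irrep_def)
    then obtain d1 d2 \<sigma> \<tau> where "d1 < d" "d2 < d" and st: "is_rep G {..<d1} \<sigma>" "is_rep G {..<d2} \<tau>"
      "\<forall>g\<in>carrier G. trace_on {..<d} (\<rho> g) = trace_on {..<d1} (\<sigma> g) + trace_on {..<d2} (\<tau> g)"
      using split_invariant_subspace[OF assms(1) less.prems, of W] by auto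
    moreover obtain L1 where "\<forall>(e, \<sigma>)\<in>set L1. is_irrep G {..<e::nat} \<sigma>"
       "\<forall>g\<in>carrier G. trace_on {..<d1} (\<sigma> g) = (\<Sum>(e, \<sigma>)\<leftarrow>L1. trace_on {..<e} (\<sigma> g))"
      using less.IH[OF \<open>d1 < d\<close> st(1)] by blast
    moreover obtain L2 where "\<forall>(e, \<sigma>)\<in>set L2. is_irrep G {..<e::nat} \<sigma>"
       "\<forall>g\<in>carrier G. trace_on {..<d2} (\<tau> g) = (\<Sum>(e, \<sigma>)\<leftarrow>L2. trace_on {..<e} (\<sigma> g))"
      using less.IH[OF \<open>d2 < d\<close> st(2)] by blast
    ultimately show ?thesis by (intro exI[of _ "L1 @ L2"]) auto
  qed
qed

lemma rep_iso_refl: "rep_iso G B \<rho> B \<rho>"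
  unfolding rep_iso_def by (intro exI[of _ id]) (simp add: linear_on_def)

text \<open>The condition \<open>once\<close> also forces \<open>L\<close> to be distinct: a
  repeated entry would be isomorphic to two members of the list. Hence its set is a system of
  representatives.\<close>

lemma model_of_composition_factors:
  assumes "group G" and rep: "is_rep G B \<rho>" and L: "\<forall>(e, \<sigma>)\<in>set L. is_irrep G {..<e::nat} \<sigma>"
    and trace: "\<forall>g\<in>carrier G. trace_on B (\<rho> g) = (\<Sum>(e, \<sigma>)\<leftarrow>L. trace_on {..<e} (\<sigma> g))"
    and once: "\<And>d \<phi>. is_irrep G {..<d::nat} \<phi> \<Longrightarrow> 
      length (filter (\<lambda>x. rep_iso G {..<d} \<phi> {..<fst x} (snd x)) L) = 1"
  shows "is_model G B \<rho>"
proof -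
  interpret rep G B \<rho> by (rule repI) fact+
  have "distinct L"
  proof (rule ccontr)
    assume "\<not> distinct L"
    then obtain xs ys zs e \<sigma> where Leq: "L = xs @ [(e, \<sigma>)] @ ys @ [(e, \<sigma>)] @ zs"
      using not_distinct_decomp[of L] by auto
    then have "is_irrep G {..<e} \<sigma>" using L by simp
    from once[OF this] show False by (simp add: Leq rep_iso_refl)
  qed
  have "\<exists>!x. x \<in> set L \<and> rep_iso G {..<d} \<phi> {..<fst x} (snd x)" if "is_irrep G {..<d} \<phi>" for d :: nat and \<phi>
  proof -
    let ?P = "\<lambda>x. rep_iso G {..<d} \<phi> {..<fst x} (snd x)"
    have "card (set (filter ?P L)) = 1"
      using once[OF that] distinct_card[OF distinct_filter[OF \<open>distinct L\<close>], of ?P] by simp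
    then obtain x where "set (filter ?P L) = {x}" using card_1_singletonE by blast
    then have "{y \<in> set L. ?P y} = {x}" by (simp only: set_filter)
    then have "y \<in> set L \<and> ?P y \<longleftrightarrow> y = x" for y by (metis (mono_tags, lifting) mem_Collect_eq singleton_iff)
    then show ?thesis by (simp only:) simp
  qed
  then have "irrep_reps G (set L)"
    using L by (auto simp: irrep_reps_def)
  moreover have "\<forall>g\<in>carrier G. trace_on B (\<rho> g) = (\<Sum>(d, \<sigma>)\<in>set L. trace_on {..<d} (\<sigma> g))"
    using trace \<open>distinct L\<close> by (simp add: sum_list_distinct_conv_sum_set)
  ultimately show ?thesis using rep by (auto simp: is_model_def)
qed

lemma of_nat_eq_sign:
  fixes c :: complex
  assumes "of_nat m = c" "c \<in> {1, -1}"
  shows "m = 1"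
proof -
  have "real m = Re c" using arg_cong[OF assms(1), of Re] by simp
  then show ?thesis using assms(2) by auto
qed

text \<open>The inner product of the character of \<open>\<rho>\<close> with an irreducible
  character is computed twice. Through the composition factors it is a multiplicity; through
  \<open>trace\<close>, after grouping by the fibers of \<open>h \<mapsto> h \<tau>(h)\<close>, it
  is the twisted indicator.\<close>

theorem model_of_twisted_square_roots:
  assumes "group G" "is_rep G B \<rho>" and fin: "finite (carrier G)"
    and \<tau>: "\<tau> \<in> hom G G" "\<And>g. g \<in> carrier G \<Longrightarrow> \<tau> (\<tau> g) = g"
    and conj: "\<And>g. g \<in> carrier G \<Longrightarrow> \<exists>h\<in>carrier G. h \<otimes>\<^bsub>G\<^esub> inv\<^bsub>G\<^esub> g = \<tau> g \<otimes>\<^bsub>G\<^esub> h"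
    and trace: "\<And>g. g \<in> carrier G \<Longrightarrow>
      trace_on B (\<rho> g) = of_nat (card {h \<in> carrier G. h \<otimes>\<^bsub>G\<^esub> \<tau> h = g})"
  shows "is_model G B \<rho>"
proof -
  interpret rep G B \<rho> by (rule repI) fact+
  have "\<exists>\<rho>'. is_rep G {..<card B} \<rho>' \<and> (\<forall>g. trace_on {..<card B} (\<rho>' g) = (\<Sum>a\<in>B. ent \<rho> g a a))"
    by (intro rep_of_matrices is_group finite_index) (auto simp: ent_mult ent_one)
  then obtain \<rho>' where \<rho>': "is_rep G {..<card B} \<rho>'" "\<And>g. trace_on {..<card B} (\<rho>' g) = trace_on B (\<rho> g)"
    by (elim exE conjE) (simp add: trace_ent)
  obtain L where L: "\<forall>(e, \<sigma>)\<in>set L. is_irrep G {..<e::nat} \<sigma>"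
    "\<forall>g\<in>carrier G. trace_on B (\<rho> g) = (\<Sum>(e, \<sigma>)\<leftarrow>L. trace_on {..<e} (\<sigma> g))"
    using composition_factors[OF assms(1) \<rho>'(1)] \<rho>'(2) by auto
  have \<tau>_in: "\<tau> g \<in> carrier G" if "g \<in> carrier G" for g using \<tau>(1) that by (auto simp: hom_def)
  have "carrier G \<noteq> {}" by blast
  then have cardG: "of_nat (card (carrier G)) \<noteq> (0 :: complex)" using fin by simp
  have "length (filter (\<lambda>x. rep_iso G {..<d} \<phi> {..<fst x} (snd x)) L) = 1" if \<phi>: "is_irrep G {..<d} \<phi>" for d :: nat and \<phi>
  proof -
    let ?n = "length (filter (\<lambda>x. rep_iso G {..<d} \<phi> {..<fst x} (snd x)) L)"
    let ?\<chi> = "\<lambda>g. trace_on {..<d} (\<phi> g)"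
    let ?S = "\<Sum>g\<in>carrier G. trace_on B (\<rho> g) * ?\<chi> (inv\<^bsub>G\<^esub> g)"
    interpret \<phi>: irrep G "{..<d}" \<phi> by (rule irrepI) fact+
    have inner: "(\<Sum>g\<in>carrier G. trace_on {..<e} (\<sigma> g) * ?\<chi> (inv\<^bsub>G\<^esub> g))
        = (if rep_iso G {..<d} \<phi> {..<e} \<sigma> then of_nat (card (carrier G)) else 0)"
      if "is_irrep G {..<e} \<sigma>" for e :: nat and \<sigma>
    proof (cases "rep_iso G {..<d} \<phi> {..<e} \<sigma>")
      case True
      interpret \<sigma>: irrep G "{..<e}" \<sigma> by (rule irrepI) fact+
      have "trace_on {..<e} (\<sigma> g) = ?\<chi> g" if "g \<in> carrier G" for g
        using rep_iso_trace_eq[OF \<phi>.rep_axioms \<sigma>.rep_axioms True that] by simp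
      then show ?thesis using True character_norm[OF \<phi>.irrep_axioms] by simp
    next
      case False
      then show ?thesis using character_orthogonal[OF \<phi>.irrep_axioms irrepI[OF assms(1) that]] by simp
    qed
    have "?S = (\<Sum>g\<in>carrier G. (\<Sum>(e, \<sigma>)\<leftarrow>L. trace_on {..<e} (\<sigma> g)) * ?\<chi> (inv\<^bsub>G\<^esub> g))"
      using L(2) by simp
    also have "\<dots> = (\<Sum>(e, \<sigma>)\<leftarrow>L. \<Sum>g\<in>carrier G. trace_on {..<e} (\<sigma> g) * ?\<chi> (inv\<^bsub>G\<^esub> g))"
      by (induction L) (auto simp: distrib_right sum.distrib split: prod.splits)
    also have "\<dots> = of_nat (card (carrier G)) * of_nat ?n"
      using L(1) inner by (induction L) (auto simp: distrib_left)
    finally have S1: "?S = of_nat (card (carrier G)) * of_nat ?n" .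
    have "?S = (\<Sum>g\<in>carrier G. \<Sum>h\<in>{h \<in> carrier G. h \<otimes>\<^bsub>G\<^esub> \<tau> h = g}. ?\<chi> (inv\<^bsub>G\<^esub> (h \<otimes>\<^bsub>G\<^esub> \<tau> h)))"
      using trace by (intro sum.cong refl) auto
    also have "\<dots> = (\<Sum>h\<in>carrier G. ?\<chi> (inv\<^bsub>G\<^esub> (h \<otimes>\<^bsub>G\<^esub> \<tau> h)))"
      using fin \<tau>_in by (intro sum.group) auto
    \<comment> \<open>For \<open>h' = \<tau> (h^-1)\<close> the product \<open>h' \<tau>(h')\<close>
      is the inverse of \<open>h \<tau>(h)\<close>.\<close>
    also have "\<dots> = (\<Sum>h\<in>carrier G. ?\<chi> (h \<otimes>\<^bsub>G\<^esub> \<tau> h))"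
    proof -
      interpret \<tau>: group_hom G G \<tau> using \<tau>(1) by unfold_locales
      show ?thesis
        by (intro sum.reindex_bij_witness[of _ "\<lambda>h. \<tau> (inv\<^bsub>G\<^esub> h)" "\<lambda>h. \<tau> (inv\<^bsub>G\<^esub> h)"])
          (auto simp: \<tau> \<tau>_in inv_mult_group)
    qed
    finally have S2: "?S = (\<Sum>h\<in>carrier G. ?\<chi> (h \<otimes>\<^bsub>G\<^esub> \<tau> h))" .
    have "\<exists>c\<in>{1, -1}. (\<Sum>h\<in>carrier G. ?\<chi> (h \<otimes>\<^bsub>G\<^esub> \<tau> h)) = c * of_nat (card (carrier G))"
    proof (rule twisted_frobenius_schur[OF \<phi>.irrep_axioms fin \<tau>(1)])
      show "\<tau> (\<tau> g) = g" if "g \<in> carrier G" for g by (rule \<tau>(2)[OF that])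
      show "\<exists>h\<in>carrier G. h \<otimes>\<^bsub>G\<^esub> inv\<^bsub>G\<^esub> g = \<tau> g \<otimes>\<^bsub>G\<^esub> h" if "g \<in> carrier G" for g
        by (rule conj[OF that])
    qed
    then obtain c where c: "c \<in> {1, -1}"
      "(\<Sum>h\<in>carrier G. ?\<chi> (h \<otimes>\<^bsub>G\<^esub> \<tau> h)) = c * of_nat (card (carrier G))"
      by (rule bexE)
    have "of_nat (card (carrier G)) * of_nat ?n = of_nat (card (carrier G)) * c"
      by (simp only: S1[symmetric] S2 c(2)) (rule mult.commute)
    then have "of_nat ?n = c" by (simp only: mult_left_cancel[OF cardG])
    then show ?thesis using c(1) by (rule of_nat_eq_sign)
  qed
  then show ?thesis by (rule model_of_composition_factors[OF assms(1,2) L])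
qed

section \<open>Permutations commuting with a given permutation\<close>

locale finite_perm =
  fixes N :: "nat set" and \<sigma> :: "nat \<Rightarrow> nat"
  assumes finite_N: "finite N" and \<sigma>: "\<sigma> permutes N"
begin

abbreviation len where "len \<equiv> least_power \<sigma>"

definition same_cycle :: "nat \<Rightarrow> nat \<Rightarrow> bool" where "same_cycle i j \<longleftrightarrow> (\<exists>k. (\<sigma> ^^ k) i = j)"

text \<open>The least element of a cycle serves as its name, which makes the cycles linearly ordered.\<close>
definition cyc :: "nat \<Rightarrow> nat" where "cyc i = (LEAST j. same_cycle i j)"

lemma permutation: "permutation \<sigma>" using \<sigma> finite_N permutation_permutes by blast

lemma len_pos: "0 < len i" using least_power_of_permutation(2)[OF permutation] .

lemma pow_eq_self_iff: "(\<sigma> ^^ k) i = i \<longleftrightarrow> len i dvd k"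
  using least_power_dvd[OF permutation] by blast

lemma pow_len [simp]: "(\<sigma> ^^ len i) i = i" by (simp add: pow_eq_self_iff)

lemma pow_add: "(\<sigma> ^^ k) ((\<sigma> ^^ l) i) = (\<sigma> ^^ (k + l)) i" by (simp add: funpow_add)

lemma pow_add_multiple: "len i dvd k \<Longrightarrow> (\<sigma> ^^ (l + k)) i = (\<sigma> ^^ l) i"
  using pow_eq_self_iff[of k i] by (simp add: funpow_add)

lemma pow_in_N: "(\<sigma> ^^ k) i \<in> N \<longleftrightarrow> i \<in> N"
  by (rule permutes_in_image[OF permutes_funpow[OF \<sigma>]])

lemma pow_inj: "(\<sigma> ^^ k) i = (\<sigma> ^^ k) j \<longleftrightarrow> i = j"
  by (rule inj_eq[OF permutes_inj[OF permutes_funpow[OF \<sigma>]]])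

lemma pow_eq_iff: "(\<sigma> ^^ k) i = (\<sigma> ^^ l) i \<longleftrightarrow> k mod len i = l mod len i"
proof -
  have le: "(\<sigma> ^^ k) i = (\<sigma> ^^ l) i \<longleftrightarrow> k mod len i = l mod len i" if "k \<le> l" for k l
  proof -
    have "(\<sigma> ^^ l) i = (\<sigma> ^^ k) ((\<sigma> ^^ (l - k)) i)" using that by (simp add: pow_add)
    then have "(\<sigma> ^^ k) i = (\<sigma> ^^ l) i \<longleftrightarrow> (\<sigma> ^^ (l - k)) i = i" by (metis pow_inj)
    also have "\<dots> \<longleftrightarrow> len i dvd l - k" by (rule pow_eq_self_iff)
    also have "\<dots> \<longleftrightarrow> k mod len i = l mod len i" using mod_eq_dvd_iff_nat[OF that, of "len i"] by auto
    finally show ?thesis .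
  qed
  show ?thesis using le[of k l] le[of l k] by (cases "k \<le> l") auto
qed

lemma same_cycle_refl: "same_cycle i i"
  unfolding same_cycle_def by (intro exI[of _ 0]) simp

lemma same_cycle_sym: "same_cycle i j \<Longrightarrow> same_cycle j i"
  unfolding same_cycle_def
proof (elim exE)
  fix k assume k: "(\<sigma> ^^ k) i = j"
  have "(\<sigma> ^^ (len i * k - k)) j = (\<sigma> ^^ (len i * k - k + k)) i" using k by (simp flip: pow_add)
  also have "len i * k - k + k = len i * k" using len_pos[of i] by simp
  also have "(\<sigma> ^^ (len i * k)) i = i" by (simp add: pow_eq_self_iff)
  finally show "\<exists>l. (\<sigma> ^^ l) j = i" by blast
qed

lemma same_cycle_trans: "same_cycle i j \<Longrightarrow> same_cycle j k \<Longrightarrow> same_cycle i k"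
  unfolding same_cycle_def by (metis pow_add)

lemma cyc_eq_iff: "cyc i = cyc j \<longleftrightarrow> same_cycle i j"
proof
  have *: "same_cycle i (cyc i)" for i
    unfolding cyc_def using same_cycle_refl by (rule LeastI)
  show "same_cycle i j" if "cyc i = cyc j"
    using *[of i] *[of j] that same_cycle_sym same_cycle_trans by metis
  show "cyc i = cyc j" if "same_cycle i j"
  proof -
    have "same_cycle i = same_cycle j" using that same_cycle_sym same_cycle_trans by blast
    then show ?thesis by (simp add: cyc_def)
  qed
qed

lemma cyc_pow: "cyc ((\<sigma> ^^ k) i) = cyc i"
  unfolding cyc_eq_iff by (rule same_cycle_sym) (auto simp: same_cycle_def)

lemma cyc_eqE:
  assumes "cyc i = cyc j"
  obtains k where "j = (\<sigma> ^^ k) i"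
  using assms by (auto simp: cyc_eq_iff same_cycle_def)

definition commutes :: "(nat \<Rightarrow> nat) \<Rightarrow> bool" where
  "commutes u \<longleftrightarrow> u permutes N \<and> u \<circ> \<sigma> = \<sigma> \<circ> u"

lemma commutesD:
  assumes "commutes u"
  shows "u permutes N" "u (\<sigma> i) = \<sigma> (u i)" "u i \<in> N \<longleftrightarrow> i \<in> N" "u i = u j \<longleftrightarrow> i = j"
  using assms permutes_in_image[of u N i] inj_eq[OF permutes_inj[of u N], of i j]
  by (simp_all add: commutes_def) (metis comp_apply)

lemma commutes_pow:
  assumes "commutes u"
  shows "u ((\<sigma> ^^ k) i) = (\<sigma> ^^ k) (u i)"
  using commutesD(2)[OF assms] by (induction k) auto

lemma len_commute: "commutes u \<Longrightarrow> len (u i) = len i"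
  by (simp add: least_power_def flip: commutes_pow) (simp add: commutesD)

lemma commutes_\<sigma>: "commutes \<sigma>" using \<sigma> by (simp add: commutes_def)

lemma len_pow: "len ((\<sigma> ^^ k) i) = len i"
  by (induction k) (auto simp: len_commute[OF commutes_\<sigma>])

lemma cyc_commute: "commutes u \<Longrightarrow> cyc (u i) = cyc (u j) \<longleftrightarrow> cyc i = cyc j"
  unfolding cyc_eq_iff same_cycle_def by (simp flip: commutes_pow) (simp add: commutesD)

text \<open>
  Multiplying \<open>u\<close> by a power of \<open>\<sigma>\<close> on each cycle does not change the permutation
  that \<open>u\<close> induces on the set of cycles; hence the exponents, which depend on this permutation only,
  are the same for \<open>u\<close> and \<open>twist e u\<close>.
\<close>
definition twist :: "(nat \<Rightarrow> nat) \<times> (nat \<Rightarrow> nat) \<times> (nat \<Rightarrow> nat) \<Rightarrow> (nat \<Rightarrow> nat) \<Rightarrow> nat \<Rightarrow> nat" where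
  "twist = (\<lambda>(e0, e1, e2) u i.
     (\<sigma> ^^ (if cyc (u i) = cyc i then e0 (len i) else if cyc i < cyc (u i) then e1 (len i) else e2 (len i))) (u i))"

lemma cyc_twist: "cyc (twist e u i) = cyc (u i)"
  by (cases e) (simp add: twist_def cyc_pow)

lemma twist_commutes:
  assumes u: "commutes u"
  shows "commutes (twist e u)"
proof -
  obtain e0 e1 e2 where e: "e = (e0, e1, e2)" by (cases e) auto
  have inj: "inj (twist e u)"
  proof
    fix i j assume eq: "twist e u i = twist e u j"
    then have c: "cyc (u i) = cyc (u j)" using cyc_twist by metis
    then have c': "cyc i = cyc j" using cyc_commute[OF u] by blast
    then obtain k where k: "j = (\<sigma> ^^ k) i" by (elim cyc_eqE)
    then have "len i = len j" by (simp add: len_pow)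
    then have "u i = u j" using eq unfolding twist_def e split c c' by (simp only: pow_inj)
    then show "i = j" using commutesD[OF u] by blast
  qed
  have "twist e u ` N \<subseteq> N"
    by (auto simp: twist_def e pow_in_N commutesD[OF u] split: if_splits)
  then have "twist e u ` N = N" using inj endo_inj_surj[OF finite_N] inj_on_subset by blast
  moreover have "twist e u i = i" if "i \<notin> N" for i
  proof -
    have "u i = i" using permutes_not_in[OF commutesD(1)[OF u] that] .
    moreover have "(\<sigma> ^^ k) i = i" for k using permutes_not_in[OF permutes_funpow[OF \<sigma>] that] .
    ultimately show ?thesis by (simp add: twist_def e)
  qed
  ultimately have "twist e u permutes N"
    using inj_on_subset[OF inj subset_UNIV, of N] by (intro bij_imp_permutes) (simp_all add: bij_betw_def)
  moreover have "twist e u (\<sigma> i) = \<sigma> (twist e u i)" for i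
    using cyc_pow[of 1] len_pow[of 1]
    by (simp add: twist_def e commutesD(2)[OF u] funpow_swap1)
  ultimately show ?thesis by (auto simp: commutes_def fun_eq_iff)
qed

text \<open>Since \<open>twist e u\<close> and \<open>u\<close> move cycles alike, the second twist
  falls into the same branch as the first, and the two exponents add up.\<close>

lemma twist_twist:
  assumes u: "commutes u" and e: "e = (e0, e1, e2)" "e' = (e0', e1', e2')"
    and "\<And>i. i \<in> N \<Longrightarrow> cyc (u i) = cyc i \<Longrightarrow> len i dvd e0' (len i) + e0 (len i)"
    and "\<And>i. i \<in> N \<Longrightarrow> cyc i < cyc (u i) \<Longrightarrow> len i dvd e1' (len i) + e1 (len i)"
    and "\<And>i. i \<in> N \<Longrightarrow> cyc (u i) < cyc i \<Longrightarrow> len i dvd e2' (len i) + e2 (len i)"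
  shows "twist e' (twist e u) = u"
proof
  fix i
  show "twist e' (twist e u) i = u i"
  proof (cases "i \<in> N")
    case False
    then show ?thesis
      using permutes_not_in commutesD(1) twist_commutes u by metis
  next
    case True
    have "(\<sigma> ^^ a) ((\<sigma> ^^ b) (u i)) = u i" if "len i dvd a + b" for a b
      using that len_commute[OF u, of i] by (simp add: pow_add pow_eq_self_iff)
    then show ?thesis using assms(4-6)[OF True] cyc_twist[of e u i]
      by (cases "cyc i" "cyc (u i)" rule: linorder_cases) (simp_all add: twist_def e cyc_pow)
  qed
qed

text \<open>On a pair of exchanged cycles, one of the two steps goes up and the other goes down, so
  \<open>e1\<close> and \<open>e2\<close> both occur, in one order or the other.\<close>

lemma twist_apply_twice:
  assumes u: "commutes u" and sq: "cyc (u (u i)) = cyc i"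
  shows "twist (e0, e1, e2) u (twist (e0, e1, e2) u i) =
    (\<sigma> ^^ (if cyc (u i) = cyc i then e0 (len i) + e0 (len i) else e1 (len i) + e2 (len i))) (u (u i))"
proof -
  have u_pow: "cyc (u ((\<sigma> ^^ k) (u i))) = cyc i" for k by (simp add: commutes_pow[OF u] cyc_pow sq)
  show ?thesis
    by (cases "cyc i" "cyc (u i)" rule: linorder_cases)
     (simp_all add: twist_def cyc_pow u_pow len_pow len_commute[OF u] commutes_pow[OF u] pow_add sq add.commute)
qed

end

section \<open>Square roots and involutions compatible with a coloring\<close>

context finite_perm
begin

text \<open>The half turn is the only nontrivial involution of a single cycle that commutes with
  \<open>\<sigma>\<close>; the predicate tests whether the color of \<open>i\<close> allows
  it.\<close>

definition half_turn_invariant :: "(nat \<Rightarrow> 'c) \<Rightarrow> nat \<Rightarrow> bool" where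
  "half_turn_invariant w i \<longleftrightarrow> even (len i) \<and> w ((\<sigma> ^^ (len i div 2)) i) = w i"

definition color_involutions :: "(nat \<Rightarrow> 'c) \<Rightarrow> ('c \<Rightarrow> 'c) \<Rightarrow> (nat \<Rightarrow> nat) set" where
  "color_involutions w f = {t. commutes t \<and> t \<circ> t = id \<and> (\<forall>i\<in>N. w (t i) = f (w i))}"

text \<open>For \<open>f\<close> the identity these are the involutions that survive the sign
  cancellation in \<open>sum_pair_sign\<close>.\<close>

definition reduced_involutions :: "(nat \<Rightarrow> 'c) \<Rightarrow> ('c \<Rightarrow> 'c) \<Rightarrow> (nat \<Rightarrow> nat) set" where
  "reduced_involutions w f = {t \<in> color_involutions w f.
     \<forall>i\<in>N. cyc (t i) = cyc i \<longrightarrow> t i = i \<and> \<not> half_turn_invariant w i}"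

lemma finite_color_involutions: "finite (color_involutions w f)"
  using finite_subset[OF _ finite_permutations[OF finite_N]]
  by (auto simp: color_involutions_def commutes_def)

lemma involutionD: "t \<circ> t = id \<Longrightarrow> t (t i) = i" by (metis comp_apply id_apply)

text \<open>On the cycle, \<open>t\<close> is a power of \<open>\<sigma>\<close> whose exponent is
  not divisible by the length while its double is.\<close>

lemma involution_fixed_cycle:
  assumes t: "commutes t" "t \<circ> t = id" and c: "cyc (t i) = cyc i" "t i \<noteq> i"
  shows "even (len i)" "t i = (\<sigma> ^^ (len i div 2)) i"
proof -
  obtain k where k: "t i = (\<sigma> ^^ k) i" using cyc_eqE[OF c(1)[symmetric]] by blast
  have "(\<sigma> ^^ (k + k)) i = t (t i)" by (simp add: k commutes_pow[OF t(1)] pow_add)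
  then have "len i dvd 2 * k" using involutionD[OF t(2)] by (simp add: pow_eq_self_iff mult_2)
  then obtain q where q: "2 * k = len i * q" by (elim dvdE)
  have "\<not> len i dvd k" using c(2) k pow_eq_self_iff by metis
  then have "odd q" using q by (auto elim!: evenE)
  then show "even (len i)" using q by (metis dvd_triv_left even_mult_iff)
  then obtain h where h: "len i = 2 * h" by (elim evenE)
  obtain s where "q = 2 * s + 1" using \<open>odd q\<close> by (elim oddE)
  then have "k = h + len i * s" using q h by (simp add: algebra_simps)
  then show "t i = (\<sigma> ^^ (len i div 2)) i" using h pow_add_multiple[of i "len i * s" h] k by simp
qed

text \<open>On a cycle that it preserves, a root is a power of \<open>\<sigma>\<close> with exponent
  one half modulo the length, which must be odd; the extra exponent \<open>(l - 1) div 2\<close>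
  turns it into the identity. On two exchanged cycles the way there and back is
  \<open>\<sigma>\<close> instead of the identity, so the downward step is corrected by
  \<open>\<sigma>^-1\<close>, that is, by the exponent \<open>l - 1\<close>. The exponents
  \<open>?e'\<close> undo this.\<close>

theorem card_square_roots:
  assumes w: "\<And>i. i \<in> N \<Longrightarrow> w (\<sigma> i) = w i"
  shows "card {s. s permutes N \<and> s \<circ> s = \<sigma> \<and> (\<forall>i\<in>N. w (s i) = f (w i))} = card (reduced_involutions w f)"
proof -
  let ?S = "{s. s permutes N \<and> s \<circ> s = \<sigma> \<and> (\<forall>i\<in>N. w (s i) = f (w i))}"
  let ?e = "(\<lambda>l. (l - 1) div 2, \<lambda>l. 0, \<lambda>l. l - 1) :: (nat \<Rightarrow> nat) \<times> (nat \<Rightarrow> nat) \<times> (nat \<Rightarrow> nat)"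
  let ?e' = "(\<lambda>l. (l + 1) div 2, \<lambda>l. 0, \<lambda>l. 1) :: (nat \<Rightarrow> nat) \<times> (nat \<Rightarrow> nat) \<times> (nat \<Rightarrow> nat)"
  have w_pow: "w ((\<sigma> ^^ k) i) = w i" if "i \<in> N" for i k
    using that w pow_in_N by (induction k) auto
  have w_twist: "w (twist e u i) = w (u i)" if "commutes u" "i \<in> N" for e u i
    using that by (cases e) (simp add: twist_def w_pow commutesD(3))
  \<comment> \<open>Colors are constant on cycles, so being reduced means here that every preserved
    cycle is fixed pointwise and has odd length.\<close>
  have hti: "half_turn_invariant w i \<longleftrightarrow> even (len i)" if "i \<in> N" for i
    using that by (simp add: half_turn_invariant_def w_pow)
  have S: "commutes s" "s (s i) = \<sigma> i" "i \<in> N \<Longrightarrow> w (s i) = f (w i)" if "s \<in> ?S" for s i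
  proof -
    have ss: "s permutes N" "s \<circ> s = \<sigma>" using that by auto
    have "s \<circ> \<sigma> = \<sigma> \<circ> s" unfolding ss(2)[symmetric] by (simp only: comp_assoc)
    then show "commutes s" using ss by (simp add: commutes_def)
    show "s (s i) = \<sigma> i" using ss(2) by auto
    show "i \<in> N \<Longrightarrow> w (s i) = f (w i)" using that by auto
  qed
  \<comment> \<open>Stated over the integers because \<open>k = 0\<close> can occur, namely on a
    cycle of length 1.\<close>
  have S_cycle: "\<exists>k. s i = (\<sigma> ^^ k) i \<and> int (len i) dvd 2 * int k - 1" if s: "s \<in> ?S" and cy: "cyc (s i) = cyc i" for s i
  proof -
    obtain k where k: "s i = (\<sigma> ^^ k) i" using cyc_eqE[OF cy[symmetric]] by blast
    have "(\<sigma> ^^ (k + k)) i = s (s i)" by (simp add: k commutes_pow[OF S(1)[OF s]] pow_add)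
    also have "\<dots> = \<sigma> i" by (rule S(2)[OF s])
    also have "\<dots> = \<sigma> ((\<sigma> ^^ len i) i)" by simp
    finally have *: "(\<sigma> ^^ (k + k)) i = (\<sigma> ^^ Suc (len i)) i" by simp
    have "len i dvd nat \<bar>2 * int k - 1\<bar>"
    proof (cases "k = 0")
      case True
      then have "\<sigma> i = i" using * pow_eq_self_iff[of "len i" i] by simp
      then have "(\<sigma> ^^ 1) i = i" by simp
      then show ?thesis unfolding pow_eq_self_iff using True by simp
    next
      case False
      then have "\<sigma> ((\<sigma> ^^ (2 * k - 1)) i) = \<sigma> ((\<sigma> ^^ len i) i)"
        using * by (cases k) (simp_all add: mult_2)
      then have "(\<sigma> ^^ (2 * k - 1)) i = (\<sigma> ^^ len i) i"
        using commutesD(4)[OF commutes_\<sigma>] by blast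
      then have "len i dvd 2 * k - 1" using pow_eq_self_iff by (metis dvd_refl)
      then show ?thesis using False by (simp add: nat_diff_distrib' nat_mult_distrib)
    qed
    then show ?thesis using k by (intro exI[of _ k]) (simp add: int_dvd_int_iff[symmetric] del: int_dvd_int_iff)
  qed
  have S_odd: "odd (len i)" if "s \<in> ?S" "cyc (s i) = cyc i" for s i
  proof
    assume "even (len i)"
    then have "2 dvd int (len i)" by simp
    then have "2 dvd 2 * int k - 1" if "int (len i) dvd 2 * int k - 1" for k
      using that dvd_trans by blast
    then show False using S_cycle[OF that] by auto
  qed
  have S_to: "twist ?e s \<in> reduced_involutions w f" if s: "s \<in> ?S" for s
  proof -
    note c = S(1)[OF s]
    have fixed: "twist ?e s i = i" if cy: "cyc (s i) = cyc i" for i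
    proof -
      obtain k where k: "s i = (\<sigma> ^^ k) i" "int (len i) dvd 2 * int k - 1" using S_cycle[OF s cy] by auto
      obtain h where h: "len i = 2 * h + 1" using S_odd[OF s cy] by (elim oddE)
      have "int (len i) dvd 2 * (int h + int k)"
        using dvd_add[OF dvd_refl k(2)] by (simp add: h algebra_simps)
      moreover have "coprime (int (len i)) 2" using h by simp
      ultimately have "int (len i) dvd int h + int k" using coprime_dvd_mult_right_iff by blast
      then have "len i dvd h + k" by (simp only: int_dvd_int_iff flip: of_nat_add)
      then show ?thesis using cy h by (simp add: twist_def k(1) pow_add pow_eq_self_iff)
    qed
    have "twist ?e s (twist ?e s i) = i" for i
    proof (cases "cyc (s i) = cyc i")
      case True
      then show ?thesis using fixed by simp
    next
      case False
      have "cyc (s (s i)) = cyc i" using S(2)[OF s, of i] cyc_pow[of 1 i] by simp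
      moreover have "(\<sigma> ^^ (len i - 1)) (\<sigma> i) = (\<sigma> ^^ Suc (len i - 1)) i"
        by (simp only: funpow_swap1 funpow.simps comp_apply)
      moreover have "(\<sigma> ^^ Suc (len i - 1)) i = i" using len_pos[of i] by (simp only: Suc_diff_1 pow_len)
      ultimately show ?thesis using False twist_apply_twice[OF c, of i] S(2)[OF s, of i] by simp
    qed
    then show ?thesis
      using twist_commutes[OF c] w_twist[OF c] S(3)[OF s] fixed S_odd[OF s]
      by (auto simp: reduced_involutions_def color_involutions_def fun_eq_iff cyc_twist hti)
  qed
  have T_to: "twist ?e' t \<in> ?S" if t: "t \<in> reduced_involutions w f" for t
  proof -
    have c: "commutes t" and tt: "\<And>i. t (t i) = i" and wt: "\<And>i. i \<in> N \<Longrightarrow> w (t i) = f (w i)"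
      and fixed: "\<And>i. i \<in> N \<Longrightarrow> cyc (t i) = cyc i \<Longrightarrow> t i = i \<and> odd (len i)"
      using t by (auto simp: reduced_involutions_def color_involutions_def hti involutionD)
    have "twist ?e' t (twist ?e' t i) = \<sigma> i" if i: "i \<in> N" for i
    proof (cases "cyc (t i) = cyc i")
      case True
      then obtain h where h: "len i = 2 * h + 1" using fixed[OF i True] by (elim conjE oddE)
      then have "(\<sigma> ^^ ((len i + 1) div 2 + (len i + 1) div 2)) i = \<sigma> ((\<sigma> ^^ len i) i)" by (simp add: mult_2 del: pow_len)
      also have "(\<sigma> ^^ len i) i = i" by simp
      finally show ?thesis
        using True fixed[OF i True] twist_apply_twice[OF c, of i] by (simp only: tt if_True simp_thms)
    next
      case False
      then show ?thesis using twist_apply_twice[OF c, of i] by (simp add: tt)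
    qed
    moreover have "twist ?e' t (twist ?e' t i) = \<sigma> i" if "i \<notin> N" for i
      using that permutes_not_in[OF \<sigma>] permutes_not_in[OF commutesD(1)[OF twist_commutes[OF c]]] by simp
    ultimately have "twist ?e' t \<circ> twist ?e' t = \<sigma>" by (auto simp: fun_eq_iff)
    then show ?thesis using twist_commutes[OF c] w_twist[OF c] wt by (auto simp: commutes_def)
  qed
  have "bij_betw (twist ?e) ?S (reduced_involutions w f)"
  proof (rule bij_betw_byWitness[where f' = "twist ?e'"])
    show "\<forall>s\<in>?S. twist ?e' (twist ?e s) = s"
    proof
      fix s assume s: "s \<in> ?S"
      have "len i dvd (len i + 1) div 2 + (len i - 1) div 2" if "cyc (s i) = cyc i" for i
        using S_odd[OF s that] by (auto simp: mult_2 elim!: oddE)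
      then show "twist ?e' (twist ?e s) = s"
        using len_pos by (intro twist_twist[OF S(1)[OF s] refl refl]) auto
    qed
    show "\<forall>t\<in>reduced_involutions w f. twist ?e (twist ?e' t) = t"
    proof
      fix t assume t: "t \<in> reduced_involutions w f"
      have "len i dvd (len i - 1) div 2 + (len i + 1) div 2" if "i \<in> N" "cyc (t i) = cyc i" for i
      proof -
        have "odd (len i)" using t that hti by (auto simp: reduced_involutions_def)
        then show ?thesis by (auto simp: mult_2 elim!: oddE)
      qed
      moreover have "commutes t" using t by (simp add: reduced_involutions_def color_involutions_def)
      ultimately show "twist ?e (twist ?e' t) = t"
        using len_pos by (intro twist_twist[OF _ refl refl]) auto
    qed
  qed (use S_to T_to in blast)+
  then show ?thesis by (rule bij_betw_same_card)
qed

text \<open>Colors alternate along each cycle, so all lengths are even and exactly the odd powers of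
  \<open>\<sigma>\<close> change colors. On a preserved cycle, a reduced involution is the identity
  and a color-changing one is the half turn, and both require \<open>len i div 2\<close> to be odd;
  the twist by the half turn exchanges them. On exchanged cycles \<open>\<sigma>\<close> is inserted
  upward and \<open>\<sigma>^-1\<close> downward, which changes the colors and keeps the square
  trivial.\<close>

theorem card_shifted_involutions:
  assumes w: "\<And>i. i \<in> N \<Longrightarrow> w (\<sigma> i) = f (w i)"
    and f: "\<And>i. i \<in> N \<Longrightarrow> f (f (w i)) = w i" "\<And>i. i \<in> N \<Longrightarrow> f (w i) \<noteq> w i"
  shows "card (reduced_involutions w (\<lambda>x. x)) = card (color_involutions w f)"
proof -
  let ?e = "(\<lambda>l. l div 2, \<lambda>l. 1, \<lambda>l. l - 1) :: (nat \<Rightarrow> nat) \<times> (nat \<Rightarrow> nat) \<times> (nat \<Rightarrow> nat)"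
  let ?e' = "(\<lambda>l. l div 2, \<lambda>l. l - 1, \<lambda>l. 1) :: (nat \<Rightarrow> nat) \<times> (nat \<Rightarrow> nat) \<times> (nat \<Rightarrow> nat)"
  have w_pow: "w ((\<sigma> ^^ k) i) = (if even k then w i else f (w i))" if "i \<in> N" for i k
    using that by (induction k) (auto simp: w f pow_in_N)
  have even: "even (len i)" if "i \<in> N" for i
  proof (rule ccontr)
    assume "odd (len i)"
    moreover have "(\<sigma> ^^ len i) i = i" by simp
    ultimately have "w i = f (w i)" using w_pow[OF that, of "len i"] by simp
    with f(2)[OF that] show False by simp
  qed
  have hti: "half_turn_invariant w i \<longleftrightarrow> even (len i div 2)" if "i \<in> N" for i
    using even[OF that] f(2)[OF that] by (simp add: half_turn_invariant_def w_pow[OF that])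
  have swap_exp: "len i dvd 1 + (len i - 1)" "len i dvd len i - 1 + 1" for i
    using len_pos[of i] by simp_all
  have half_exp: "len i dvd len i div 2 + len i div 2" if "i \<in> N" for i using even[OF that] by (auto simp: mult_2 elim!: evenE)
  have odd_exp: "odd (len i - 1)" if "i \<in> N" for i
    using even[OF that] len_pos[of i] by simp
  have sq: "twist e u (twist e u i) = i"
    if "e = ?e \<or> e = ?e'" "commutes u" "\<And>i. u (u i) = i" "i \<in> N" for e u i
    using that twist_apply_twice[OF that(2), of i] half_exp[OF that(4)] swap_exp[of i]
    by (auto simp: pow_eq_self_iff)
  have sq': "twist e u (twist e u i) = i" if "commutes u" "i \<notin> N" for e u i
    using that permutes_not_in[OF commutesD(1)[OF twist_commutes[OF that(1)]]] by simp
  have to: "twist ?e t \<in> color_involutions w f" if t: "t \<in> reduced_involutions w (\<lambda>x. x)" for t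
  proof -
    have c: "commutes t" and tt: "\<And>i. t (t i) = i" and wt: "\<And>i. i \<in> N \<Longrightarrow> w (t i) = w i"
      and fixed: "\<And>i. i \<in> N \<Longrightarrow> cyc (t i) = cyc i \<Longrightarrow> t i = i \<and> odd (len i div 2)"
      using t by (auto simp: reduced_involutions_def color_involutions_def hti involutionD)
    have "w (twist ?e t i) = f (w i)" if i: "i \<in> N" for i
      using i fixed[OF i] odd_exp[OF i] by (simp add: twist_def w_pow commutesD(3)[OF c] wt)
    moreover have "twist ?e t \<circ> twist ?e t = id"
      using sq[of ?e t] sq'[OF c] c tt by (simp add: fun_eq_iff) blast
    ultimately show ?thesis using twist_commutes[OF c] by (simp add: color_involutions_def)
  qed
  have from_: "twist ?e' t \<in> reduced_involutions w (\<lambda>x. x)" if t: "t \<in> color_involutions w f" for t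
  proof -
    have c: "commutes t" and t2: "t \<circ> t = id" and tt: "\<And>i. t (t i) = i"
      and wt: "\<And>i. i \<in> N \<Longrightarrow> w (t i) = f (w i)"
      using t by (auto simp: color_involutions_def involutionD)
    have turn: "t i = (\<sigma> ^^ (len i div 2)) i \<and> odd (len i div 2)" if "i \<in> N" "cyc (t i) = cyc i" for i
    proof -
      have "t i \<noteq> i" using wt[OF that(1)] f(2)[OF that(1)] by auto
      then have *: "t i = (\<sigma> ^^ (len i div 2)) i" using involution_fixed_cycle[OF c t2 that(2)] by blast
      then have "w ((\<sigma> ^^ (len i div 2)) i) = f (w i)" using wt[OF that(1)] by simp
      then show ?thesis using * w_pow[OF that(1)] f(2)[OF that(1)] by (auto split: if_splits)
    qed
    have fixed: "twist ?e' t i = i" if "i \<in> N" "cyc (t i) = cyc i" for i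
      using turn[OF that] half_exp[OF that(1)] that(2) cyc_pow by (simp add: twist_def pow_add pow_eq_self_iff)
    have "w (twist ?e' t i) = w i" if i: "i \<in> N" for i
    proof (cases "cyc (t i) = cyc i")
      case True
      then show ?thesis using fixed[OF i] by simp
    next
      case False
      then show ?thesis using i odd_exp[OF i] by (simp add: twist_def w_pow commutesD(3)[OF c] wt f)
    qed
    moreover have "twist ?e' t \<circ> twist ?e' t = id"
      using sq[of ?e' t] sq'[OF c] c tt by (simp add: fun_eq_iff) blast
    ultimately show ?thesis
      using twist_commutes[OF c] fixed turn
      by (auto simp: reduced_involutions_def color_involutions_def cyc_twist hti)
  qed
  have "bij_betw (twist ?e) (reduced_involutions w (\<lambda>x. x)) (color_involutions w f)"
  proof (rule bij_betw_byWitness[where f' = "twist ?e'"])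
    show "\<forall>t\<in>reduced_involutions w (\<lambda>x. x). twist ?e' (twist ?e t) = t"
      using half_exp swap_exp
      by (auto simp: reduced_involutions_def color_involutions_def intro!: twist_twist[OF _ refl refl])
    show "\<forall>t\<in>color_involutions w f. twist ?e (twist ?e' t) = t"
      using half_exp swap_exp
      by (auto simp: color_involutions_def intro!: twist_twist[OF _ refl refl])
  qed (use to from_ in blast)+
  then show ?thesis by (rule bij_betw_same_card)
qed

end

section \<open>Signs of involutions\<close>

definition flip_sign :: "(nat \<Rightarrow> nat) \<Rightarrow> nat \<Rightarrow> nat \<Rightarrow> int" where
  "flip_sign \<sigma> i j = (if (int j - int i) * (int (\<sigma> j) - int (\<sigma> i)) < 0 then - 1 else 1)"

text \<open>For \<open>D = {1..n}\<close> and an involution \<open>t\<close> this is the sign in the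
  symmetric case of the representation, see \<open>minus_one_power_inv_stat\<close>. The set
  \<open>D\<close> allows it to be computed cycle by cycle.\<close>

definition pair_sign :: "nat set \<Rightarrow> (nat \<Rightarrow> nat) \<Rightarrow> (nat \<Rightarrow> nat) \<Rightarrow> int" where
  "pair_sign D \<sigma> t = (\<Prod>i\<in>{i \<in> D. i < t i}. flip_sign \<sigma> i (t i))"

lemma flip_sign_sym: "flip_sign \<sigma> i j = flip_sign \<sigma> j i"
  by (simp add: flip_sign_def algebra_simps)

text \<open>\<open>A\<close> is an arbitrary set of representatives of the two-element orbits of \<open>t\<close> in \<open>D\<close>.\<close>
lemma pair_sign_transversal:
  assumes t: "\<And>i. t (t i) = i" and "t ` D \<subseteq> D"
    and A: "A \<subseteq> D" "\<And>i. i \<in> A \<Longrightarrow> t i \<notin> A" "\<And>i. i \<in> D \<Longrightarrow> t i \<noteq> i \<Longrightarrow> i \<in> A \<or> t i \<in> A"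
  shows "pair_sign D \<sigma> t = (\<Prod>i\<in>A. flip_sign \<sigma> i (t i))"
  unfolding pair_sign_def
proof (rule prod.reindex_bij_witness[of _ "\<lambda>i. min i (t i)" "\<lambda>i. if i \<in> A then i else t i"])
  fix i assume i: "i \<in> {i \<in> D. i < t i}"
  then have *: "i \<in> A \<or> t i \<in> A" using A(3)[of i] by auto
  then show "(if i \<in> A then i else t i) \<in> A" by auto
  show "min (if i \<in> A then i else t i) (t (if i \<in> A then i else t i)) = i" using i t by auto
  show "flip_sign \<sigma> (if i \<in> A then i else t i) (t (if i \<in> A then i else t i)) = flip_sign \<sigma> i (t i)"
    using t by (auto simp: flip_sign_sym)
next
  fix i assume i: "i \<in> A"
  then have "t i \<noteq> i" using A(2)[OF i] by metis
  then show "(if min i (t i) \<in> A then min i (t i) else t (min i (t i))) = i"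
    using i A(2)[OF i] t by (auto simp: min_def)
  show "min i (t i) \<in> {i \<in> D. i < t i}" using i A(1) assms(2) t \<open>t i \<noteq> i\<close> by (auto simp: min_def)
qed

lemma pair_sign_split:
  assumes "finite N" "D \<subseteq> N"
  shows "pair_sign N \<sigma> t = pair_sign D \<sigma> t * pair_sign (N - D) \<sigma> t"
proof -
  have "{i \<in> N. i < t i} = {i \<in> D. i < t i} \<union> {i \<in> N - D. i < t i}" using assms(2) by auto
  then show ?thesis using assms finite_subset[OF assms(2,1)]
    unfolding pair_sign_def by (simp only:) (intro prod.union_disjoint, auto)
qed

lemma pair_sign_cong:
  "(\<And>i. i \<in> D \<Longrightarrow> t i = t' i) \<Longrightarrow> pair_sign D \<sigma> t = pair_sign D \<sigma> t'"
  unfolding pair_sign_def by (intro prod.cong) auto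

lemma prod_consecutive:
  fixes o' :: "nat \<Rightarrow> int"
  assumes "\<And>j. o' j * o' j = 1"
  shows "(\<Prod>j<h. o' j * o' (Suc j)) = o' 0 * o' h"
proof (induction h)
  case (Suc h)
  have "o' 0 * o' h * (o' h * o' (Suc h)) = o' 0 * (o' h * o' h) * o' (Suc h)" by (simp only: mult_ac)
  then show ?case using Suc assms by simp
qed (simp add: assms)

text \<open>Splits the sign into the orientations of the pair before and after
  \<open>\<sigma>\<close>, so that products along a cycle telescope.\<close>

lemma flip_sign_sgn:
  assumes "i \<noteq> j" "\<sigma> i \<noteq> \<sigma> j"
  shows "flip_sign \<sigma> i j = sgn (int j - int i) * sgn (int (\<sigma> j) - int (\<sigma> i))"
  using assms by (auto simp: flip_sign_def mult_less_0_iff sgn_if)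

section \<open>Signs of involutions that commute with the permutation\<close>

context finite_perm
begin

text \<open>The points that \<open>t\<close> sends to a later cycle form a transversal which is
  stable under \<open>\<sigma>\<close>. Each contributes its orientation times that of its
  successor; over a stable set both products agree, and only squares remain.\<close>

lemma pair_sign_eq_1:
  assumes t: "commutes t" "t \<circ> t = id" and fixed: "\<And>i. i \<in> N \<Longrightarrow> cyc (t i) = cyc i \<Longrightarrow> t i = i"
  shows "pair_sign N \<sigma> t = 1"
proof -
  define A where "A = {i \<in> N. cyc i < cyc (t i)}"
  let ?o = "\<lambda>i. sgn (int (t i) - int i)"
  have moved: "i \<noteq> t i" if "i \<in> A" for i using that by (auto simp: A_def)
  have "pair_sign N \<sigma> t = (\<Prod>i\<in>A. flip_sign \<sigma> i (t i))"
  proof (rule pair_sign_transversal)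
    show "i \<in> A \<or> t i \<in> A" if "i \<in> N" "t i \<noteq> i" for i
      using that fixed[OF that(1)] commutesD(3)[OF t(1)] involutionD[OF t(2)]
      by (auto simp: A_def not_less le_less)
  qed (auto simp: A_def involutionD[OF t(2)] commutesD(3)[OF t(1)])
  also have "\<dots> = (\<Prod>i\<in>A. ?o i * ?o (\<sigma> i))"
    using moved commutesD(4)[OF commutes_\<sigma>] by (intro prod.cong) (auto simp: flip_sign_sgn commutesD(2)[OF t(1)])
  also have "\<dots> = (\<Prod>i\<in>A. ?o i) * (\<Prod>i\<in>A. ?o (\<sigma> i))" by (rule prod.distrib)
  also have "(\<Prod>i\<in>A. ?o (\<sigma> i)) = (\<Prod>i\<in>A. ?o i)"
  proof -
    have cyc_\<sigma>: "cyc (\<sigma> i) = cyc i" for i using cyc_pow[of 1 i] by simp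
    have "\<sigma> ` A \<subseteq> A"
      by (auto simp: A_def commutesD(3)[OF commutes_\<sigma>] commutesD(2)[OF t(1)] cyc_\<sigma>)
    moreover have inj: "inj_on \<sigma> A" using permutes_inj[OF \<sigma>] inj_on_subset by blast
    moreover have "finite A" using finite_N by (simp add: A_def)
    ultimately have "\<sigma> ` A = A" using endo_inj_surj by blast
    then show ?thesis using prod.reindex[OF inj, of ?o] by (simp add: o_def)
  qed
  also have "(\<Prod>i\<in>A. ?o i) * (\<Prod>i\<in>A. ?o i) = (\<Prod>i\<in>A. ?o i * ?o i)" by (rule prod.distrib[symmetric])
  also have "\<dots> = 1" by (intro prod.neutral) (auto simp: sgn_if dest!: moved)
  finally show ?thesis .
qed

text \<open>Half of the cycle is a transversal. The product along it telescopes to the orientations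
  at \<open>b\<close> and at \<open>t b\<close>, which belong to the same pair read in opposite
  directions.\<close>

lemma pair_sign_half_turn:
  assumes t: "commutes t" "t \<circ> t = id" and b: "b \<in> N" and len: "len b = 2 * h"
    and tb: "t b = (\<sigma> ^^ h) b"
  shows "pair_sign {i \<in> N. cyc i = cyc b} \<sigma> t = - 1"
proof -
  let ?D = "{i \<in> N. cyc i = cyc b}"
  let ?p = "\<lambda>j. (\<sigma> ^^ j) b"
  let ?o = "\<lambda>j. sgn (int (t (?p j)) - int (?p j))"
  have h: "0 < h" using len len_pos[of b] by simp
  have t_p: "t (?p j) = ?p (h + j)" for j by (simp add: commutes_pow[OF t(1)] tb pow_add add.commute)
  have p_small: "?p j = ?p k \<longleftrightarrow> j = k" if "j < len b" "k < len b" for j k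
    using that by (simp add: pow_eq_iff)
  have moved: "t (?p j) \<noteq> ?p j" for j
    using p_small[of h 0] h len tb commutes_pow[OF t(1), of j b] pow_inj[of j] by auto
  have D: "\<exists>j<len b. i = ?p j" if "i \<in> ?D" for i
  proof -
    obtain k where "i = ?p k" using \<open>i \<in> ?D\<close> cyc_eqE[of b i] by (metis (mono_tags, lifting) mem_Collect_eq)
    then have "i = ?p (k mod len b)" by (simp add: pow_eq_iff)
    then show ?thesis using len_pos[of b] by (intro exI[of _ "k mod len b"]) simp
  qed
  have "pair_sign ?D \<sigma> t = (\<Prod>i\<in>?p ` {..<h}. flip_sign \<sigma> i (t i))"
  proof (rule pair_sign_transversal)
    show "t (t i) = i" for i by (rule involutionD[OF t(2)])
    show "t ` ?D \<subseteq> ?D"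
    proof
      fix i assume "i \<in> t ` ?D"
      then obtain j where "j \<in> ?D" "i = t j" by blast
      moreover from this obtain k where "j = ?p k" using D by blast
      ultimately show "i \<in> ?D" by (auto simp: t_p cyc_pow pow_in_N b)
    qed
    show "?p ` {..<h} \<subseteq> ?D" using b by (auto simp: cyc_pow pow_in_N)
    show "t i \<notin> ?p ` {..<h}" if "i \<in> ?p ` {..<h}" for i
    proof
      assume "t i \<in> ?p ` {..<h}"
      with that obtain j k where "j < h" "k < h" "i = ?p j" "t i = ?p k" by auto
      then show False using p_small[of "h + j" k] len by (auto simp: t_p)
    qed
    show "i \<in> ?p ` {..<h} \<or> t i \<in> ?p ` {..<h}" if i: "i \<in> ?D" for i
    proof -
      obtain j where j: "j < len b" "i = ?p j" using D[OF i] by blast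
      show ?thesis
      proof (cases "j < h")
        case True
        then show ?thesis using j by auto
      next
        case False
        then have "h + j = (j - h) + len b" using len by simp
        then have "t i = ?p (j - h)" using j(2) by (simp add: t_p pow_eq_iff)
        then show ?thesis using j(1) len by auto
      qed
    qed
  qed
  also have "\<dots> = (\<Prod>j<h. flip_sign \<sigma> (?p j) (t (?p j)))"
  proof -
    have "inj_on ?p {..<h}" using p_small len by (auto simp: inj_on_def)
    then show ?thesis by (simp add: prod.reindex)
  qed
  also have "\<dots> = (\<Prod>j<h. ?o j * ?o (Suc j))"
  proof (intro prod.cong refl)
    fix j
    have "t (\<sigma> (?p j)) = \<sigma> (t (?p j))" by (rule commutesD(2)[OF t(1)])
    then show "flip_sign \<sigma> (?p j) (t (?p j)) = ?o j * ?o (Suc j)"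
      using moved[of j] commutesD(4)[OF commutes_\<sigma>, of "?p j" "t (?p j)"]
      by (subst flip_sign_sgn) auto
  qed
  also have "\<dots> = ?o 0 * ?o h"
  proof (rule prod_consecutive)
    show "?o j * ?o j = 1" for j using moved[of j] by (auto simp: sgn_if)
  qed
  also have "\<dots> = - 1" using moved[of 0] tb[symmetric] by (simp add: involutionD[OF t(2)] sgn_if)
  finally show ?thesis .
qed

text \<open>
  Exchanging the identity and the half turn on the first cycle on which both are possible reverses
  the sign, so that only the involutions without such a cycle contribute.
\<close>
theorem sum_pair_sign:
  assumes w: "\<And>i. i \<in> N \<Longrightarrow> w (\<sigma> i) = f (w i)" and f: "inj_on f (w ` N)"
  shows "(\<Sum>t\<in>color_involutions w (\<lambda>x. x). pair_sign N \<sigma> t) = int (card (reduced_involutions w (\<lambda>x. x)))"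
proof -
  let ?T = "color_involutions w (\<lambda>x. x)" and ?R = "reduced_involutions w (\<lambda>x. x)"
  \<comment> \<open>Injectivity of \<open>f\<close> on the colors is what lets equality of two
    colors pass between positions and their images under \<open>\<sigma>\<close>.\<close>
  have hti_pow: "half_turn_invariant w ((\<sigma> ^^ k) i) = half_turn_invariant w i" if "i \<in> N" for i k
  proof (induction k)
    case (Suc k)
    let ?j = "(\<sigma> ^^ k) i"
    have j: "?j \<in> N" using that by (simp add: pow_in_N)
    have "len (\<sigma> ?j) = len ?j" by (rule len_commute[OF commutes_\<sigma>])
    moreover have "w ((\<sigma> ^^ l) (\<sigma> ?j)) = w (\<sigma> ?j) \<longleftrightarrow> w ((\<sigma> ^^ l) ?j) = w ?j" for l
      using w[of ?j] w[of "(\<sigma> ^^ l) ?j"] j pow_in_N[of l ?j] inj_onD[OF f, of "w ((\<sigma> ^^ l) ?j)" "w ?j"]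
      by (auto simp: funpow_swap1[symmetric])
    ultimately show ?case using Suc by (simp add: half_turn_invariant_def)
  qed simp
  have hti_cyc: "half_turn_invariant w j = half_turn_invariant w i" if "i \<in> N" "cyc i = cyc j" for i j
    using hti_pow[OF that(1)] cyc_eqE[OF that(2)] by metis
  \<comment> \<open>Both \<open>bad\<close> and \<open>first\<close> depend only on how
    \<open>t\<close> moves cycles. As \<open>toggle\<close> does not alter this, applying it again
    acts on the same cycle and restores \<open>t\<close>.\<close>
  define bad where "bad t = {i \<in> N. cyc (t i) = cyc i \<and> half_turn_invariant w i}" for t
  define first where "first t = Min (cyc ` bad t)" for t
  define toggle where "toggle t i = (if cyc i = first t then (\<sigma> ^^ (len i div 2)) (t i) else t i)" for t i
  have T: "commutes t" "t \<circ> t = id" "t (t i) = i" "i \<in> N \<Longrightarrow> w (t i) = w i" if "t \<in> ?T" for t i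
    using that by (auto simp: color_involutions_def involutionD)
  have bad_iff: "t \<notin> ?R \<longleftrightarrow> bad t \<noteq> {}" if t: "t \<in> ?T" for t
  proof -
    have "half_turn_invariant w i" if "i \<in> N" "cyc (t i) = cyc i" "t i \<noteq> i" for i
      using involution_fixed_cycle[OF T(1,2)[OF t] that(2,3)] T(4)[OF t that(1)]
      by (simp add: half_turn_invariant_def)
    then show ?thesis using t by (auto simp: reduced_involutions_def bad_def)
  qed
  have first: "\<exists>b. b \<in> bad t \<and> cyc b = first t" if "bad t \<noteq> {}" for t
  proof -
    have "finite (bad t)" using finite_N by (simp add: bad_def)
    then have "first t \<in> cyc ` bad t" unfolding first_def using that by (intro Min_in) auto
    then show ?thesis by auto
  qed
  have cyc_toggle: "cyc (toggle t i) = cyc (t i)" for t i by (simp add: toggle_def cyc_pow)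
  have bad_toggle: "bad (toggle t) = bad t" for t by (simp add: bad_def cyc_toggle)
  have first_toggle: "first (toggle t) = first t" for t by (simp add: first_def bad_toggle)
  have toggle: "toggle t \<in> ?T - ?R" "toggle (toggle t) = t" "pair_sign N \<sigma> (toggle t) = - pair_sign N \<sigma> t"
    if t: "t \<in> ?T - ?R" for t
  proof -
    have tT: "t \<in> ?T" and "bad t \<noteq> {}" using t bad_iff by auto
    then obtain b where b: "b \<in> N" "cyc (t b) = cyc b" "half_turn_invariant w b" "cyc b = first t"
      using first[of t] by (auto simp: bad_def)
    note c = T(1)[OF tT] and tt = T(3)[OF tT]
    have in_first: "cyc (t i) = first t \<longleftrightarrow> cyc i = first t" for i
      using cyc_commute[OF c, of i b] b(2,4) by simp
    have hti: "half_turn_invariant w i" if "cyc i = first t" for i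
      using hti_cyc[OF b(1), of i] b that by simp
    obtain h where h: "len b = 2 * h" using b(3) by (auto simp: half_turn_invariant_def elim!: evenE)
    have len_first: "len i = len b" if "cyc i = first t" for i
      using that b(4) cyc_eqE[of b i] len_pow by metis
    have sq: "toggle t (toggle t i) = i" for i
      using in_first[of i] len_first[of i] h
      by (simp add: toggle_def cyc_pow commutes_pow[OF c] tt pow_add pow_eq_self_iff len_pow len_commute[OF c] mult_2)
    have perm: "toggle t permutes N"
    proof -
      have out: "toggle t i = i" if "i \<notin> N" for i
      proof -
        have "t i = i" using permutes_not_in[OF commutesD(1)[OF c] that] .
        moreover have "(\<sigma> ^^ k) i = i" for k using permutes_not_in[OF permutes_funpow[OF \<sigma>] that] .
        ultimately show ?thesis by (simp add: toggle_def)
      qed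
      have "toggle t ` N \<subseteq> N" by (auto simp: toggle_def pow_in_N commutesD(3)[OF c])
      then have "bij_betw (toggle t) N N"
        using sq by (intro bij_betw_byWitness[where f' = "toggle t"]) auto
      then show ?thesis using out by (rule bij_imp_permutes)
    qed
    have "toggle t (\<sigma> i) = \<sigma> (toggle t i)" for i
      using cyc_pow[of 1 i] len_pow[of 1 i]
      by (simp add: toggle_def commutesD(2)[OF c] funpow_swap1)
    then have tc: "commutes (toggle t)" using perm by (auto simp: commutes_def)
    have "w (toggle t i) = w i" if i: "i \<in> N" for i
    proof (cases "cyc i = first t")
      case True
      have "t i \<in> N" using i commutesD(3)[OF c] by simp
      moreover have "half_turn_invariant w (t i)" using True in_first hti by simp
      ultimately show ?thesis
        using True T(4)[OF tT i] by (simp add: toggle_def half_turn_invariant_def len_commute[OF c])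
    next
      case False
      then show ?thesis using T(4)[OF tT i] by (simp add: toggle_def)
    qed
    then have toggle_T: "toggle t \<in> ?T" using tc sq by (auto simp: color_involutions_def)
    then show "toggle t \<in> ?T - ?R" using bad_iff[of "toggle t"] \<open>bad t \<noteq> {}\<close> by (simp add: bad_toggle)
    show "toggle (toggle t) = t"
    proof
      fix i
      show "toggle (toggle t) i = t i"
        using len_first[of i] h len_commute[OF c, of i]
        by (simp add: toggle_def[of "toggle t"] first_toggle)
          (simp add: toggle_def pow_add pow_eq_self_iff mult_2)
    qed
    let ?D = "{i \<in> N. cyc i = cyc b}"
    have id_sign: "pair_sign ?D \<sigma> u = 1" if "commutes u" "u b = b" for u
    proof -
      have "u i = i" if i: "i \<in> ?D" for i
      proof -
        have "cyc b = cyc i" using i by simp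
        then obtain k where "i = (\<sigma> ^^ k) b" by (rule cyc_eqE)
        then show ?thesis using \<open>u b = b\<close> by (simp add: commutes_pow[OF \<open>commutes u\<close>])
      qed
      then have "{i \<in> ?D. i < u i} = {}" by auto
      then show ?thesis unfolding pair_sign_def by (simp only: prod.empty)
    qed
    have half_sign: "pair_sign ?D \<sigma> u = - 1" if "u \<in> ?T" "u b = (\<sigma> ^^ h) b" for u
      using pair_sign_half_turn[OF T(1,2)[OF that(1)] b(1) h that(2)] .
    have "pair_sign ?D \<sigma> (toggle t) = - pair_sign ?D \<sigma> t"
    proof (cases "t b = b")
      case True
      then have "toggle t b = (\<sigma> ^^ h) b" using b(4) h by (simp add: toggle_def)
      then show ?thesis using id_sign[OF c True] half_sign[OF toggle_T] by simp
    next
      case False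
      then have tb: "t b = (\<sigma> ^^ h) b" using involution_fixed_cycle(2)[OF T(1,2)[OF tT] b(2)] h by simp
      then have "toggle t b = b" using b(4) h by (simp add: toggle_def pow_add pow_eq_self_iff mult_2)
      then show ?thesis using id_sign[OF tc] half_sign[OF tT tb] by simp
    qed
    moreover have "pair_sign (N - ?D) \<sigma> (toggle t) = pair_sign (N - ?D) \<sigma> t"
      using b(4) by (intro pair_sign_cong) (auto simp: toggle_def)
    ultimately show "pair_sign N \<sigma> (toggle t) = - pair_sign N \<sigma> t"
      using pair_sign_split[OF finite_N, of ?D \<sigma>] by simp
  qed
  have "(\<Sum>t\<in>?T - ?R. pair_sign N \<sigma> t) = (\<Sum>t\<in>?T - ?R. - pair_sign N \<sigma> t)"
    using toggle by (intro sum.reindex_bij_witness[of _ toggle toggle]) auto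
  then have zero: "(\<Sum>t\<in>?T - ?R. pair_sign N \<sigma> t) = 0" by (simp add: sum_negf)
  have "?R \<subseteq> ?T" by (auto simp: reduced_involutions_def)
  then have "(\<Sum>t\<in>?T. pair_sign N \<sigma> t) = (\<Sum>t\<in>?R. pair_sign N \<sigma> t)"
    using sum.subset_diff[OF _ finite_color_involutions, of ?R w "\<lambda>x. x" "pair_sign N \<sigma>"] zero by simp
  also have "\<dots> = (\<Sum>t\<in>?R. 1)"
    by (intro sum.cong refl pair_sign_eq_1) (auto simp: reduced_involutions_def color_involutions_def)
  finally show ?thesis by simp
qed

corollary card_colored_square_roots:
  assumes w: "\<And>i. i \<in> N \<Longrightarrow> w (\<sigma> i) = w i"
  shows "int (card {s. s permutes N \<and> s \<circ> s = \<sigma> \<and> (\<forall>i\<in>N. w (s i) = w i)})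
    = (\<Sum>t\<in>color_involutions w (\<lambda>x. x). pair_sign N \<sigma> t)"
  using card_square_roots[of w "\<lambda>x. x"] sum_pair_sign[of w "\<lambda>x. x"] w by simp

text \<open>Colors are constant on cycles and \<open>f\<close> moves every color, so no cycle is
  preserved and every admissible involution is reduced.\<close>

corollary card_color_swapping_square_roots:
  assumes w: "\<And>i. i \<in> N \<Longrightarrow> w (\<sigma> i) = w i" and f: "\<And>i. i \<in> N \<Longrightarrow> f (w i) \<noteq> w i"
  shows "card {s. s permutes N \<and> s \<circ> s = \<sigma> \<and> (\<forall>i\<in>N. w (s i) = f (w i))} = card (color_involutions w f)"
proof -
  have w_pow: "w ((\<sigma> ^^ k) i) = w i" if "i \<in> N" for i k
    using that w pow_in_N by (induction k) auto
  have "cyc (t i) \<noteq> cyc i" if "t \<in> color_involutions w f" "i \<in> N" for t i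
  proof
    assume "cyc (t i) = cyc i"
    then obtain k where "t i = (\<sigma> ^^ k) i" using cyc_eqE[of i "t i"] by metis
    then show False using that w_pow[of i k] f[of i] by (auto simp: color_involutions_def)
  qed
  then have "reduced_involutions w f = color_involutions w f" by (auto simp: reduced_involutions_def)
  then show ?thesis using card_square_roots[of w f] w by simp
qed

corollary sum_pair_sign_shifted:
  assumes "\<And>i. i \<in> N \<Longrightarrow> w (\<sigma> i) = f (w i)"
    and "\<And>i. i \<in> N \<Longrightarrow> f (f (w i)) = w i" "\<And>i. i \<in> N \<Longrightarrow> f (w i) \<noteq> w i"
  shows "(\<Sum>t\<in>color_involutions w (\<lambda>x. x). pair_sign N \<sigma> t) = int (card (color_involutions w f))"
proof -
  have "inj_on f (w ` N)" using assms(2) by (intro inj_on_inverseI[of _ f]) auto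
  then show ?thesis using sum_pair_sign[of w f] card_shifted_involutions[of w f] assms by simp
qed

end

section \<open>Fourier analysis on colors\<close>

lemma zeta_nonzero: "zeta r \<noteq> 0" by (simp add: zeta_def)

lemma zeta_powi: "zeta r powi x = cis (of_int x * (2 * pi / of_nat r))"
proof -
  have "zeta r = cis (2 * pi / of_nat r)" by (simp add: zeta_def cis_conv_exp mult.commute)
  then show ?thesis by (simp only: cis_power_int)
qed

lemma zeta_powi_add: "zeta r powi (x + y) = zeta r powi x * zeta r powi y"
  by (simp add: power_int_add zeta_nonzero)

lemma zeta_powi_eq_1_iff:
  assumes "0 < r"
  shows "zeta r powi x = 1 \<longleftrightarrow> int r dvd x"
proof
  assume "zeta r powi x = 1"
  then have "cos (of_int x * (2 * pi / of_nat r)) = 1" unfolding zeta_powi by (simp add: complex_eq_iff)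
  then obtain m :: int where "of_int x * (2 * pi / of_nat r) = of_int m * 2 * pi"
    unfolding cos_one_2pi_int by blast
  then have "real_of_int x = real_of_int (m * int r)"
    using assms by (simp add: field_simps)
  then have "x = m * int r" by (simp only: of_int_eq_iff)
  then show "int r dvd x" by simp
next
  assume "int r dvd x"
  then obtain m where "x = int r * m" by (elim dvdE)
  then have "zeta r powi x = cis (2 * pi * of_int m)"
    unfolding zeta_powi using assms by (simp add: field_simps)
  then show "zeta r powi x = 1" by simp
qed

lemma zeta_powi_cong:
  assumes "0 < r" "int r dvd x - y"
  shows "zeta r powi x = zeta r powi y"
proof -
  have "zeta r powi (x - y) = 1" using assms zeta_powi_eq_1_iff by blast
  then show ?thesis using zeta_powi_add[of r "x - y" y] by simp
qed

lemma zeta_powi_mod: "0 < r \<Longrightarrow> zeta r powi (x mod int r) = zeta r powi x"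
  by (intro zeta_powi_cong) (simp_all add: mod_eq_dvd_iff[symmetric])

lemma zeta_powi_half:
  assumes "0 < r" "int r dvd 2 * k" "\<not> int r dvd k"
  shows "zeta r powi k = - 1"
proof -
  have "zeta r powi (k + k) = 1"
    unfolding zeta_powi_eq_1_iff[OF assms(1)] using assms(2) by (simp only: mult_2)
  then have "zeta r powi k * zeta r powi k = 1" by (simp only: zeta_powi_add)
  moreover have "zeta r powi k \<noteq> 1" using zeta_powi_eq_1_iff[OF assms(1)] assms(3) by simp
  ultimately show ?thesis by (simp add: square_eq_1_iff)
qed

text \<open>The residues \<open>k\<close> modulo \<open>r\<close> for which the scalar with all colors \<open>k\<close> lies in \<open>C_p\<close>.\<close>
definition scalar_colors :: "nat \<Rightarrow> nat \<Rightarrow> int set" where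
  "scalar_colors r p = {k \<in> {0..<int r}. int r dvd int p * k}"

lemma scalar_colors_eq:
  assumes "0 < p" "p dvd r" "0 < r"
  shows "scalar_colors r p = (\<lambda>j. int (r div p) * j) ` {0..<int p}"
proof -
  obtain q where q: "r = p * q" using assms(2) by (elim dvdE)
  then have "0 < q" using assms(3) by auto
  have "k \<in> scalar_colors r p \<longleftrightarrow> k \<in> (\<lambda>j. int q * j) ` {0..<int p}" for k
  proof
    assume k: "k \<in> scalar_colors r p"
    then have "int p * int q dvd int p * k" by (simp add: scalar_colors_def q)
    then have "int q dvd k" using assms(1) by simp
    then obtain j where j: "k = int q * j" by (elim dvdE)
    then have "0 \<le> j" "j < int p"
      using k \<open>0 < q\<close> by (auto simp: scalar_colors_def q zero_le_mult_iff mult.commute)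
    then show "k \<in> (\<lambda>j. int q * j) ` {0..<int p}" using j by auto
  qed (use \<open>0 < q\<close> in \<open>auto simp: scalar_colors_def q mult.commute\<close>)
  then show ?thesis using assms(1) by (auto simp: q)
qed

lemma card_scalar_colors:
  assumes "0 < p" "p dvd r" "0 < r"
  shows "card (scalar_colors r p) = p"
proof -
  have "0 < r div p" using assms by (simp add: div_greater_zero_iff dvd_imp_le)
  then have "inj_on (\<lambda>j. int (r div p) * j) {0..<int p}" by (auto simp: inj_on_def)
  then show ?thesis unfolding scalar_colors_eq[OF assms] by (simp add: card_image)
qed

lemma finite_scalar_colors: "finite (scalar_colors r p)"
  using finite_subset[of "scalar_colors r p" "{0..<int r}"] unfolding scalar_colors_def by blast

lemma zero_scalar_color: "0 < r \<Longrightarrow> 0 \<in> scalar_colors r p"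
  by (simp add: scalar_colors_def)

lemma scalar_colors_mod:
  assumes "0 < r" "int r dvd int p * x"
  shows "x mod int r \<in> scalar_colors r p"
  using assms by (simp add: scalar_colors_def dvd_mult_mod_iff)

lemma sum_scalar_colors:
  assumes "0 < p" "p dvd r" "0 < r"
  shows "(\<Sum>k\<in>scalar_colors r p. zeta r powi (k * x)) = (if int p dvd x then of_nat p else 0)"
proof (cases "int p dvd x")
  case True
  have "zeta r powi (k * x) = 1" if "k \<in> scalar_colors r p" for k
  proof -
    obtain y where "x = int p * y" using True by (elim dvdE)
    then show ?thesis using that assms(3)
      by (simp add: zeta_powi_eq_1_iff scalar_colors_def mult.left_commute[of k] flip: mult.assoc)
        (simp add: mult.commute[of k])
  qed
  then show ?thesis using True by (simp add: card_scalar_colors[OF assms])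
next
  case False
  obtain q where q: "r = p * q" using assms(2) by (elim dvdE)
  let ?S = "\<Sum>k\<in>scalar_colors r p. zeta r powi (k * x)"
  \<comment> \<open>Translation by \<open>q = r div p\<close> permutes the index set and multiplies
    the sum by \<open>\<zeta>^(q * x)\<close>, which differs from 1; so the sum vanishes.\<close>
  have "?S = (\<Sum>k\<in>scalar_colors r p. zeta r powi ((k + int q) mod int r * x))"
  proof (rule sum.reindex_bij_witness[of _ "\<lambda>k. (k + int q) mod int r" "\<lambda>k. (k - int q) mod int r"])
    fix k assume k: "k \<in> scalar_colors r p"
    then have k': "0 \<le> k" "k < int r" "int r dvd int p * k" by (auto simp: scalar_colors_def)
    have "int r dvd int p * int q" by (simp add: q)
    then show "(k - int q) mod int r \<in> scalar_colors r p" "(k + int q) mod int r \<in> scalar_colors r p"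
      using k' by (intro scalar_colors_mod assms(3); simp add: distrib_left right_diff_distrib)+
    show "((k - int q) mod int r + int q) mod int r = k" "((k + int q) mod int r - int q) mod int r = k"
      using k' by (simp_all add: mod_simps)
    then show "zeta r powi (((k - int q) mod int r + int q) mod int r * x) = zeta r powi (k * x)" by simp
  qed
  also have "\<dots> = (\<Sum>k\<in>scalar_colors r p. zeta r powi (int q * x) * zeta r powi (k * x))"
  proof (intro sum.cong refl)
    fix k
    have "zeta r powi ((k + int q) mod int r * x) = zeta r powi ((k + int q) * x)"
      using zeta_powi_mod[OF assms(3)] by (metis mod_mult_left_eq)
    also have "\<dots> = zeta r powi (int q * x) * zeta r powi (k * x)"
      by (simp add: distrib_right zeta_powi_add)
    finally show "zeta r powi ((k + int q) mod int r * x) = zeta r powi (int q * x) * zeta r powi (k * x)" .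
  qed
  also have "\<dots> = zeta r powi (int q * x) * ?S" by (simp add: sum_distrib_left)
  finally have "?S = zeta r powi (int q * x) * ?S" .
  moreover have "zeta r powi (int q * x) \<noteq> 1"
    using False assms by (auto simp: zeta_powi_eq_1_iff q mult.commute[of "int p"])
  ultimately have "?S = 0" by auto
  then show ?thesis using False by simp
qed

lemma zeta_powi_sum: "zeta r powi (\<Sum>i\<in>A. f i) = (\<Prod>i\<in>A. zeta r powi f i)"
  by (induction A rule: infinite_finite_induct) (auto simp: zeta_powi_add)

text \<open>The sum factors over \<open>A\<close>. Each factor is an instance of
  \<open>sum_scalar_colors\<close> with \<open>p = r\<close>, where every residue is a scalar
  color.\<close>

lemma sum_colorings:
  assumes "0 < r" "finite A"
  shows "(\<Sum>z\<in>A \<rightarrow>\<^sub>E {0..<int r}. zeta r powi (\<Sum>i\<in>A. z i * c i)) =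
    (if \<forall>i\<in>A. int r dvd c i then of_nat (r ^ card A) else 0)"
proof -
  have r: "scalar_colors r r = {0..<int r}" by (auto simp: scalar_colors_def)
  have "(\<Sum>z\<in>A \<rightarrow>\<^sub>E {0..<int r}. zeta r powi (\<Sum>i\<in>A. z i * c i))
      = (\<Prod>i\<in>A. \<Sum>x\<in>{0..<int r}. zeta r powi (x * c i))"
    unfolding zeta_powi_sum using assms(2) by (intro prod_sum_PiE[symmetric]) auto
  also have "\<dots> = (\<Prod>i\<in>A. if int r dvd c i then of_nat r else 0)"
    using sum_scalar_colors[OF assms(1) dvd_refl assms(1)] by (simp add: r)
  also have "\<dots> = (if \<forall>i\<in>A. int r dvd c i then of_nat (r ^ card A) else 0)"
    using assms(2) by (auto intro: prod_zero)
  finally show ?thesis .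
qed

text \<open>Fourier inversion on \<open>(\<int>/r)\<^sup>A\<close> and on \<open>\<int>/p\<close>.\<close>
lemma card_coboundary_solutions:
  assumes "0 < p" "p dvd r" "0 < r" "finite A" and s: "s permutes (A :: nat set)"
  shows "of_nat p * of_nat (card {z \<in> A \<rightarrow>\<^sub>E {0..<int r}.
            (\<forall>i\<in>A. int r dvd z (s i) - z i - a i) \<and> int p dvd (\<Sum>i\<in>A. z i)})
       = (\<Sum>k\<in>scalar_colors r p. \<Sum>w\<in>{w \<in> A \<rightarrow>\<^sub>E {0..<int r}. \<forall>i\<in>A. int r dvd w (s i) - w i - k}.
            zeta r powi (\<Sum>i\<in>A. a i * w i))"
proof -
  let ?Z = "A \<rightarrow>\<^sub>E {0..<int r}" and ?K = "scalar_colors r p"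
  let ?R = "of_nat (r ^ card A) :: complex"
  have fZ: "finite ?Z" using assms(4) by (intro finite_PiE) auto
  have reindex: "(\<Sum>i\<in>A. w i * z (s i)) = (\<Sum>i\<in>A. w (inv_into UNIV s i) * z i)" for w z :: "nat \<Rightarrow> int"
    by (subst sum.permute[OF s, of "\<lambda>i. w (inv_into UNIV s i) * z i"])
      (simp add: o_def permutes_inverses[OF s])
  \<comment> \<open>Summation by parts moves \<open>s\<close> from \<open>z\<close> to
    \<open>w\<close>, so that the sum over \<open>z\<close> can be carried out for fixed
    \<open>k\<close> and \<open>w\<close>.\<close>
  have ex: "(- k) * (\<Sum>i\<in>A. z i) + (\<Sum>i\<in>A. w i * (a i + z i - z (s i)))
      = (\<Sum>i\<in>A. a i * w i) + (\<Sum>i\<in>A. z i * (w i - w (inv_into UNIV s i) - k))" for k z w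
  proof -
    have "(- k) * (\<Sum>i\<in>A. z i) + (\<Sum>i\<in>A. w i * (a i + z i - z (s i)))
      = (\<Sum>i\<in>A. a i * w i) + (\<Sum>i\<in>A. z i * w i) - (\<Sum>i\<in>A. w i * z (s i)) - k * (\<Sum>i\<in>A. z i)"
      by (simp add: algebra_simps sum.distrib sum_subtractf)
    also have "\<dots> = (\<Sum>i\<in>A. a i * w i) + (\<Sum>i\<in>A. z i * (w i - w (inv_into UNIV s i) - k))"
      unfolding reindex by (simp add: algebra_simps sum.distrib sum_subtractf sum_distrib_left)
    finally show ?thesis .
  qed
  \<comment> \<open>Each condition on \<open>z\<close> is about to become a character sum:
    \<open>k\<close> is dual to the color sum modulo \<open>p\<close>, and \<open>w\<close> to the
    equations at the positions. The minus sign makes the dual condition read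
    \<open>w (s i) - w i - k\<close>.\<close>
  have "?R * (of_nat p * of_nat (card {z \<in> ?Z. (\<forall>i\<in>A. int r dvd z (s i) - z i - a i) \<and> int p dvd (\<Sum>i\<in>A. z i)}))
      = (\<Sum>z\<in>?Z. (if int p dvd - (\<Sum>i\<in>A. z i) then of_nat p else 0) *
          (if \<forall>i\<in>A. int r dvd a i + z i - z (s i) then ?R else 0))"
  proof -
    have "int r dvd a i + z i - z (s i) \<longleftrightarrow> int r dvd z (s i) - z i - a i" for z i
      by (metis (no_types, opaque_lifting) diff_diff_eq diff_minus_eq_add dvd_minus_iff minus_diff_eq add.commute)
    then have "(\<Sum>z\<in>?Z. (if int p dvd - (\<Sum>i\<in>A. z i) then of_nat p else 0) *
          (if \<forall>i\<in>A. int r dvd a i + z i - z (s i) then ?R else 0))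
      = (\<Sum>z\<in>?Z. if (\<forall>i\<in>A. int r dvd z (s i) - z i - a i) \<and> int p dvd (\<Sum>i\<in>A. z i) then ?R * of_nat p else 0)"
      by (intro sum.cong) (auto simp: dvd_minus_iff)
    then show ?thesis using fZ by (simp add: sum.If_cases Int_def mult_ac)
  qed
  also have "\<dots> = (\<Sum>z\<in>?Z. (\<Sum>k\<in>?K. zeta r powi (k * - (\<Sum>i\<in>A. z i))) *
      (\<Sum>w\<in>?Z. zeta r powi (\<Sum>i\<in>A. w i * (a i + z i - z (s i)))))"
    unfolding sum_scalar_colors[OF assms(1-3)] sum_colorings[OF assms(3,4)] ..
  also have "\<dots> = (\<Sum>z\<in>?Z. \<Sum>k\<in>?K. \<Sum>w\<in>?Z.
      zeta r powi ((- k) * (\<Sum>i\<in>A. z i) + (\<Sum>i\<in>A. w i * (a i + z i - z (s i)))))"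
    unfolding sum_product zeta_powi_add by simp
  also have "\<dots> = (\<Sum>k\<in>?K. \<Sum>w\<in>?Z. \<Sum>z\<in>?Z.
      zeta r powi (\<Sum>i\<in>A. a i * w i) * zeta r powi (\<Sum>i\<in>A. z i * (w i - w (inv_into UNIV s i) - k)))"
    unfolding ex zeta_powi_add
    by (subst sum.swap[of _ ?K ?Z]) (rule sum.cong[OF refl], rule sum.swap)
  also have "\<dots> = (\<Sum>k\<in>?K. \<Sum>w\<in>?Z. zeta r powi (\<Sum>i\<in>A. a i * w i) *
      (if \<forall>i\<in>A. int r dvd w i - w (inv_into UNIV s i) - k then ?R else 0))"
    unfolding sum_distrib_left[symmetric] sum_colorings[OF assms(3,4)] ..
  also have "\<dots> = (\<Sum>k\<in>?K. \<Sum>w\<in>?Z. if \<forall>i\<in>A. int r dvd w (s i) - w i - k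
      then ?R * zeta r powi (\<Sum>i\<in>A. a i * w i) else 0)"
  proof -
    have "(\<forall>i\<in>A. int r dvd w i - w (inv_into UNIV s i) - k) \<longleftrightarrow> (\<forall>i\<in>A. int r dvd w (s i) - w i - k)" for w k
    proof -
      have "(\<forall>i\<in>s ` A. int r dvd w i - w (inv_into UNIV s i) - k) \<longleftrightarrow> (\<forall>i\<in>A. int r dvd w (s i) - w i - k)"
        by (simp add: permutes_inverses[OF s])
      then show ?thesis by (simp add: permutes_image[OF s])
    qed
    then show ?thesis by (intro sum.cong refl) (auto simp: mult.commute)
  qed
  also have "\<dots> = ?R * (\<Sum>k\<in>?K. \<Sum>w\<in>{w \<in> ?Z. \<forall>i\<in>A. int r dvd w (s i) - w i - k}. zeta r powi (\<Sum>i\<in>A. a i * w i))"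
    using fZ by (simp add: sum.If_cases Int_def sum_distrib_left)
  finally show ?thesis using assms(3) by simp
qed

lemma (in finite_perm) color_involutions_cong:
  assumes "\<And>i. i \<in> N \<Longrightarrow> f (w i) = f' (w i)"
  shows "color_involutions w f = color_involutions w f'"
  using assms by (auto simp: color_involutions_def)

text \<open>Summation over \<open>N\<close> cancels \<open>w\<close> and leaves
  \<open>card N * k\<close>; Bezout combines this with \<open>p * k\<close>.\<close>

lemma double_shift_eq_0:
  fixes w :: "nat \<Rightarrow> int"
  assumes s: "s permutes N" and "finite N" and shift: "\<And>i. i \<in> N \<Longrightarrow> int r dvd w (s i) - w i - k"
    and p: "int r dvd int p * k" and gcd: "gcd p (card N) dvd 2"
  shows "int r dvd 2 * k"
proof -
  have "int r dvd (\<Sum>i\<in>N. w (s i) - w i - k)" using shift by (rule dvd_sum)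
  also have "(\<Sum>i\<in>N. w (s i) - w i - k) = - (int (card N) * k)"
    using sum.permute[OF s, of w] by (simp add: sum_subtractf o_def)
  finally have n: "int r dvd int (card N) * k" by simp
  obtain u v where "u * int p + v * int (card N) = gcd (int p) (int (card N))"
    using bezout_int by blast
  then have "int (gcd p (card N)) * k = (u * int p + v * int (card N)) * k" by simp
  then have "int (gcd p (card N)) * k = u * (int p * k) + v * (int (card N) * k)"
    by (simp only: distrib_right mult.assoc)
  then have "int r dvd int (gcd p (card N)) * k" using p n by simp
  moreover have "int (gcd p (card N)) dvd 2" using gcd by (metis int_dvd_int_iff of_nat_numeral)
  ultimately show ?thesis by (meson dvd_trans dvd_refl mult_dvd_mono)
qed

section \<open>Comparison of the two counts for a fixed coloring\<close>

locale coloring = finite_perm +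
  fixes w :: "nat \<Rightarrow> int" and r p :: nat
  assumes r: "0 < r" and w: "w \<in> N \<rightarrow>\<^sub>E {0..<int r}" and N: "N \<noteq> {}" and gcd: "gcd p (card N) dvd 2"
begin

definition shift :: "int \<Rightarrow> int \<Rightarrow> int" where "shift k x = (x + k) mod int r"

lemma w_range: "i \<in> N \<Longrightarrow> 0 \<le> w i \<and> w i < int r" using w by (auto simp: PiE_iff)

lemma shift_iff:
  assumes "i \<in> N" "j \<in> N"
  shows "w j = shift k (w i) \<longleftrightarrow> int r dvd w j - w i - k"
proof -
  have "w j = shift k (w i) \<longleftrightarrow> w j mod int r = (w i + k) mod int r"
    using w_range[OF assms(2)] by (simp add: shift_def)
  then show ?thesis by (simp add: mod_eq_dvd_iff diff_diff_eq)
qed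

lemma shift_0: "i \<in> N \<Longrightarrow> shift 0 (w i) = w i" using w_range[of i] by (simp add: shift_def)

lemma shift_shift:
  assumes "i \<in> N" "int r dvd 2 * k"
  shows "shift k (shift k (w i)) = w i"
proof -
  have "(w i + 2 * k) mod int r = w i mod int r" using assms(2) by (simp add: mod_eq_dvd_iff)
  then show ?thesis using w_range[OF assms(1)] by (simp add: shift_def mod_simps algebra_simps)
qed

lemma shift_neq:
  assumes "i \<in> N" "k \<in> {0..<int r}" "k \<noteq> 0"
  shows "shift k (w i) \<noteq> w i"
proof
  assume "shift k (w i) = w i"
  then have "int r dvd k" using shift_iff[OF assms(1,1), of k] by simp
  then show False using assms(2,3) zdvd_imp_le[of "int r" k] by auto
qed

text \<open>Makes the nonzero shift unique: in \<open>coloring_identity\<close> only the indices 0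
  and \<open>k\<close> can then contribute.\<close>

lemma colors_involutive:
  assumes "int r dvd 2 * k" "k \<in> {0..<int r}" "k \<noteq> 0"
  shows "2 * k = int r"
proof -
  obtain q where q: "2 * k = int r * q" using assms(1) by (elim dvdE)
  have "k < int r" using assms(2) by simp
  then have "int r * q < int r * 2" unfolding q[symmetric] by linarith
  moreover have "0 < int r * q" unfolding q[symmetric] using assms(2,3) by auto
  ultimately have *: "0 < int r * q" "int r * q < int r * 2" by blast+
  have "0 < q" using *(1) r by (simp add: zero_less_mult_iff)
  moreover have "q < 2" by (rule mult_left_less_imp_less[OF *(2)]) simp
  ultimately have "q = 1" by linarith
  then show ?thesis using q by simp
qed

abbreviation "K \<equiv> scalar_colors r p"
abbreviation "shifts s k \<equiv> (\<forall>i\<in>N. int r dvd w (s i) - w i - k)"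

lemma shifts_unique:
  assumes "shifts s k" "shifts s l" "k \<in> K" "l \<in> K"
  shows "k = l"
proof -
  obtain i where i: "i \<in> N" using N by blast
  then have "int r dvd (w (s i) - w i - k) - (w (s i) - w i - l)" using assms(1,2) dvd_diff by blast
  then have "l mod int r = k mod int r" by (simp add: mod_eq_dvd_iff)
  then show ?thesis using assms(3,4) by (simp add: scalar_colors_def)
qed

lemma shifts_2:
  assumes "s permutes N" "shifts s k" "k \<in> K"
  shows "int r dvd 2 * k"
  using assms by (intro double_shift_eq_0[OF _ finite_N _ _ gcd, of s r w]) (auto simp: scalar_colors_def)

lemma square_root_shifts:
  assumes "s permutes N" "s \<circ> s = \<sigma>" "shifts s k" "k \<in> K"
  shows "shifts \<sigma> 0"
proof
  fix i assume i: "i \<in> N"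
  have "s i \<in> N" using permutes_in_image[OF assms(1)] i by blast
  then have "int r dvd (w (s (s i)) - w (s i) - k) + (w (s i) - w i - k) + 2 * k"
    using assms(3) i shifts_2[OF assms(1,3,4)] by (intro dvd_add) auto
  then show "int r dvd w (\<sigma> i) - w i - 0" using assms(2) by (auto simp: algebra_simps)
qed

abbreviation "roots k \<equiv> {s. s permutes N \<and> s \<circ> s = \<sigma> \<and> shifts s k}"

lemma roots_eq: "roots k = {s. s permutes N \<and> s \<circ> s = \<sigma> \<and> (\<forall>i\<in>N. w (s i) = shift k (w i))}"
proof -
  have "(\<forall>i\<in>N. w (s i) = shift k (w i)) \<longleftrightarrow> shifts s k" if "s permutes N" for s
    using shift_iff permutes_in_image[OF that] by (intro ball_cong) auto
  then show ?thesis by blast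
qed

lemma shiftsD: "shifts s k \<Longrightarrow> s permutes N \<Longrightarrow> i \<in> N \<Longrightarrow> w (s i) = shift k (w i)"
  using shift_iff permutes_in_image[of s N i] by auto

text \<open>On the right, \<open>l\<close> is the shift of the involution \<open>t\<close> and
  \<open>k\<close> that of \<open>\<sigma>\<close>. The terms with \<open>l = 0\<close> belong to
  symmetric lifts, the others to antisymmetric ones, for which \<open>k\<close> is the exponent
  \<open>u\<close> modulo \<open>r\<close>.\<close>

theorem coloring_identity:
  "(\<Sum>k\<in>K. of_nat (card (roots k)) :: complex) =
   (\<Sum>l\<in>K. \<Sum>k\<in>K. \<Sum>t\<in>color_involutions w (shift l).
      if shifts \<sigma> k then if l = 0 then of_int (pair_sign N \<sigma> t) else zeta r powi k else 0)"
  (is "?lhs = ?rhs")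
proof -
  have zero: "0 \<in> K" using r by (rule zero_scalar_color)
  have sign0: "(\<Sum>t\<in>color_involutions w (shift 0). (of_int (pair_sign N \<sigma> t) :: complex))
      = of_int (\<Sum>t\<in>color_involutions w (\<lambda>x. x). pair_sign N \<sigma> t)"
    using color_involutions_cong[of "shift 0" w "\<lambda>x. x"] shift_0 by simp
  \<comment> \<open>\<open>\<sigma>\<close> shifts \<open>w\<close> by at most one residue in
    \<open>K\<close>, so the sum over \<open>k\<close> has a single nonzero term.\<close>
  have collapse: "?rhs = (\<Sum>l\<in>K. \<Sum>t\<in>color_involutions w (shift l).
      if l = 0 then of_int (pair_sign N \<sigma> t) else zeta r powi k)" if k: "k \<in> K" "shifts \<sigma> k" for k
  proof (rule sum.cong[OF refl])
    fix l
    let ?f = "\<lambda>k'. \<Sum>t\<in>color_involutions w (shift l).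
      if shifts \<sigma> k' then if l = 0 then of_int (pair_sign N \<sigma> t) else zeta r powi k' else 0"
    have "?f k' = 0" if "k' \<in> K - {k}" for k'
    proof -
      have "\<not> shifts \<sigma> k'" using shifts_unique[OF k(2) _ k(1)] that by blast
      then show ?thesis by (simp only: if_False sum.neutral_const)
    qed
    then have "sum ?f K = sum ?f {k}"
      using k(1) finite_scalar_colors by (intro sum.mono_neutral_right) auto
    then show "sum ?f K = (\<Sum>t\<in>color_involutions w (shift l).
        if l = 0 then of_int (pair_sign N \<sigma> t) else zeta r powi k)"
      using k(2) by (simp only: if_True) simp
  qed
  show ?thesis
  proof (cases "\<exists>k\<in>K. shifts \<sigma> k")
    case False
    \<comment> \<open>A root of shift \<open>k\<close> would make \<open>\<sigma>\<close> shift
      \<open>w\<close> by \<open>2 * k\<close>, that is, by 0.\<close>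
    have "roots k = {}" if "k \<in> K" for k using square_root_shifts[of _ k] that False zero by blast
    then have "?lhs = 0" by (intro sum.neutral ballI) (simp only: card.empty of_nat_0)
    moreover have "\<not> shifts \<sigma> k" if "k \<in> K" for k using False that by blast
    then have "?rhs = 0" by (intro sum.neutral ballI) (simp only: if_False)
    ultimately show ?thesis by (simp only:)
  next
    case True
    then obtain k where k: "k \<in> K" "shifts \<sigma> k" by blast
    show ?thesis
    proof (cases "k = 0")
      case True
      have w\<sigma>: "w (\<sigma> i) = w i" if "i \<in> N" for i
        using shiftsD[OF k(2) \<sigma> that] shift_0[OF that] True by simp
      have "of_nat (card (roots l)) = (\<Sum>t\<in>color_involutions w (shift l).
          (if l = 0 then of_int (pair_sign N \<sigma> t) else zeta r powi k :: complex))" if l: "l \<in> K" for l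
      proof (cases "l = 0")
        case True
        have "roots 0 = {s. s permutes N \<and> s \<circ> s = \<sigma> \<and> (\<forall>i\<in>N. w (s i) = w i)}"
          unfolding roots_eq using shift_0 by auto
        then have "int (card (roots 0)) = (\<Sum>t\<in>color_involutions w (\<lambda>x. x). pair_sign N \<sigma> t)"
          using card_colored_square_roots[of w] w\<sigma> by simp
        then have "(of_int (int (card (roots 0))) :: complex)
            = of_int (\<Sum>t\<in>color_involutions w (\<lambda>x. x). pair_sign N \<sigma> t)" by (rule arg_cong)
        then show ?thesis using sign0 True by simp
      next
        case False
        then have "shift l (w i) \<noteq> w i" if "i \<in> N" for i
          using l that by (intro shift_neq) (auto simp: scalar_colors_def)
        then have "card (roots l) = card (color_involutions w (shift l))"
          unfolding roots_eq using w\<sigma> by (intro card_color_swapping_square_roots)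
        then show ?thesis using False \<open>k = 0\<close> by simp
      qed
      then show ?thesis unfolding collapse[OF k] by (rule sum.cong[OF refl])
    next
      case False
      have k2: "int r dvd 2 * k" using shifts_2[OF \<sigma> k(2,1)] .
      have kr: "k \<in> {0..<int r}" using k(1) by (simp add: scalar_colors_def)
      have w\<sigma>: "w (\<sigma> i) = shift k (w i)" if "i \<in> N" for i using shiftsD[OF k(2) \<sigma> that] .
      have "\<not> shifts \<sigma> 0" using shifts_unique[OF k(2) _ k(1) zero] False by blast
      then have "roots l = {}" if "l \<in> K" for l using square_root_shifts[of _ l] that by blast
      then have "?lhs = 0" by (intro sum.neutral ballI) (simp only: card.empty of_nat_0)
      have "\<not> int r dvd k" using kr False zdvd_imp_le[of "int r" k] by auto
      then have zk: "zeta r powi k = - 1" using zeta_powi_half[OF r k2] by blast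
      let ?g = "\<lambda>l. \<Sum>t\<in>color_involutions w (shift l).
          if l = 0 then of_int (pair_sign N \<sigma> t) else zeta r powi k"
      \<comment> \<open>Any involution of nonzero shift \<open>l\<close> forces
        \<open>2 * l = r\<close>, and \<open>2 * k = r\<close> holds too. The two surviving indices
        cancel because \<open>zeta r powi k\<close> is -1.\<close>
      have "?g l = 0" if l: "l \<in> K - {0, k}" for l
      proof -
        have "color_involutions w (shift l) = {}"
        proof (rule ccontr)
          assume "color_involutions w (shift l) \<noteq> {}"
          then obtain t where t: "t permutes N" "\<forall>i\<in>N. w (t i) = shift l (w i)"
            by (auto simp: color_involutions_def commutes_def)
          have "shifts t l" using t shift_iff permutes_in_image[OF t(1)] by auto
          then have "int r dvd 2 * l" using shifts_2[OF t(1)] l by blast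
          then have "2 * l = int r" using l by (intro colors_involutive) (auto simp: scalar_colors_def)
          moreover have "2 * k = int r" using k2 kr False by (rule colors_involutive)
          ultimately show False using l by auto
        qed
        then show ?thesis by (simp only: sum.empty)
      qed
      then have "sum ?g K = sum ?g {0, k}"
        using k(1) zero finite_scalar_colors by (intro sum.mono_neutral_right) auto
      also have "\<dots> = ?g 0 + ?g k" using False by simp
      also have "?g 0 = of_int (\<Sum>t\<in>color_involutions w (\<lambda>x. x). pair_sign N \<sigma> t)"
        unfolding sign0[symmetric] by simp
      also have "(\<Sum>t\<in>color_involutions w (\<lambda>x. x). pair_sign N \<sigma> t) = int (card (color_involutions w (shift k)))"
        using shift_shift[OF _ k2] shift_neq[OF _ kr False] w\<sigma> by (intro sum_pair_sign_shifted) auto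
      also have "?g k = - of_nat (card (color_involutions w (shift k)))" using False zk by simp
      finally show ?thesis unfolding collapse[OF k] using \<open>?lhs = 0\<close> by simp
    qed
  qed
qed

end

section \<open>Inverses up to conjugation\<close>

context finite_perm
begin

lemma cyc_reach: "\<exists>k. i = (\<sigma> ^^ k) (cyc i)"
proof -
  have "same_cycle i (cyc i)" unfolding cyc_def using same_cycle_refl by (rule LeastI)
  then have "same_cycle (cyc i) i" by (rule same_cycle_sym)
  then show ?thesis unfolding same_cycle_def by metis
qed

text \<open>Determined only modulo the length of the cycle; \<open>reversal_eq\<close> and
  \<open>potential_eq\<close> therefore admit any valid exponent.\<close>

definition pos :: "nat \<Rightarrow> nat" where "pos i = (SOME k. i = (\<sigma> ^^ k) (cyc i))"

lemma pos: "i = (\<sigma> ^^ pos i) (cyc i)"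
  unfolding pos_def using cyc_reach by (rule someI_ex)

lemma cyc_cyc: "cyc (cyc i) = cyc i"
  using pos[of i] cyc_pow[of "pos i" "cyc i"] by simp

lemma len_cyc: "len (cyc i) = len i"
  using pos[of i] len_pow[of "pos i" "cyc i"] by simp

text \<open>On each cycle, \<open>reversal\<close> is the reflection that fixes the chosen base point.\<close>
definition reversal :: "nat \<Rightarrow> nat" where
  "reversal i = (\<sigma> ^^ ((len i - 1) * pos i)) (cyc i)"

text \<open>The exponent \<open>(len i - 1) * pos i\<close> is a natural number congruent to
  \<open>- pos i\<close> modulo the length, and any other such exponent gives the same
  point.\<close>

lemma reversal_eq:
  assumes "i = (\<sigma> ^^ k) (cyc i)" "len i dvd k + l"
  shows "reversal i = (\<sigma> ^^ l) (cyc i)"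
proof -
  let ?n = "len i"
  have "pos i mod ?n = k mod ?n"
    using pos[of i] assms(1) pow_eq_iff[of "pos i" "cyc i" k] by (simp add: len_cyc)
  then have "((?n - 1) * pos i) mod ?n = ((?n - 1) * k) mod ?n" by (metis mod_mult_right_eq)
  moreover have "((?n - 1) * k) mod ?n = l mod ?n"
  proof -
    have "(?n - 1) * k + k = ?n * k"
      using len_pos[of i] by (cases ?n) simp_all
    then have "(?n - 1) * k + (k + l) = l + ?n * k" by (simp only: add.assoc[symmetric] add.commute[of l])
    then have "((?n - 1) * k + (k + l)) mod ?n = l mod ?n" by (simp only: mod_mult_self2)
    moreover obtain q where "k + l = ?n * q" using assms(2) by (elim dvdE)
    ultimately show ?thesis by simp
  qed
  ultimately show ?thesis unfolding reversal_def by (simp add: pow_eq_iff len_cyc)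
qed

lemma complement_exponent: "len i dvd k + (len i - 1) * k"
proof -
  have "k + (len i - 1) * k = len i * k" using len_pos[of i] by (cases "len i") simp_all
  then show ?thesis by simp
qed

lemma cyc_reversal: "cyc (reversal i) = cyc i" by (simp add: reversal_def cyc_pow cyc_cyc)

lemma len_reversal: "len (reversal i) = len i" by (simp add: reversal_def len_pow len_cyc)

lemma reversal_reversal: "reversal (reversal i) = i"
proof -
  let ?l = "(len i - 1) * pos i"
  have "reversal (reversal i) = (\<sigma> ^^ pos i) (cyc (reversal i))"
    using complement_exponent[of i "pos i"]
    by (intro reversal_eq[of _ ?l]) (simp_all add: cyc_reversal len_reversal add.commute, simp add: reversal_def)
  then show ?thesis using pos[of i] by (simp add: cyc_reversal)
qed

text \<open>Equivalently, \<open>reversal\<close> conjugates \<open>\<sigma>\<close> to its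
  inverse.\<close>

lemma \<sigma>_reversal_\<sigma>: "\<sigma> (reversal (\<sigma> i)) = reversal i"
proof -
  let ?b = "cyc i" and ?k = "Suc (pos i)"
  let ?l = "(len i - 1) * ?k"
  have c: "cyc (\<sigma> i) = ?b" "len (\<sigma> i) = len i" using cyc_pow[of 1 i] len_pow[of 1 i] by simp_all
  have "reversal (\<sigma> i) = (\<sigma> ^^ ?l) (cyc (\<sigma> i))"
    using pos[of i] complement_exponent[of i ?k] by (intro reversal_eq[of _ ?k]) (simp_all add: c)
  moreover have "reversal i = (\<sigma> ^^ Suc ?l) ?b"
    using complement_exponent[of i ?k] by (intro reversal_eq[OF pos[of i]]) simp
  ultimately show ?thesis by (simp add: c)
qed

lemma cyc_in_N: "cyc i \<in> N \<longleftrightarrow> i \<in> N"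
  using pos[of i] pow_in_N[of "pos i" "cyc i"] by simp

lemma reversal_permutes: "reversal permutes N"
proof (rule bij_imp_permutes)
  have "reversal i \<in> N \<longleftrightarrow> i \<in> N" for i by (simp add: reversal_def pow_in_N cyc_in_N)
  then show "bij_betw reversal N N"
    by (intro bij_betw_byWitness[where f' = reversal]) (auto simp: reversal_reversal)
  show "reversal i = i" if "i \<notin> N" for i
  proof -
    have out: "(\<sigma> ^^ k) j = j" if "j \<notin> N" for j k using permutes_not_in[OF permutes_funpow[OF \<sigma>] that] .
    have "cyc i \<notin> N" using that cyc_in_N by simp
    then show ?thesis using pos[of i] out by (metis reversal_def)
  qed
qed

section \<open>Colors of the conjugating element\<close>

context
  fixes a :: "nat \<Rightarrow> int"
begin

definition incr :: "nat \<Rightarrow> int" where "incr i = a (reversal (\<sigma> i)) - a i"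

text \<open>The solution of \<open>y (\<sigma> i) - y i = incr i\<close> that vanishes at the base
  point of each cycle.\<close>

definition potential :: "nat \<Rightarrow> int" where
  "potential i = (\<Sum>j<pos i. incr ((\<sigma> ^^ j) (cyc i)))"

text \<open>Both parts of \<open>incr\<close> run through the values of \<open>a\<close> on the same
  cycle, in different orders. This is the condition for the potential to close up around the
  cycle.\<close>

lemma sum_incr_cycle: "(\<Sum>j<len i. incr ((\<sigma> ^^ j) (cyc i))) = 0"
proof -
  let ?b = "cyc i"
  have "reversal (\<sigma> ((\<sigma> ^^ j) ?b)) = (\<sigma> ^^ (len i - Suc j)) ?b" if "j < len i" for j
  proof -
    have c: "cyc (\<sigma> ((\<sigma> ^^ j) ?b)) = ?b" "len (\<sigma> ((\<sigma> ^^ j) ?b)) = len i"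
      using cyc_pow[of "Suc j" ?b] len_pow[of "Suc j" ?b] by (simp_all add: cyc_cyc len_cyc)
    show ?thesis
      using that by (subst reversal_eq[of _ "Suc j" "len i - Suc j"]) (simp_all only: c, simp_all)
  qed
  then have "(\<Sum>j<len i. incr ((\<sigma> ^^ j) ?b))
      = (\<Sum>j<len i. a ((\<sigma> ^^ (len i - Suc j)) ?b)) - (\<Sum>j<len i. a ((\<sigma> ^^ j) ?b))"
    by (simp add: incr_def sum_subtractf)
  also have "(\<Sum>j<len i. a ((\<sigma> ^^ (len i - Suc j)) ?b)) = (\<Sum>j<len i. a ((\<sigma> ^^ j) ?b))"
    by (rule sum.nat_diff_reindex)
  finally show ?thesis by simp
qed

lemma potential_eq:
  assumes "i = (\<sigma> ^^ k) (cyc i)"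
  shows "potential i = (\<Sum>j<k. incr ((\<sigma> ^^ j) (cyc i)))"
proof -
  define S where "S m = (\<Sum>j<m. incr ((\<sigma> ^^ j) (cyc i)))" for m
  have period: "S (len i + m) = S m" for m
  proof (induction m)
    case 0
    then show ?case using sum_incr_cycle by (simp add: S_def)
  next
    case (Suc m)
    have "(\<sigma> ^^ (len i + m)) (cyc i) = (\<sigma> ^^ m) (cyc i)"
      by (simp add: pow_eq_iff len_cyc)
    then show ?case using Suc by (simp add: S_def)
  qed
  have mod: "S m = S (m mod len i)" for m
  proof (induction m rule: less_induct)
    case (less m)
    show ?case
    proof (cases "m < len i")
      case False
      then have "S m = S (m - len i)" using period[of "m - len i"] by simp
      also have "\<dots> = S ((m - len i) mod len i)" using False len_pos[of i] by (intro less.IH) simp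
      finally show ?thesis using False by (simp add: le_mod_geq)
    qed simp
  qed
  have "pos i mod len i = k mod len i"
    using pos[of i] assms pow_eq_iff[of "pos i" "cyc i" k] by (simp add: len_cyc)
  then have "S (pos i) = S k" using mod by metis
  then show ?thesis by (simp add: S_def potential_def)
qed

lemma potential_\<sigma>: "potential (\<sigma> i) = potential i - a i + a (reversal (\<sigma> i))"
proof -
  have c: "cyc (\<sigma> i) = cyc i" using cyc_pow[of 1 i] by simp
  have "\<sigma> i = (\<sigma> ^^ Suc (pos i)) (cyc i)" using pos[of i] by simp
  then have "potential (\<sigma> i) = (\<Sum>j<Suc (pos i). incr ((\<sigma> ^^ j) (cyc i)))"
    using potential_eq[of "\<sigma> i" "Suc (pos i)"] c by simp
  also have "\<dots> = potential i + incr i" using pos[of i] by (simp add: potential_def)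
  finally show ?thesis by (simp add: incr_def)
qed

text \<open>On even cycles the parity of the position is well defined; \<open>\<sigma>\<close>
  exchanges the two classes and \<open>reversal\<close> preserves them. Writing the points of odd
  position as \<open>\<sigma> i\<close> with \<open>i\<close> of even position makes the difference
  explicitly twice an integer.\<close>

lemma even_sum_potential:
  assumes even: "\<And>i. i \<in> N \<Longrightarrow> even (len i)"
  shows "even ((\<Sum>i\<in>N. potential i) - (\<Sum>i\<in>N. a i))"
proof -
  define E where "E = {i \<in> N. even (pos i)}"
  have parity: "even (pos i) \<longleftrightarrow> even k" if "i \<in> N" "i = (\<sigma> ^^ k) (cyc i)" for i k
  proof -
    have "pos i mod len i = k mod len i"
      using pos[of i] that(2) pow_eq_iff[of "pos i" "cyc i" k] by (simp add: len_cyc)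
    then show ?thesis using even[OF that(1)] by (metis dvd_mod_iff)
  qed
  have \<sigma>N: "\<sigma> i \<in> N \<longleftrightarrow> i \<in> N" for i using permutes_in_image[OF \<sigma>] .
  have rN: "reversal i \<in> N \<longleftrightarrow> i \<in> N" for i using permutes_in_image[OF reversal_permutes] .
  have pos_\<sigma>: "even (pos (\<sigma> i)) \<longleftrightarrow> odd (pos i)" if "i \<in> N" for i
  proof -
    have "\<sigma> i = (\<sigma> ^^ Suc (pos i)) (cyc (\<sigma> i))" using pos[of i] cyc_pow[of 1 i] by simp
    then show ?thesis using parity[of "\<sigma> i" "Suc (pos i)"] that \<sigma>N by simp
  qed
  have pos_rev: "even (pos (reversal i)) \<longleftrightarrow> even (pos i)" if i: "i \<in> N" for i
  proof -
    have "reversal i = (\<sigma> ^^ ((len i - 1) * pos i)) (cyc (reversal i))"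
      by (simp add: cyc_reversal) (simp add: reversal_def)
    moreover have "even ((len i - 1) * pos i) \<longleftrightarrow> even (pos i)" using even[OF i] len_pos[of i] by simp
    ultimately show ?thesis using parity[of "reversal i"] i rN by metis
  qed
  have \<sigma>E: "bij_betw \<sigma> E (N - E)"
  proof -
    have "\<sigma> ` E = N - E"
    proof
      show "\<sigma> ` E \<subseteq> N - E" using \<sigma>N pos_\<sigma> by (auto simp: E_def)
      show "N - E \<subseteq> \<sigma> ` E"
      proof
        fix i assume i: "i \<in> N - E"
        then obtain j where "j \<in> N" "i = \<sigma> j" using permutes_image[OF \<sigma>] by blast
        then show "i \<in> \<sigma> ` E" using i pos_\<sigma>[of j] by (auto simp: E_def)
      qed
    qed
    then show ?thesis using permutes_inj[OF \<sigma>] by (auto simp: bij_betw_def inj_on_def inj_def)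
  qed
  have revE: "bij_betw reversal (N - E) (N - E)"
    by (rule bij_betw_byWitness[where f' = reversal]) (auto simp: reversal_reversal E_def rN pos_rev)
  have split: "(\<Sum>i\<in>N. f i) = (\<Sum>i\<in>N - E. f i) + (\<Sum>i\<in>E. f i)" for f :: "nat \<Rightarrow> int"
    using sum.subset_diff[of E N f] finite_N by (auto simp: E_def)
  have "(\<Sum>i\<in>N. potential i) = (\<Sum>i\<in>E. potential (\<sigma> i)) + (\<Sum>i\<in>E. potential i)"
    unfolding split sum.reindex_bij_betw[OF \<sigma>E] ..
  also have "(\<Sum>i\<in>E. potential (\<sigma> i)) = (\<Sum>i\<in>E. potential i) - (\<Sum>i\<in>E. a i) + (\<Sum>i\<in>E. a (reversal (\<sigma> i)))"
    by (simp add: potential_\<sigma> sum.distrib sum_subtractf)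
  also have "(\<Sum>i\<in>E. a (reversal (\<sigma> i))) = (\<Sum>i\<in>N - E. a i)"
    using sum.reindex_bij_betw[OF \<sigma>E, of "\<lambda>i. a (reversal i)"] sum.reindex_bij_betw[OF revE, of a] by simp
  finally have "(\<Sum>i\<in>N. potential i) - (\<Sum>i\<in>N. a i) = 2 * ((\<Sum>i\<in>E. potential i) - (\<Sum>i\<in>E. a i))"
    unfolding split[of a] by simp
  then show ?thesis by simp
qed

end

lemma card_cycle:
  assumes "b \<in> N"
  shows "card {i \<in> N. cyc i = cyc b} = len b"
proof -
  have "{i \<in> N. cyc i = cyc b} = (\<lambda>k. (\<sigma> ^^ k) b) ` {..<len b}"
  proof
    show "{i \<in> N. cyc i = cyc b} \<subseteq> (\<lambda>k. (\<sigma> ^^ k) b) ` {..<len b}"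
    proof
      fix i assume "i \<in> {i \<in> N. cyc i = cyc b}"
      then have "cyc b = cyc i" by simp
      then obtain k where "i = (\<sigma> ^^ k) b" by (rule cyc_eqE)
      then have "i = (\<sigma> ^^ (k mod len b)) b" by (simp add: pow_eq_iff)
      then show "i \<in> (\<lambda>k. (\<sigma> ^^ k) b) ` {..<len b}" using len_pos[of b] by (intro rev_image_eqI[of "k mod len b"]) auto
    qed
  qed (use assms in \<open>auto simp: cyc_pow pow_in_N\<close>)
  moreover have "inj_on (\<lambda>k. (\<sigma> ^^ k) b) {..<len b}" by (auto simp: inj_on_def pow_eq_iff)
  ultimately show ?thesis by (simp add: card_image)
qed

text \<open>A solution may be changed by a function that is constant on cycles. A global constant
  changes its sum by multiples of \<open>card N\<close>, so modulo \<open>p\<close> every even sum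
  can be removed, and the task is to reach an even sum.\<close>

lemma reversing_cocycle:
  fixes a :: "nat \<Rightarrow> int" and p :: nat
  assumes gcd: "gcd p (card N) dvd 2" and a: "int p dvd (\<Sum>i\<in>N. a i)"
  shows "\<exists>y. (\<forall>i. y (\<sigma> i) = y i - a i + a (reversal (\<sigma> i))) \<and> int p dvd (\<Sum>i\<in>N. y i)"
proof -
  have c\<sigma>: "cyc (\<sigma> i) = cyc i" for i using cyc_pow[of 1 i] by simp
  let ?D = "\<Sum>i\<in>N. potential a i"
  \<comment> \<open>Parity repair: an odd \<open>p\<close> changes it through \<open>x\<close>, and
    a cycle of odd length through its indicator function \<open>t\<close>.\<close>
  have "\<exists>t x. (\<forall>i. t (\<sigma> i) = t i) \<and> even (?D + (\<Sum>i\<in>N. t i) + int p * x)"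
  proof -
    consider "even ?D" | "odd ?D" "odd p" | b where "odd ?D" "b \<in> N" "odd (len b)"
      | "odd ?D" "even p" "\<forall>b\<in>N. even (len b)" by blast
    then show ?thesis
    proof cases
      case 1
      then show ?thesis by (intro exI[of _ "\<lambda>_. 0"] exI[of _ 0]) simp
    next
      case 2
      then show ?thesis by (intro exI[of _ "\<lambda>_. 0"] exI[of _ 1]) simp
    next
      case 3
      let ?t = "\<lambda>i. if cyc i = cyc b then 1 else 0 :: int"
      have "(\<Sum>i\<in>N. ?t i) = int (len b)"
        using card_cycle[OF 3(2)] finite_N by (simp add: sum.If_cases Int_def)
      then show ?thesis using 3 by (intro exI[of _ ?t] exI[of _ 0]) (simp add: c\<sigma>)
    next
      case 4
      \<comment> \<open>This case is contradictory: the even number \<open>p\<close> divides the sum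
        of \<open>a\<close>, so \<open>?D\<close> is even as well.\<close>
      have "even (?D - (\<Sum>i\<in>N. a i))" using 4(3) by (intro even_sum_potential) auto
      moreover have "even (\<Sum>i\<in>N. a i)" using 4(2) a dvd_trans[of 2 "int p"] by simp
      ultimately show ?thesis using 4(1) by simp
    qed
  qed
  then obtain t x where t: "\<And>i. t (\<sigma> i) = t i" and even: "even (?D + (\<Sum>i\<in>N. t i) + int p * x)"
    by blast
  from even obtain e where e: "?D + (\<Sum>i\<in>N. t i) + int p * x = 2 * e" by (elim evenE)
  obtain u v where "u * int p + v * int (card N) = gcd (int p) (int (card N))" using bezout_int by blast
  moreover obtain m where "2 = gcd p (card N) * m" using gcd by (elim dvdE)
  then have "2 = int (gcd p (card N)) * int m" by (metis of_nat_mult of_nat_numeral)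
  ultimately have m: "(u * int p + v * int (card N)) * int m = 2" by simp
  \<comment> \<open>By Bezout, \<open>v * m * card N\<close> is congruent to 2 modulo
    \<open>p\<close>; subtracting the constant \<open>e * m * v\<close> at every point thus removes
    \<open>2 * e\<close> from the sum modulo \<open>p\<close>.\<close>
  let ?y = "\<lambda>i. potential a i + t i - e * int m * v"
  have "(\<Sum>i\<in>N. ?y i) = ?D + (\<Sum>i\<in>N. t i) - e * int m * v * int (card N)"
    by (simp add: sum.distrib sum_subtractf)
  also have "\<dots> = 2 * e - int p * x - e * int m * v * int (card N)" using e by simp
  also have "\<dots> = e * ((u * int p + v * int (card N)) * int m) - int p * x - e * int m * v * int (card N)"
    unfolding m by simp
  also have "\<dots> = int p * (e * u * int m - x)" by (simp add: algebra_simps)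
  finally have "int p dvd (\<Sum>i\<in>N. ?y i)" by simp
  then show ?thesis by (intro exI[of _ ?y]) (simp add: potential_\<sigma> t)
qed

end

text \<open>Equivalently, \<open>conj_elt r n g\<close> is conjugate to \<open>g\<^sup>-\<^sup>1\<close> in \<open>G(r,p,n)\<close>.\<close>
lemma conj_elt_conjugate_inverse:
  assumes r: "0 < r" "p dvd r" and gcd: "gcd p n dvd 2" and g: "g \<in> carrier (G_rpn r p n)"
  shows "\<exists>h\<in>carrier (G_rpn r p n). conj_elt r n g \<otimes>\<^bsub>G_rn r n\<^esub> (h \<otimes>\<^bsub>G_rn r n\<^esub> g) = h"
proof -
  have \<sigma>: "perm g permutes {1..n}" and sum_g: "int p dvd (\<Sum>i\<in>{1..n}. color g i)"
    using g by (auto simp: G_rpn_def G_rn_def)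
  interpret finite_perm "{1..n}" "perm g" using \<sigma> by unfold_locales auto
  obtain y where y: "\<And>i. y (perm g i) = y i - color g i + color g (reversal (perm g i))"
    and p: "int p dvd (\<Sum>i\<in>{1..n}. y i)"
    using reversing_cocycle[of p "color g"] gcd sum_g by auto
  have inN: "perm g i \<in> {1..n} \<longleftrightarrow> i \<in> {1..n}" "reversal i \<in> {1..n} \<longleftrightarrow> i \<in> {1..n}" for i
    using permutes_in_image[OF \<sigma>] permutes_in_image[OF reversal_permutes] by blast+
  define h where "h = (reversal, \<lambda>i\<in>{1..n}. y i mod int r)"
  have "int p dvd (\<Sum>i=1..n. y i mod int r)"
  proof -
    have "int p dvd y i - y i mod int r" for i
      using r(2) by (metis dvd_minus_mod dvd_trans of_nat_dvd_iff)
    then have "int p dvd (\<Sum>i=1..n. y i - y i mod int r)" by (intro dvd_sum) auto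
    then have "int p dvd (\<Sum>i=1..n. y i) - (\<Sum>i=1..n. y i mod int r)" by (simp add: sum_subtractf)
    then show ?thesis using p by (metis dvd_diff_right_iff dvd_diff_left_iff)
  qed
  then have "h \<in> carrier (G_rpn r p n)"
    using reversal_permutes r(1) by (auto simp: h_def G_rpn_def G_rn_def)
  moreover have "conj_elt r n g \<otimes>\<^bsub>G_rn r n\<^esub> (h \<otimes>\<^bsub>G_rn r n\<^esub> g) = h"
  proof -
    have "perm g \<circ> (reversal \<circ> perm g) = reversal" by (auto simp: \<sigma>_reversal_\<sigma>)
    \<comment> \<open>The color equation of the claim is the cocycle equation for
      \<open>y\<close>.\<close>
    moreover have "((color g i + (y (perm g i) mod int r)) mod int r + (- color g (reversal (perm g i))) mod int r) mod int r
        = y i mod int r" for i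
      by (simp add: mod_simps y)
    ultimately show ?thesis using inN
      by (auto simp: G_rn_def conj_elt_def h_def fun_eq_iff restrict_def simp del: atLeastAtMost_iff)
  qed
  ultimately show ?thesis by blast
qed

section \<open>Lifts of the absolute involutions\<close>

\<comment> \<open>Otherwise \<open>{1..n}\<close> would be rewritten to \<open>{Suc 0..n}\<close>.\<close>
declare One_nat_def [simp del]

lemma G_rn_carrier_iff:
  "g \<in> carrier (G_rn r n) \<longleftrightarrow> perm g permutes {1..n} \<and> color g \<in> {1..n} \<rightarrow>\<^sub>E {0..<int r}"
  by (cases g) (auto simp: G_rn_def)

lemma G_rn_mult:
  "g \<otimes>\<^bsub>G_rn r n\<^esub> h = (perm g \<circ> perm h, \<lambda>i\<in>{1..n}. (color h i + color g (perm h i)) mod int r)"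
  by (simp add: G_rn_def)

lemma G_rn_one: "\<one>\<^bsub>G_rn r n\<^esub> = (id, \<lambda>i\<in>{1..n}. 0)"
  by (simp add: G_rn_def)

lemma colperm_eqI:
  assumes "perm g = perm h" "color g \<in> extensional A" "color h \<in> extensional A"
    "\<And>i. i \<in> A \<Longrightarrow> color g i = color h i"
  shows "g = h"
  using assms by (intro prod_eqI) (auto intro: extensionalityI)

lemma colperm_eq_iff:
  assumes "color g \<in> extensional A" "color h \<in> extensional A"
  shows "g = h \<longleftrightarrow> perm g = perm h \<and> (\<forall>i\<in>A. color g i = color h i)"
  using colperm_eqI[OF _ assms] by auto

lemma G_rn_inv:
  assumes "0 < r" "g \<in> carrier (G_rn r n)"
  shows "inv\<^bsub>G_rn r n\<^esub> g = (inv_into UNIV (perm g), \<lambda>i\<in>{1..n}. (- color g (inv_into UNIV (perm g) i)) mod int r)"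
proof -
  interpret group "G_rn r n" using assms(1) by (rule group_G_rn)
  let ?y = "(inv_into UNIV (perm g), \<lambda>i\<in>{1..n}. (- color g (inv_into UNIV (perm g) i)) mod int r)"
  have p: "perm g permutes {1..n}" using assms(2) by (simp add: G_rn_carrier_iff)
  have "?y \<in> carrier (G_rn r n)" using assms(1) permutes_inv[OF p] by (auto simp: G_rn_carrier_iff)
  moreover have "?y \<otimes>\<^bsub>G_rn r n\<^esub> g = \<one>\<^bsub>G_rn r n\<^esub>"
    using permutes_inv_o(2)[OF p] permutes_inverses[OF p] permutes_in_image[OF p]
    by (auto simp: G_rn_mult G_rn_one mod_simps intro!: colperm_eqI[of _ _ "{1..n}"] simp del: atLeastAtMost_iff)
  ultimately show ?thesis using assms(2) by (intro inv_equality)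
qed

section \<open>The quotient by the scalar subgroup and its absolute involutions\<close>

locale crg =
  fixes r p n :: nat
  assumes r: "0 < r" and p: "0 < p" and n: "0 < n" and p_dvd_r: "p dvd r"
begin

abbreviation "N \<equiv> {1..n}"
abbreviation "Grn \<equiv> G_rn r n"
abbreviation "Grpn \<equiv> G_rpn r p n"
abbreviation "Kpr \<equiv> scalar_colors r p"
abbreviation "Cp \<equiv> C_p r p n"
abbreviation "Inv \<equiv> abs_involutions r p n"

sublocale G: group Grn using r by (rule group_G_rn)

lemma mod_dvd_p: "int p dvd x mod int r - x"
  using p_dvd_r by (metis dvd_minus_iff dvd_minus_mod dvd_trans minus_diff_eq of_nat_dvd_iff)

lemma p_dvd_mod_sum: "int p dvd (\<Sum>i\<in>A. f i mod int r) \<longleftrightarrow> int p dvd (\<Sum>i\<in>A. f i)"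
proof -
  have "int p dvd (\<Sum>i\<in>A. f i mod int r - f i)" using mod_dvd_p by (rule dvd_sum)
  then have "(\<Sum>i\<in>A. f i mod int r) mod int p = (\<Sum>i\<in>A. f i) mod int p"
    by (simp only: sum_subtractf mod_eq_dvd_iff)
  then show ?thesis by (simp only: dvd_eq_mod_eq_0)
qed

lemma Grpn_carrier_iff:
  "g \<in> carrier Grpn \<longleftrightarrow> g \<in> carrier Grn \<and> int p dvd (\<Sum>i\<in>N. color g i)"
  by (auto simp: G_rpn_def)

lemma Grpn_subset: "g \<in> carrier Grpn \<Longrightarrow> g \<in> carrier Grn" by (simp add: Grpn_carrier_iff)

lemma Grpn_ops [simp]: "x \<otimes>\<^bsub>Grpn\<^esub> y = x \<otimes>\<^bsub>Grn\<^esub> y" "\<one>\<^bsub>Grpn\<^esub> = \<one>\<^bsub>Grn\<^esub>"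
  by (simp_all add: G_rpn_def)

lemma subgroup_Grpn: "subgroup (carrier Grpn) Grn"
proof (rule G.subgroupI)
  show "carrier Grpn \<subseteq> carrier Grn" using Grpn_subset by blast
  have "int p dvd (\<Sum>i\<in>N. color \<one>\<^bsub>Grn\<^esub> i)" by (simp add: G_rn_one)
  then have "\<one>\<^bsub>Grn\<^esub> \<in> carrier Grpn" by (simp only: Grpn_carrier_iff G.one_closed simp_thms)
  then show "carrier Grpn \<noteq> {}" by blast
next
  fix g assume g: "g \<in> carrier Grpn"
  have perm: "perm g permutes N" using g by (simp add: Grpn_carrier_iff G_rn_carrier_iff)
  have "(\<Sum>i\<in>N. color (inv\<^bsub>Grn\<^esub> g) i) = (\<Sum>i\<in>N. (- color g (inv_into UNIV (perm g) i)) mod int r)"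
    using G_rn_inv[OF r Grpn_subset[OF g]] by simp
  moreover have "(\<Sum>i\<in>N. - color g (inv_into UNIV (perm g) i)) = - (\<Sum>i\<in>N. color g i)"
    using sum.permute[OF permutes_inv[OF perm], of "color g"] by (simp add: sum_negf o_def)
  ultimately show "inv\<^bsub>Grn\<^esub> g \<in> carrier Grpn"
    using g G.inv_closed by (simp add: Grpn_carrier_iff p_dvd_mod_sum)
next
  fix g h assume gh: "g \<in> carrier Grpn" "h \<in> carrier Grpn"
  have perm: "perm h permutes N" using gh by (simp add: Grpn_carrier_iff G_rn_carrier_iff)
  have "(\<Sum>i\<in>N. color (g \<otimes>\<^bsub>Grn\<^esub> h) i) = (\<Sum>i\<in>N. (color h i + color g (perm h i)) mod int r)"
    by (simp add: G_rn_mult)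
  moreover have "(\<Sum>i\<in>N. color h i + color g (perm h i)) = (\<Sum>i\<in>N. color h i) + (\<Sum>i\<in>N. color g i)"
    using sum.permute[OF perm, of "color g"] by (simp add: sum.distrib o_def)
  ultimately show "g \<otimes>\<^bsub>Grn\<^esub> h \<in> carrier Grpn"
    using gh G.m_closed by (simp add: Grpn_carrier_iff p_dvd_mod_sum)
qed

lemma group_Grpn: "group Grpn"
  using G.subgroup_imp_group[OF subgroup_Grpn] by (simp add: G_rpn_def)

lemma finite_Grpn: "finite (carrier Grpn)"
  using finite_subset[OF _ finite_G_rn] Grpn_subset by blast

definition translate :: "int \<Rightarrow> colperm \<Rightarrow> colperm" where
  "translate k a = (perm a, \<lambda>i\<in>N. (color a i + k) mod int r)"

lemma translate_carrier: "a \<in> carrier Grn \<Longrightarrow> translate k a \<in> carrier Grn"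
  using r by (auto simp: translate_def G_rn_carrier_iff)

lemma C_p_eq: "Cp = (\<lambda>k. (id, \<lambda>i\<in>N. k) :: colperm) ` Kpr"
proof
  show "Cp \<subseteq> (\<lambda>k. (id, \<lambda>i\<in>N. k) :: colperm) ` Kpr"
    using C_p_elt[OF r p_dvd_r] by (fastforce simp: scalar_colors_def)
  have "(id, \<lambda>i\<in>N. (int (r div p) * int j) mod int r) \<in> Cp" for j
  proof (induction j)
    case 0
    have "(id, \<lambda>i\<in>N. (int (r div p) * int 0) mod int r) = \<one>\<^bsub>Grn\<^esub>" by (simp add: G_rn_one)
    then show ?case unfolding C_p_def by (simp only: generate.one)
  next
    case (Suc j)
    have "(id, \<lambda>i\<in>N. int (r div p) mod int r) \<in> Cp" unfolding C_p_def by (intro generate.incl) simp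
    then have "(id, \<lambda>i\<in>N. int (r div p) mod int r) \<otimes>\<^bsub>Grn\<^esub> (id, \<lambda>i\<in>N. (int (r div p) * int j) mod int r) \<in> Cp"
      using Suc unfolding C_p_def by (intro generate.eng)
    moreover have "(id, \<lambda>i\<in>N. int (r div p) mod int r) \<otimes>\<^bsub>Grn\<^esub> (id, \<lambda>i\<in>N. (int (r div p) * int j) mod int r)
        = (id, \<lambda>i\<in>N. (int (r div p) * int (Suc j)) mod int r)"
      by (auto simp: G_rn_mult fun_eq_iff restrict_def mod_simps algebra_simps)
    ultimately show ?case by (simp only:)
  qed
  note gen = this
  show "(\<lambda>k. (id, \<lambda>i\<in>N. k) :: colperm) ` Kpr \<subseteq> Cp"
  proof
    fix c :: colperm assume "c \<in> (\<lambda>k. (id, \<lambda>i\<in>N. k)) ` Kpr"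
    then obtain k where k: "k \<in> Kpr" "c = (id, \<lambda>i\<in>N. k)" by blast
    then obtain j where j: "j \<in> {0..<int p}" "k = int (r div p) * j"
      unfolding scalar_colors_eq[OF p p_dvd_r r] by blast
    have "int (r div p) * int (nat j) = k" using j by simp
    moreover have "k mod int r = k" using k(1) by (simp add: scalar_colors_def)
    ultimately show "c \<in> Cp" using gen[of "nat j"] k(2) by simp
  qed
qed

lemma subgroup_Cp: "subgroup Cp Grn"
  unfolding C_p_def using r by (intro G.generate_is_subgroup) (auto simp: G_rn_carrier_iff permutes_id)

lemma coset_eq:
  assumes "a \<in> carrier Grn"
  shows "Cp #>\<^bsub>Grn\<^esub> a = (\<lambda>k. translate k a) ` Kpr"
proof -
  have perm: "perm a permutes N" using assms by (simp add: G_rn_carrier_iff)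
  have "(id, \<lambda>i\<in>N. k) \<otimes>\<^bsub>Grn\<^esub> a = translate k a" for k
    using permutes_in_image[OF perm]
    by (auto simp: G_rn_mult translate_def fun_eq_iff restrict_def simp del: atLeastAtMost_iff)
  then show ?thesis by (auto simp: r_coset_def C_p_eq)
qed

lemma coset_self: "a \<in> carrier Grn \<Longrightarrow> a \<in> Cp #>\<^bsub>Grn\<^esub> a"
  using G.rcos_self subgroup_Cp by blast

lemma coset_cong: "a \<in> carrier Grn \<Longrightarrow> b \<in> Cp #>\<^bsub>Grn\<^esub> a \<Longrightarrow> Cp #>\<^bsub>Grn\<^esub> b = Cp #>\<^bsub>Grn\<^esub> a"
  using G.repr_independence[OF _ _ subgroup_Cp] by blast

lemma card_coset:
  assumes "a \<in> carrier Grn"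
  shows "card (Cp #>\<^bsub>Grn\<^esub> a) = p"
proof -
  have "inj_on (\<lambda>k. translate k a) Kpr"
  proof (rule inj_onI)
    fix k l assume kl: "k \<in> Kpr" "l \<in> Kpr" "translate k a = translate l a"
    then have "(color a 1 + k) mod int r = (color a 1 + l) mod int r"
      using n by (auto simp: translate_def restrict_def fun_eq_iff dest: spec[of _ 1])
    then have "(color a 1 + k - color a 1) mod int r = (color a 1 + l - color a 1) mod int r"
      by (metis mod_diff_left_eq)
    then have "k mod int r = l mod int r" by simp
    then show "k = l" using kl(1,2) by (simp add: scalar_colors_def)
  qed
  then show ?thesis using card_scalar_colors[OF p p_dvd_r r] by (simp add: coset_eq[OF assms] card_image)
qed

text \<open>The union of the classes in \<open>Inv\<close>: the product of \<open>a\<close> with its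
  conjugate is the scalar of color \<open>l\<close>. By \<open>symmetric_iff\<close>,
  \<open>l = 0\<close> is the symmetric case and every other \<open>l\<close> the antisymmetric
  one.\<close>

definition lifts :: "colperm set" where
  "lifts = {a \<in> carrier Grn. perm a \<circ> perm a = id \<and>
     (\<exists>l\<in>Kpr. \<forall>i\<in>N. int r dvd color a (perm a i) - color a i - l)}"

lemma scalar_colors_diff: "k \<in> Kpr \<Longrightarrow> l \<in> Kpr \<Longrightarrow> (k - l) mod int r \<in> Kpr"
  using r by (intro scalar_colors_mod) (auto simp: scalar_colors_def right_diff_distrib)

text \<open>The product of the class of \<open>a\<close> with its conjugate is the coset of
  \<open>?b\<close>; so the condition is that \<open>?b\<close> itself is a scalar in
  \<open>Cp\<close>.\<close>

lemma Inv_iff: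
  assumes a: "a \<in> carrier Grn"
  shows "Cp #>\<^bsub>Grn\<^esub> a \<in> Inv \<longleftrightarrow> a \<in> lifts"
proof -
  let ?v = "Cp #>\<^bsub>Grn\<^esub> a" and ?b = "a \<otimes>\<^bsub>Grn\<^esub> conj_elt r n a"
  have perm: "perm a permutes N" using a by (simp add: G_rn_carrier_iff)
  have inN: "perm a i \<in> N \<longleftrightarrow> i \<in> N" for i by (rule permutes_in_image[OF perm])
  have conj: "conj_elt r n a \<in> carrier Grn" using perm r by (auto simp: conj_elt_def G_rn_carrier_iff)
  have b: "?b \<in> carrier Grn" using a conj by (rule G.m_closed)
  have prod: "translate k a \<otimes>\<^bsub>Grn\<^esub> conj_elt r n (translate l a) = translate ((k - l) mod int r) ?b" for k l
  proof (rule colperm_eqI[of _ _ N])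
    fix i assume i: "i \<in> N"
    have "color (translate k a \<otimes>\<^bsub>Grn\<^esub> conj_elt r n (translate l a)) i
        = ((- ((color a i + l) mod int r)) mod int r + (color a (perm a i) + k) mod int r) mod int r"
      using i inN by (simp add: translate_def conj_elt_def G_rn_mult del: atLeastAtMost_iff)
    also have "\<dots> = (- color a i - l + (color a (perm a i) + k)) mod int r" by (simp add: mod_simps)
    also have "\<dots> = ((- color a i + color a (perm a i)) mod int r + (k - l) mod int r) mod int r"
      by (simp only: mod_add_eq) (simp add: algebra_simps)
    also have "(- color a i + color a (perm a i)) mod int r = color ?b i"
      using i by (simp add: conj_elt_def G_rn_mult mod_add_left_eq del: atLeastAtMost_iff)
    also have "(color ?b i + (k - l) mod int r) mod int r = color (translate ((k - l) mod int r) ?b) i"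
      using i by (simp add: translate_def del: atLeastAtMost_iff)
    finally show "color (translate k a \<otimes>\<^bsub>Grn\<^esub> conj_elt r n (translate l a)) i
        = color (translate ((k - l) mod int r) ?b) i" .
  qed (simp_all add: translate_def conj_elt_def G_rn_mult)
  have "?v <#>\<^bsub>Grn\<^esub> (conj_elt r n ` ?v) = Cp #>\<^bsub>Grn\<^esub> ?b"
  proof
    show "?v <#>\<^bsub>Grn\<^esub> (conj_elt r n ` ?v) \<subseteq> Cp #>\<^bsub>Grn\<^esub> ?b"
      using scalar_colors_diff by (auto simp: set_mult_def coset_eq[OF a] coset_eq[OF b] prod)
    show "Cp #>\<^bsub>Grn\<^esub> ?b \<subseteq> ?v <#>\<^bsub>Grn\<^esub> (conj_elt r n ` ?v)"
    proof
      fix c assume "c \<in> Cp #>\<^bsub>Grn\<^esub> ?b"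
      then obtain k where k: "k \<in> Kpr" "c = translate k ?b" by (auto simp: coset_eq[OF b])
      then have "c = translate k a \<otimes>\<^bsub>Grn\<^esub> conj_elt r n (translate 0 a)"
        using prod[of k 0] by (simp add: scalar_colors_def)
      then show "c \<in> ?v <#>\<^bsub>Grn\<^esub> (conj_elt r n ` ?v)"
        using k(1) zero_scalar_color[OF r, of p] by (auto simp: set_mult_def coset_eq[OF a])
    qed
  qed
  moreover have "?v \<in> carrier (Grn Mod Cp)" using a by (auto simp: FactGroup_def RCOSETS_def)
  ultimately have "?v \<in> Inv \<longleftrightarrow> Cp #>\<^bsub>Grn\<^esub> ?b = Cp"
    by (simp add: abs_involutions_def FactGroup_def)
  also have "\<dots> \<longleftrightarrow> ?b \<in> Cp"
    using coset_self[OF b] G.coset_join2[OF b subgroup_Cp] by auto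
  also have "\<dots> \<longleftrightarrow> a \<in> lifts"
  proof -
    have "?b = (id, \<lambda>i\<in>N. l) \<longleftrightarrow> perm a \<circ> perm a = id \<and> (\<forall>i\<in>N. int r dvd color a (perm a i) - color a i - l)"
      if l: "l \<in> Kpr" for l
    proof -
      have col: "color ?b i = l \<longleftrightarrow> int r dvd color a (perm a i) - color a i - l" if "i \<in> N" for i
      proof -
        have "color ?b i = (color a (perm a i) - color a i) mod int r"
          using that by (simp add: conj_elt_def G_rn_mult mod_simps del: atLeastAtMost_iff)
        moreover have "l = l mod int r" using l by (simp add: scalar_colors_def)
        ultimately show ?thesis by (metis mod_eq_dvd_iff)
      qed
      have "perm ?b = perm a \<circ> perm a" "color ?b \<in> extensional N" by (simp_all add: conj_elt_def G_rn_mult)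
      then show ?thesis using col by (auto intro!: colperm_eqI[of _ _ N] simp del: atLeastAtMost_iff)
    qed
    then show ?thesis using a by (auto simp: C_p_eq lifts_def)
  qed
  finally show ?thesis .
qed

lemma lifts_carrier: "a \<in> lifts \<Longrightarrow> a \<in> carrier Grn" by (simp add: lifts_def)

lemma Inv_eq: "Inv = (\<lambda>a. Cp #>\<^bsub>Grn\<^esub> a) ` lifts"
proof -
  have "Inv \<subseteq> (\<lambda>a. Cp #>\<^bsub>Grn\<^esub> a) ` carrier Grn"
    by (auto simp: abs_involutions_def FactGroup_def RCOSETS_def)
  then have "v \<in> Inv \<longleftrightarrow> v \<in> (\<lambda>a. Cp #>\<^bsub>Grn\<^esub> a) ` lifts" for v
    using Inv_iff lifts_carrier by blast
  then show ?thesis by blast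
qed

lemma finite_Inv: "finite Inv"
proof -
  have "finite lifts" using finite_subset[OF _ finite_G_rn[of r n]] by (auto simp: lifts_def)
  then show ?thesis unfolding Inv_eq by (rule finite_imageI)
qed

lemma Inv_memD:
  assumes "v \<in> Inv" "w \<in> v"
  shows "w \<in> lifts" "v = Cp #>\<^bsub>Grn\<^esub> w" "v \<in> carrier (Grn Mod Cp)"
proof -
  obtain a where a: "a \<in> lifts" "v = Cp #>\<^bsub>Grn\<^esub> a" using assms(1) by (auto simp: Inv_eq)
  have ac: "a \<in> carrier Grn" using a(1) by (rule lifts_carrier)
  show v: "v = Cp #>\<^bsub>Grn\<^esub> w" using coset_cong[OF ac] assms(2) a(2) by simp
  have "w \<in> carrier Grn" using assms(2) translate_carrier[OF ac] by (auto simp: a(2) coset_eq[OF ac])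
  then show "w \<in> lifts" using Inv_iff[of w] v assms(1) by simp
  show "v \<in> carrier (Grn Mod Cp)" using assms(1) by (simp add: abs_involutions_def)
qed

text \<open>Turns sums over classes into sums over lifts; the resulting factor \<open>p\<close> of
  \<open>trace_rho\<close> matches the one from Fourier inversion.\<close>

lemma sum_lifts: "(\<Sum>v\<in>Inv. \<Sum>w\<in>v. f w) = (\<Sum>w\<in>lifts. f w)" for f :: "colperm \<Rightarrow> complex"
proof -
  have "\<Union>Inv = lifts"
  proof
    show "\<Union>Inv \<subseteq> lifts" using Inv_memD(1) by blast
    show "lifts \<subseteq> \<Union>Inv"
    proof
      fix a assume a: "a \<in> lifts"
      then have "Cp #>\<^bsub>Grn\<^esub> a \<in> Inv" unfolding Inv_eq by (rule imageI)
      then show "a \<in> \<Union>Inv" using coset_self[OF lifts_carrier[OF a]] by (rule UnionI)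
    qed
  qed
  moreover have "finite v" if "v \<in> Inv" for v
    using that by (auto simp: Inv_eq coset_eq[OF lifts_carrier] finite_scalar_colors)
  moreover have "v \<inter> v' = {}" if "v \<in> Inv" "v' \<in> Inv" "v \<noteq> v'" for v v'
    using that Inv_memD(2) by (metis disjoint_iff)
  ultimately show ?thesis using sum.Union_disjoint[of Inv f] by (simp add: o_def)
qed

text \<open>Going around a pair of the involution \<open>perm w\<close> shifts the color by
  \<open>2 * l\<close>, so a nonzero \<open>l\<close> below \<open>r\<close> must be
  \<open>r div 2\<close>.\<close>

lemma symmetric_iff:
  assumes "w \<in> lifts" "l \<in> Kpr" "\<forall>i\<in>N. int r dvd color w (perm w i) - color w i - l"
  shows "symmetric n w \<longleftrightarrow> l = 0" "antisymmetric r n w \<longleftrightarrow> l \<noteq> 0"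
proof -
  have w: "perm w permutes N" "color w \<in> N \<rightarrow>\<^sub>E {0..<int r}" "perm w \<circ> perm w = id"
    using assms(1) by (auto simp: lifts_def G_rn_carrier_iff)
  have inN: "perm w i \<in> N \<longleftrightarrow> i \<in> N" for i by (rule permutes_in_image[OF w(1)])
  have l: "0 \<le> l" "l < int r" using assms(2) by (auto simp: scalar_colors_def)
  have range: "color w i = color w i mod int r" if "i \<in> N" for i using w(2) that by (auto simp: PiE_iff)
  have col: "color w (perm w i) = (color w i + l) mod int r" if "i \<in> N" for i
  proof -
    have "color w (perm w i) mod int r = (color w i + l) mod int r"
      using assms(3) that unfolding mod_eq_dvd_iff by (simp only: diff_diff_eq)
    then show ?thesis using that inN[of i] range[of "perm w i"] by simp
  qed
  have N: "1 \<in> N" using n by simp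
  show sym: "symmetric n w \<longleftrightarrow> l = 0"
  proof
    assume "symmetric n w"
    then have "int r dvd - l" using assms(3) N by (auto simp: symmetric_def)
    then have "int r dvd l" by simp
    then show "l = 0" using l zdvd_imp_le[of "int r" l] by (cases "l = 0") auto
  qed (use col range w(3) in \<open>auto simp: symmetric_def\<close>)
  have "l = int (r div 2) \<and> even r" if "l \<noteq> 0"
  proof -
    let ?d = "\<lambda>i. color w (perm w i) - color w i - l"
    have "perm w (perm w 1) = 1" using w(3) by (metis comp_apply id_apply)
    then have "?d (perm w 1) + ?d 1 = - (2 * l)" by simp
    moreover have "int r dvd ?d (perm w 1) + ?d 1"
      using bspec[OF assms(3) N] bspec[OF assms(3), of "perm w 1"] N inN[of 1] by (intro dvd_add) blast+
    ultimately have "int r dvd - (2 * l)" by (simp only:)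
    then have "int r dvd 2 * l" by (simp only: dvd_minus_iff)
    then obtain q where q: "2 * l = int r * q" by (elim dvdE)
    have "0 < int r * q" unfolding q[symmetric] using l that by simp
    then have "0 < q" using r by (simp add: zero_less_mult_iff)
    have "int r * q < int r * 2" unfolding q[symmetric] using l by linarith
    then have "q < 2" by (rule mult_left_less_imp_less) simp
    then have "q = 1" using \<open>0 < q\<close> by linarith
    then have "2 * l = int r" using q by (simp only: mult_1_right)
    then show ?thesis by presburger
  qed
  moreover have "\<not> antisymmetric r n w" if "l = 0"
  proof
    assume anti: "antisymmetric r n w"
    then have "color w 1 = (color w 1 + int (r div 2)) mod int r"
      using col[OF N] N that range[OF N] by (auto simp: antisymmetric_def)
    then have "int r dvd color w 1 - (color w 1 + int (r div 2))"
      using range[OF N] by (metis mod_eq_dvd_iff)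
    then have "int r dvd int (r div 2)" by simp
    moreover have "even r" "0 < r div 2" using anti r by (auto simp: antisymmetric_def elim!: evenE)
    ultimately show False using r zdvd_not_zless[of "int (r div 2)" "int r"] by simp
  qed
  ultimately show "antisymmetric r n w \<longleftrightarrow> l \<noteq> 0"
    using col w(3) by (auto simp: antisymmetric_def)
qed

text \<open>Two lifts differ by a constant added to all colors, which leaves the color differences
  along \<open>perm w\<close>, and with them \<open>l\<close>, unchanged.\<close>

lemma symmetric_lift:
  assumes v: "v \<in> Inv" and w: "w \<in> v" "w' \<in> v"
  shows "symmetric n w \<longleftrightarrow> symmetric n w'" "antisymmetric r n w \<longleftrightarrow> \<not> symmetric n w'"
proof -
  note W = Inv_memD(1)[OF v w(1)] and W' = Inv_memD(1)[OF v w(2)]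
  obtain l where l: "l \<in> Kpr" "\<forall>i\<in>N. int r dvd color w (perm w i) - color w i - l"
    using W by (auto simp: lifts_def)
  obtain k where k: "perm w' = perm w"
    "\<And>i. i \<in> N \<Longrightarrow> color w' i mod int r = (color w i + k) mod int r"
    using lift_differ[OF r p_dvd_r Inv_memD(3)[OF v w(1)] w] by blast
  have "perm w permutes N" using W by (simp add: lifts_def G_rn_carrier_iff)
  then have inN: "perm w i \<in> N \<longleftrightarrow> i \<in> N" for i by (rule permutes_in_image)
  have "int r dvd color w' (perm w' i) - color w' i - l" if i: "i \<in> N" for i
  proof -
    have "int r dvd color w' (perm w i) - (color w (perm w i) + k)" "int r dvd color w' i - (color w i + k)"
      using k(2) i inN by (simp_all only: mod_eq_dvd_iff[symmetric])
    then have "int r dvd color w' (perm w i) - (color w (perm w i) + k) - (color w' i - (color w i + k))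
        + (color w (perm w i) - color w i - l)"
      using l(2) i by (meson dvd_add dvd_diff)
    then show ?thesis unfolding k(1) by (simp add: algebra_simps)
  qed
  then show "symmetric n w \<longleftrightarrow> symmetric n w'" "antisymmetric r n w \<longleftrightarrow> \<not> symmetric n w'"
    using symmetric_iff[OF W l] symmetric_iff[OF W' l(1)] by simp_all
qed

lemma Inv_nonempty: "v \<in> Inv \<Longrightarrow> lift_elt v \<in> v"
  unfolding lift_elt_def by (rule someI_ex) (auto simp: Inv_eq intro: coset_self lifts_carrier)

lemma symmetric_class_iff:
  assumes "v \<in> Inv" "w \<in> v"
  shows "symmetric_class n v \<longleftrightarrow> symmetric n w" "antisymmetric_class r n v \<longleftrightarrow> \<not> symmetric n w"
proof -
  have "symmetric n w' \<longleftrightarrow> symmetric n w" "antisymmetric r n w' \<longleftrightarrow> \<not> symmetric n w" if "w' \<in> v" for w'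
    using symmetric_lift[OF assms(1) that assms(2)] by blast+
  then show "symmetric_class n v \<longleftrightarrow> symmetric n w" "antisymmetric_class r n v \<longleftrightarrow> \<not> symmetric n w"
    using assms(2) unfolding symmetric_class_def antisymmetric_class_def by blast+
qed

lemma symmetric_xor_antisymmetric: "v \<in> Inv \<Longrightarrow> symmetric_class n v \<longleftrightarrow> \<not> antisymmetric_class r n v"
  using symmetric_class_iff Inv_nonempty by blast

end

section \<open>The monomial representation\<close>

lemma pair_sign_id: "pair_sign D id t = 1"
  unfolding pair_sign_def by (intro prod.neutral) (auto simp: flip_sign_def mult_less_0_iff)

text \<open>A chain rule: \<open>\<sigma>\<close> carries the pairs of \<open>t\<close> to those of
  its conjugate, and the orientations in between cancel. The images of the smaller elements need not
  be the smaller ones, hence the use of \<open>pair_sign_transversal\<close>.\<close>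

lemma pair_sign_comp:
  assumes \<sigma>: "\<sigma> permutes D" and \<tau>: "\<tau> permutes D" and t: "t permutes D" "t \<circ> t = id"
  shows "pair_sign D (\<tau> \<circ> \<sigma>) t = pair_sign D \<tau> (\<sigma> \<circ> t \<circ> inv_into UNIV \<sigma>) * pair_sign D \<sigma> t"
proof -
  let ?u = "\<sigma> \<circ> t \<circ> inv_into UNIV \<sigma>" and ?A = "{i \<in> D. i < t i}"
  have tt: "t (t i) = i" for i using t(2) by (metis comp_apply id_apply)
  have inv: "inv_into UNIV \<sigma> (\<sigma> i) = i" "\<sigma> (inv_into UNIV \<sigma> i) = i" for i
    using permutes_inverses[OF \<sigma>] by simp_all
  have inj: "\<sigma> i = \<sigma> j \<longleftrightarrow> i = j" "\<tau> i = \<tau> j \<longleftrightarrow> i = j" for i j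
    using permutes_inj[OF \<sigma>] permutes_inj[OF \<tau>] by (auto dest: injD)
  have mem: "\<sigma> i \<in> D \<longleftrightarrow> i \<in> D" "t i \<in> D \<longleftrightarrow> i \<in> D" "inv_into UNIV \<sigma> i \<in> D \<longleftrightarrow> i \<in> D" for i
    using permutes_in_image[OF \<sigma>] permutes_in_image[OF t(1)] permutes_in_image[OF permutes_inv[OF \<sigma>]] by blast+
  have "pair_sign D \<tau> ?u = (\<Prod>i\<in>\<sigma> ` ?A. flip_sign \<tau> i (?u i))"
  proof (rule pair_sign_transversal)
    show "?u (?u i) = i" for i by (simp add: inv tt)
    show "?u ` D \<subseteq> D" by (auto simp: mem)
    show "\<sigma> ` ?A \<subseteq> D" by (auto simp: mem)
    show "?u i \<notin> \<sigma> ` ?A" if "i \<in> \<sigma> ` ?A" for i using that by (auto simp: inv tt inj)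
    show "i \<in> \<sigma> ` ?A \<or> ?u i \<in> \<sigma> ` ?A" if "i \<in> D" "?u i \<noteq> i" for i
    proof -
      define j where "j = inv_into UNIV \<sigma> i"
      have i: "i = \<sigma> j" by (simp add: j_def inv)
      then have "t j \<noteq> j" "j \<in> D" using that by (auto simp: inv inj mem)
      then have "j \<in> ?A \<or> t j \<in> ?A" by (auto simp: tt mem)
      then show ?thesis by (auto simp: i inv)
    qed
  qed
  also have "\<dots> = (\<Prod>i\<in>?A. flip_sign \<tau> (\<sigma> i) (\<sigma> (t i)))"
    by (subst prod.reindex) (auto simp: inj_on_def inj inv)
  finally have "pair_sign D \<tau> ?u * pair_sign D \<sigma> t
      = (\<Prod>i\<in>?A. flip_sign \<tau> (\<sigma> i) (\<sigma> (t i)) * flip_sign \<sigma> i (t i))"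
    by (simp add: pair_sign_def prod.distrib)
  also have "\<dots> = pair_sign D (\<tau> \<circ> \<sigma>) t"
    unfolding pair_sign_def
  proof (intro prod.cong refl)
    fix i assume "i \<in> ?A"
    then have "i \<noteq> t i" by simp
    then show "flip_sign \<tau> (\<sigma> i) (\<sigma> (t i)) * flip_sign \<sigma> i (t i) = flip_sign (\<tau> \<circ> \<sigma>) i (t i)"
      by (auto simp: flip_sign_sgn inj sgn_if)
  qed
  finally show ?thesis by simp
qed

lemma minus_one_power_inv_stat:
  assumes t: "perm w permutes {1..n}" "perm w \<circ> perm w = id" and \<sigma>: "perm g permutes {1..n}"
  shows "(- 1) ^ inv_stat n g w = pair_sign {1..n} (perm g) (perm w)"
proof -
  let ?t = "perm w" and ?\<sigma> = "perm g" and ?D = "{1..n}"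
  let ?B = "{i \<in> ?D. i < ?t i \<and> flip_sign ?\<sigma> i (?t i) = - 1}"
  have tt: "?t (?t i) = i" for i using t(2) by (metis comp_apply id_apply)
  have mem: "?t i \<in> ?D \<longleftrightarrow> i \<in> ?D" for i using permutes_in_image[OF t(1)] .
  have neg: "flip_sign ?\<sigma> i j = - 1 \<longleftrightarrow> (int j - int i) * (int (?\<sigma> j) - int (?\<sigma> i)) < 0" for i j
    by (simp add: flip_sign_def)
  have "inv_set n ?\<sigma> \<inter> pair_set n ?t = (\<lambda>i. {i, ?t i}) ` ?B"
  proof
    show "inv_set n ?\<sigma> \<inter> pair_set n ?t \<subseteq> (\<lambda>i. {i, ?t i}) ` ?B"
    proof
      fix e assume e: "e \<in> inv_set n ?\<sigma> \<inter> pair_set n ?t"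
      then obtain i where i: "i \<in> ?D" "?t i \<noteq> i" "e = {i, ?t i}" unfolding pair_set_def by blast
      from e obtain a b where ab: "e = {a, b}" "flip_sign ?\<sigma> a b = - 1" unfolding inv_set_def neg by blast
      then have "{a, b} = {i, ?t i}" using i by simp
      then have f: "flip_sign ?\<sigma> i (?t i) = - 1"
        using ab(2) flip_sign_sym[of ?\<sigma>] by (auto simp: doubleton_eq_iff)
      show "e \<in> (\<lambda>i. {i, ?t i}) ` ?B"
      proof (cases "i < ?t i")
        case True
        then show ?thesis using i f by blast
      next
        case False
        then have "?t i \<in> ?B" using i f flip_sign_sym[of ?\<sigma> i "?t i"] mem[of i] by (simp add: tt del: atLeastAtMost_iff)
        moreover have "e = {?t i, ?t (?t i)}" using i by (auto simp: tt)
        ultimately show ?thesis by blast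
      qed
    qed
    show "(\<lambda>i. {i, ?t i}) ` ?B \<subseteq> inv_set n ?\<sigma> \<inter> pair_set n ?t"
    proof
      fix e assume "e \<in> (\<lambda>i. {i, ?t i}) ` ?B"
      then obtain i where i: "i \<in> ?D" "i < ?t i" "flip_sign ?\<sigma> i (?t i) = - 1" "e = {i, ?t i}" by blast
      then have "?t i \<in> ?D" "?t i \<noteq> i" using mem[of i] by simp_all
      then show "e \<in> inv_set n ?\<sigma> \<inter> pair_set n ?t"
        using i unfolding inv_set_def pair_set_def neg by blast
    qed
  qed
  moreover have "inj_on (\<lambda>i. {i, ?t i}) ?B" by (rule inj_onI) (auto simp: doubleton_eq_iff tt)
  ultimately have "inv_stat n g w = card ?B" by (simp add: inv_stat_def card_image)
  moreover have "pair_sign ?D ?\<sigma> ?t = (\<Prod>i\<in>{i \<in> ?D. i < ?t i}. if flip_sign ?\<sigma> i (?t i) = - 1 then - 1 else 1)"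
    unfolding pair_sign_def by (intro prod.cong refl) (auto simp: flip_sign_def)
  moreover have "\<dots> = (- 1) ^ card ?B"
    by (simp add: prod.If_cases Int_def conj_assoc)
  ultimately show ?thesis by simp
qed

section \<open>Action on lifts and the cocycle of coefficients\<close>

context crg
begin

definition conj_abs :: "colperm \<Rightarrow> colperm \<Rightarrow> colperm" where
  "conj_abs g w = (perm g \<circ> perm w \<circ> inv_into UNIV (perm g), \<lambda>i\<in>N. color w (inv_into UNIV (perm g) i))"

lemma permD:
  assumes "g \<in> carrier Grn"
  shows "perm g permutes N" "perm g i \<in> N \<longleftrightarrow> i \<in> N" "inv_into UNIV (perm g) i \<in> N \<longleftrightarrow> i \<in> N"
    "perm g (inv_into UNIV (perm g) i) = i" "inv_into UNIV (perm g) (perm g i) = i"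
proof -
  show p: "perm g permutes N" using assms by (simp add: G_rn_carrier_iff)
  show "perm g i \<in> N \<longleftrightarrow> i \<in> N" by (rule permutes_in_image[OF p])
  show "inv_into UNIV (perm g) i \<in> N \<longleftrightarrow> i \<in> N" by (rule permutes_in_image[OF permutes_inv[OF p]])
  show "perm g (inv_into UNIV (perm g) i) = i" "inv_into UNIV (perm g) (perm g i) = i"
    using permutes_inverses[OF p] by simp_all
qed

lemma color_range: "w \<in> carrier Grn \<Longrightarrow> i \<in> N \<Longrightarrow> color w i mod int r = color w i"
  by (auto simp: G_rn_carrier_iff PiE_iff)

lemma conj_abs_carrier:
  assumes g: "g \<in> carrier Grn" and w: "w \<in> carrier Grn"
  shows "conj_abs g w \<in> carrier Grn"
proof -
  have "perm g \<circ> perm w \<circ> inv_into UNIV (perm g) permutes N"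
    using permD(1)[OF g] permD(1)[OF w] by (intro permutes_compose permutes_inv)
  moreover have "color w (inv_into UNIV (perm g) i) \<in> {0..<int r}" if "i \<in> N" for i
    using w permD(3)[OF g, of i] that by (auto simp: G_rn_carrier_iff PiE_iff simp del: atLeastAtMost_iff)
  ultimately show ?thesis by (auto simp: conj_abs_def G_rn_carrier_iff simp del: atLeastAtMost_iff)
qed

lemma conj_abs_eq:
  assumes g: "g \<in> carrier Grn" and w: "w \<in> carrier Grn"
  shows "abs_elt n g \<otimes>\<^bsub>Grn\<^esub> w \<otimes>\<^bsub>Grn\<^esub> inv\<^bsub>Grn\<^esub> (abs_elt n g) = conj_abs g w"
proof -
  have a: "abs_elt n g \<in> carrier Grn" using permD(1)[OF g] r by (auto simp: abs_elt_def G_rn_carrier_iff)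
  have inv: "inv\<^bsub>Grn\<^esub> (abs_elt n g) = (inv_into UNIV (perm g), \<lambda>i\<in>N. 0)"
    unfolding G_rn_inv[OF r a]
    using permD(3)[OF g] by (auto simp: abs_elt_def fun_eq_iff restrict_def simp del: atLeastAtMost_iff)
  show ?thesis unfolding inv
    using permD(2)[OF w] permD(3)[OF g] color_range[OF w]
    by (auto intro!: colperm_eqI[of _ _ N] simp: G_rn_mult abs_elt_def conj_abs_def simp del: atLeastAtMost_iff)
qed

lemma conj_abs_translate:
  assumes "g \<in> carrier Grn"
  shows "conj_abs g (translate k w) = translate k (conj_abs g w)"
  using permD(3)[OF assms]
  by (auto intro!: colperm_eqI[of _ _ N] simp: translate_def conj_abs_def simp del: atLeastAtMost_iff)

lemma conj_class_coset:
  assumes g: "g \<in> carrier Grn" and w: "w \<in> carrier Grn"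
  shows "conj_class r n g (Cp #>\<^bsub>Grn\<^esub> w) = Cp #>\<^bsub>Grn\<^esub> conj_abs g w"
proof -
  have "conj_class r n g (Cp #>\<^bsub>Grn\<^esub> w) = conj_abs g ` (Cp #>\<^bsub>Grn\<^esub> w)"
    unfolding conj_class_def coset_eq[OF w] using conj_abs_eq[OF g translate_carrier[OF w]] by (intro image_cong) auto
  then show ?thesis
    by (simp add: coset_eq[OF w] coset_eq[OF conj_abs_carrier[OF g w]] image_image conj_abs_translate[OF g])
qed

lemma conj_abs_shift:
  assumes g: "g \<in> carrier Grn" and w: "w \<in> carrier Grn"
    and l: "\<forall>i\<in>N. int r dvd color w (perm w i) - color w i - l"
  shows "\<forall>i\<in>N. int r dvd color (conj_abs g w) (perm (conj_abs g w) i) - color (conj_abs g w) i - l"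
  using l permD(2)[OF w] permD(2,3,5)[OF g] by (auto simp: conj_abs_def simp del: atLeastAtMost_iff)

lemma conj_abs_lifts:
  assumes g: "g \<in> carrier Grn" and w: "w \<in> lifts"
  shows "conj_abs g w \<in> lifts" "symmetric n (conj_abs g w) \<longleftrightarrow> symmetric n w"
proof -
  note wc = lifts_carrier[OF w]
  obtain l where l: "l \<in> Kpr" "\<forall>i\<in>N. int r dvd color w (perm w i) - color w i - l"
    using w by (auto simp: lifts_def)
  have "perm w (perm w i) = i" for i using w by (auto simp: lifts_def dest: fun_cong[of _ _ i])
  then have "perm (conj_abs g w) \<circ> perm (conj_abs g w) = id"
    using permD(4,5)[OF g] by (auto simp: conj_abs_def fun_eq_iff)
  then show lift: "conj_abs g w \<in> lifts"
    using conj_abs_carrier[OF g wc] conj_abs_shift[OF g wc l(2)] l(1) unfolding lifts_def by blast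
  show "symmetric n (conj_abs g w) \<longleftrightarrow> symmetric n w"
    using symmetric_iff(1)[OF w l] symmetric_iff(1)[OF lift l(1) conj_abs_shift[OF g wc l(2)]] by simp
qed

lemma conj_abs_mult:
  assumes g: "g \<in> carrier Grn" and h: "h \<in> carrier Grn"
  shows "conj_abs (g \<otimes>\<^bsub>Grn\<^esub> h) w = conj_abs g (conj_abs h w)"
proof -
  have "inv_into UNIV (perm g \<circ> perm h) = inv_into UNIV (perm h) \<circ> inv_into UNIV (perm g)"
    using permutes_bij[OF permD(1)[OF g]] permutes_bij[OF permD(1)[OF h]] by (rule o_inv_distrib)
  then show ?thesis using permD(3)[OF g]
    by (auto intro!: colperm_eqI[of _ _ N] simp: G_rn_mult conj_abs_def comp_assoc simp del: atLeastAtMost_iff)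
qed

lemma conj_abs_one: "w \<in> carrier Grn \<Longrightarrow> conj_abs \<one>\<^bsub>Grn\<^esub> w = w"
  by (auto intro!: colperm_eqI[of _ _ N] simp: G_rn_one conj_abs_def G_rn_carrier_iff PiE_iff)

text \<open>The coefficient \<open>rho_coeff\<close> on the level of lifts, with exponents not
  reduced modulo \<open>r\<close>, so that they add.\<close>

definition lift_coeff :: "colperm \<Rightarrow> colperm \<Rightarrow> complex" where
  "lift_coeff g w = zeta r powi (\<Sum>i\<in>N. color g i * color w i) *
     (if symmetric n w then of_int (pair_sign N (perm g) (perm w))
      else zeta r powi (color w 1 - color w (inv_into UNIV (perm g) 1)))"

lemma rho_coeff_eq:
  assumes v: "v \<in> Inv" and w: "w \<in> v" and g: "g \<in> carrier Grpn"
  shows "rho_coeff r n g v = lift_coeff g w"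
proof -
  note indep = lift_independence[OF r p_dvd_r n Inv_memD(3)[OF v w] w Inv_nonempty[OF v] g]
  have wl: "w \<in> lifts" using Inv_memD(1)[OF v w] .
  have "(- 1) ^ inv_stat n g w = pair_sign N (perm g) (perm w)"
    using wl permD(1)[OF Grpn_subset[OF g]] permD(1)[OF lifts_carrier[OF wl]]
    by (intro minus_one_power_inv_stat) (auto simp: lifts_def)
  then have "(- 1 :: complex) ^ inv_stat n g w = of_int (pair_sign N (perm g) (perm w))"
    by (metis of_int_1 of_int_minus of_int_power)
  then show ?thesis
    using symmetric_class_iff(1)[OF v w] unfolding rho_coeff_def lift_coeff_def indep
    by (simp add: pairing_def u_stat_def zeta_powi_mod[OF r])
qed

text \<open>The cocycle identity that makes the monomial action multiplicative.\<close>

lemma lift_coeff_mult: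
  assumes g: "g \<in> carrier Grn" and h: "h \<in> carrier Grn" and w: "w \<in> lifts"
  shows "lift_coeff (g \<otimes>\<^bsub>Grn\<^esub> h) w = lift_coeff g (conj_abs h w) * lift_coeff h w"
proof -
  note wc = lifts_carrier[OF w]
  let ?w = "conj_abs h w"
  have "zeta r powi (\<Sum>i\<in>N. color (g \<otimes>\<^bsub>Grn\<^esub> h) i * color w i)
      = zeta r powi ((\<Sum>i\<in>N. color h i * color w i) + (\<Sum>i\<in>N. color g (perm h i) * color w i))"
  proof (rule zeta_powi_cong[OF r])
    have "int r dvd (\<Sum>i\<in>N. ((color h i + color g (perm h i)) mod int r - (color h i + color g (perm h i))) * color w i)"
      by (intro dvd_sum dvd_mult2) (metis dvd_minus_iff dvd_minus_mod minus_diff_eq)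
    then show "int r dvd (\<Sum>i\<in>N. color (g \<otimes>\<^bsub>Grn\<^esub> h) i * color w i)
        - ((\<Sum>i\<in>N. color h i * color w i) + (\<Sum>i\<in>N. color g (perm h i) * color w i))"
      by (simp add: G_rn_mult left_diff_distrib distrib_right sum.distrib sum_subtractf)
  qed
  also have "(\<Sum>i\<in>N. color g (perm h i) * color w i) = (\<Sum>i\<in>N. color g i * color ?w i)"
  proof -
    have "(\<Sum>i\<in>N. color g i * color ?w i) = (\<Sum>i\<in>N. color g i * color w (inv_into UNIV (perm h) i))"
      by (intro sum.cong refl) (simp add: conj_abs_def del: atLeastAtMost_iff)
    also have "\<dots> = (\<Sum>i\<in>N. color g (perm h i) * color w i)"
      by (subst sum.permute[OF permD(1)[OF h]]) (simp add: permD(5)[OF h])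
    finally show ?thesis by simp
  qed
  finally have pairing: "zeta r powi (\<Sum>i\<in>N. color (g \<otimes>\<^bsub>Grn\<^esub> h) i * color w i)
      = zeta r powi (\<Sum>i\<in>N. color g i * color ?w i) * zeta r powi (\<Sum>i\<in>N. color h i * color w i)"
    by (simp add: zeta_powi_add mult.commute)
  have sign: "pair_sign N (perm (g \<otimes>\<^bsub>Grn\<^esub> h)) (perm w)
      = pair_sign N (perm g) (perm ?w) * pair_sign N (perm h) (perm w)"
    using pair_sign_comp[OF permD(1)[OF h] permD(1)[OF g] permD(1)[OF wc]] w
    by (simp add: G_rn_mult conj_abs_def lifts_def)
  have "inv_into UNIV (perm (g \<otimes>\<^bsub>Grn\<^esub> h)) = inv_into UNIV (perm h) \<circ> inv_into UNIV (perm g)"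
    using o_inv_distrib[OF permutes_bij[OF permD(1)[OF g]] permutes_bij[OF permD(1)[OF h]]] by (simp add: G_rn_mult)
  moreover have one: "1 \<in> N" using n by simp
  \<comment> \<open>The exponent telescopes, since the color of \<open>?w\<close> at 1 is the color
    of \<open>w\<close> at the preimage of 1 under \<open>perm h\<close>.\<close>
  ultimately have u: "color w 1 - color w (inv_into UNIV (perm (g \<otimes>\<^bsub>Grn\<^esub> h)) 1)
      = (color ?w 1 - color ?w (inv_into UNIV (perm g) 1)) + (color w 1 - color w (inv_into UNIV (perm h) 1))"
    using permD(3)[OF g, of 1] by (simp add: conj_abs_def del: atLeastAtMost_iff)
  show ?thesis
    using conj_abs_lifts(2)[OF h w] unfolding lift_coeff_def pairing sign u zeta_powi_add by simp
qed

lemma lift_coeff_one: "lift_coeff \<one>\<^bsub>Grn\<^esub> w = 1"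
  by (simp add: lift_coeff_def G_rn_one pair_sign_id del: atLeastAtMost_iff)

lemma is_rep_rho: "is_rep Grpn Inv (rho r p n)"
proof (rule is_rep_op_of[OF group_Grpn finite_Inv])
  let ?M = "\<lambda>g v' v. if v' = conj_class r n g v then rho_coeff r n g v else 0"
  have act: "conj_class r n g v \<in> Inv \<and>
      (\<exists>w\<in>lifts. v = Cp #>\<^bsub>Grn\<^esub> w \<and> w \<in> v \<and> conj_class r n g v = Cp #>\<^bsub>Grn\<^esub> conj_abs g w \<and>
        conj_abs g w \<in> conj_class r n g v)"
    if g: "g \<in> carrier Grpn" and v: "v \<in> Inv" for g v
  proof -
    note gc = Grpn_subset[OF g]
    obtain w where w: "w \<in> lifts" "v = Cp #>\<^bsub>Grn\<^esub> w" using v by (auto simp: Inv_eq)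
    note wc = lifts_carrier[OF w(1)]
    have eq: "conj_class r n g v = Cp #>\<^bsub>Grn\<^esub> conj_abs g w" using conj_class_coset[OF gc wc] w(2) by simp
    moreover have "conj_abs g w \<in> Cp #>\<^bsub>Grn\<^esub> conj_abs g w" by (rule coset_self[OF conj_abs_carrier[OF gc wc]])
    moreover have "w \<in> v" using coset_self[OF wc] w(2) by simp
    moreover have "Cp #>\<^bsub>Grn\<^esub> conj_abs g w \<in> Inv" unfolding Inv_eq using conj_abs_lifts(1)[OF gc w(1)] by (rule imageI)
    ultimately show ?thesis using w by (auto simp only:)
  qed
  show "rho r p n g = op_of Inv Inv (?M g)" if g: "g \<in> carrier Grpn" for g
  proof
    fix f
    show "rho r p n g f = op_of Inv Inv (?M g) f"
    proof (cases "f \<in> free_space Inv")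
      case True
      have "rho r p n g f v' = op_of Inv Inv (?M g) f v'" for v'
      proof -
        have "rho r p n g f v' = (\<Sum>v\<in>Inv. f v * (rho_coeff r n g v * basis_vec (conj_class r n g v) v'))"
          using True by (simp add: rho_def sum_fun_apply cscale_def)
        also have "\<dots> = (\<Sum>v\<in>Inv. ?M g v' v * f v)"
          by (intro sum.cong refl) (simp add: basis_vec_def)
        also have "\<dots> = op_of Inv Inv (?M g) f v'"
        proof (cases "v' \<in> Inv")
          case False
          then have "?M g v' v = 0" if "v \<in> Inv" for v using act[OF g that] by auto
          then show ?thesis using False True by (simp add: op_of_apply)
        qed (use True in \<open>simp add: op_of_apply\<close>)
        finally show ?thesis .
      qed
      then show ?thesis by (rule ext)
    qed (simp add: rho_def op_of_def)
  qed
  fix v' v assume v: "v' \<in> Inv" "v \<in> Inv"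
  show "?M \<one>\<^bsub>Grpn\<^esub> v' v = (if v' = v then 1 else 0)"
  proof -
    have one: "\<one>\<^bsub>Grn\<^esub> \<in> carrier Grpn" using subgroup.one_closed[OF subgroup_Grpn] .
    obtain w where w: "w \<in> lifts" "v = Cp #>\<^bsub>Grn\<^esub> w" "w \<in> v"
      "conj_class r n \<one>\<^bsub>Grn\<^esub> v = Cp #>\<^bsub>Grn\<^esub> conj_abs \<one>\<^bsub>Grn\<^esub> w"
      using act[OF one v(2)] by blast
    then have "conj_class r n \<one>\<^bsub>Grn\<^esub> v = v" using conj_abs_one[OF lifts_carrier[OF w(1)]] by simp
    moreover have "rho_coeff r n \<one>\<^bsub>Grn\<^esub> v = 1" using rho_coeff_eq[OF v(2) w(3) one] lift_coeff_one by simp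
    ultimately show ?thesis by simp
  qed
  fix g h assume gh: "g \<in> carrier Grpn" "h \<in> carrier Grpn"
  note gc = Grpn_subset[OF gh(1)] and hc = Grpn_subset[OF gh(2)]
  have ghc: "g \<otimes>\<^bsub>Grn\<^esub> h \<in> carrier Grpn" using gh subgroup.m_closed[OF subgroup_Grpn] by blast
  let ?u = "conj_class r n h v"
  obtain w where w: "w \<in> lifts" "v = Cp #>\<^bsub>Grn\<^esub> w" "w \<in> v" "?u = Cp #>\<^bsub>Grn\<^esub> conj_abs h w" "conj_abs h w \<in> ?u"
    using act[OF gh(2) v(2)] by blast
  have u: "?u \<in> Inv" using act[OF gh(2) v(2)] by blast
  note wc = lifts_carrier[OF w(1)]
  have "conj_class r n (g \<otimes>\<^bsub>Grn\<^esub> h) v = conj_class r n g ?u"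
    unfolding w(4) conj_class_coset[OF gc conj_abs_carrier[OF hc wc]]
    by (simp only: w(2) conj_class_coset[OF G.m_closed[OF gc hc] wc] conj_abs_mult[OF gc hc])
  moreover have "rho_coeff r n (g \<otimes>\<^bsub>Grn\<^esub> h) v = rho_coeff r n g ?u * rho_coeff r n h v"
    using rho_coeff_eq[OF v(2) w(3) ghc] rho_coeff_eq[OF v(2) w(3) gh(2)] rho_coeff_eq[OF u w(5) gh(1)]
      lift_coeff_mult[OF gc hc w(1)] by simp
  moreover have "(\<Sum>l\<in>Inv. ?M g v' l * ?M h l v) = (\<Sum>l\<in>Inv. if l = ?u then ?M g v' ?u * rho_coeff r n h v else 0)"
    by (intro sum.cong refl) simp
  ultimately show "?M (g \<otimes>\<^bsub>Grpn\<^esub> h) v' v = (\<Sum>l\<in>Inv. ?M g v' l * ?M h l v)"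
    using u finite_Inv by simp
qed

end

section \<open>The character of the monomial representation\<close>

context crg
begin

abbreviation "Z \<equiv> N \<rightarrow>\<^sub>E {0..<int r}"
abbreviation "chi g z \<equiv> zeta r powi (\<Sum>i\<in>N. color g i * z i)"
abbreviation "shifts s z k \<equiv> (\<forall>i\<in>N. int r dvd z (s i) - z i - k)"

lemma finite_Z: "finite Z" by (intro finite_PiE) auto

text \<open>An element \<open>h\<close> of the set is a square root \<open>s\<close> of
  \<open>|g|\<close> together with a solution of the color equations. Here \<open>z\<close> is not
  the coloring of \<open>h\<close> but the dual variable of
  \<open>card_coboundary_solutions\<close>; it is made the outermost index to match
  \<open>trace_rho\<close>.\<close>

lemma count_twisted_square_roots:
  assumes g: "g \<in> carrier Grn"
  shows "of_nat p * of_nat (card {h \<in> carrier Grpn. h \<otimes>\<^bsub>Grn\<^esub> conj_elt r n h = g}) =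
    (\<Sum>z\<in>Z. chi g z * (\<Sum>k\<in>Kpr. of_nat (card {s. s permutes N \<and> s \<circ> s = perm g \<and> shifts s z k})))"
proof -
  let ?S = "{s. s permutes N \<and> s \<circ> s = perm g}"
  let ?Zs = "\<lambda>s. {z \<in> Z. (\<forall>i\<in>N. int r dvd z (s i) - z i - color g i) \<and> int p dvd (\<Sum>i\<in>N. z i)}"
  have finS: "finite ?S" using finite_subset[OF _ finite_permutations[of N]] by auto
  have "{h \<in> carrier Grpn. h \<otimes>\<^bsub>Grn\<^esub> conj_elt r n h = g} = (SIGMA s:?S. ?Zs s)"
  proof -
    have "h \<otimes>\<^bsub>Grn\<^esub> conj_elt r n h = g \<longleftrightarrow>
        perm h \<circ> perm h = perm g \<and> (\<forall>i\<in>N. int r dvd color h (perm h i) - color h i - color g i)"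
      if h: "h \<in> carrier Grn" for h
    proof -
      let ?q = "h \<otimes>\<^bsub>Grn\<^esub> conj_elt r n h"
      have col: "color ?q i = color g i \<longleftrightarrow> int r dvd color h (perm h i) - color h i - color g i" if "i \<in> N" for i
      proof -
        have "color ?q i = (color h (perm h i) - color h i) mod int r"
          using that by (simp add: G_rn_mult conj_elt_def mod_simps del: atLeastAtMost_iff)
        then show ?thesis using color_range[OF g that] by (metis mod_eq_dvd_iff)
      qed
      have q: "perm ?q = perm h \<circ> perm h" "color ?q \<in> extensional N" by (simp_all add: G_rn_mult conj_elt_def)
      have "color g \<in> extensional N" using g by (auto simp: G_rn_carrier_iff PiE_iff)
      then have "?q = g \<longleftrightarrow> perm ?q = perm g \<and> (\<forall>i\<in>N. color ?q i = color g i)"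
        by (rule colperm_eq_iff[OF q(2)])
      also have "\<dots> \<longleftrightarrow> perm h \<circ> perm h = perm g \<and> (\<forall>i\<in>N. int r dvd color h (perm h i) - color h i - color g i)"
      proof -
        have "(\<forall>i\<in>N. color ?q i = color g i) \<longleftrightarrow> (\<forall>i\<in>N. int r dvd color h (perm h i) - color h i - color g i)"
          by (rule ball_cong[OF refl col])
        then show ?thesis by (simp only: q(1))
      qed
      finally show ?thesis .
    qed
    note eq = this
    show ?thesis
    proof (rule Set.set_eqI)
      fix x :: colperm
      have "x \<in> {h \<in> carrier Grpn. h \<otimes>\<^bsub>Grn\<^esub> conj_elt r n h = g} \<longleftrightarrow>
          x \<in> carrier Grn \<and> int p dvd (\<Sum>i\<in>N. color x i) \<and> perm x \<circ> perm x = perm g \<and>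
          (\<forall>i\<in>N. int r dvd color x (perm x i) - color x i - color g i)"
        using eq[of x] Grpn_carrier_iff[of x] by blast
      also have "\<dots> \<longleftrightarrow> x \<in> (SIGMA s:?S. ?Zs s)"
        unfolding G_rn_carrier_iff mem_Sigma_iff[of "perm x" "color x", unfolded prod.collapse] by blast
      finally show "x \<in> {h \<in> carrier Grpn. h \<otimes>\<^bsub>Grn\<^esub> conj_elt r n h = g} \<longleftrightarrow> x \<in> (SIGMA s:?S. ?Zs s)" .
    qed
  qed
  moreover have "card (SIGMA s:?S. ?Zs s) = (\<Sum>s\<in>?S. card (?Zs s))"
    using finS finite_Z by (intro card_SigmaI) auto
  ultimately have "of_nat p * of_nat (card {h \<in> carrier Grpn. h \<otimes>\<^bsub>Grn\<^esub> conj_elt r n h = g})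
      = (\<Sum>s\<in>?S. of_nat p * (of_nat (card (?Zs s)) :: complex))"
    by (simp only: of_nat_sum sum_distrib_left)
  also have "\<dots> = (\<Sum>s\<in>?S. \<Sum>k\<in>Kpr. \<Sum>z\<in>{z \<in> Z. shifts s z k}. chi g z)"
    using card_coboundary_solutions[OF p p_dvd_r r, of N] by (intro sum.cong refl) simp
  also have "\<dots> = (\<Sum>s\<in>?S. \<Sum>k\<in>Kpr. \<Sum>z\<in>Z. if shifts s z k then chi g z else 0)"
    using finite_Z by (intro sum.cong refl sum.inter_filter)
  also have "\<dots> = (\<Sum>k\<in>Kpr. \<Sum>z\<in>Z. \<Sum>s\<in>?S. if shifts s z k then chi g z else 0)"
    by (subst sum.swap) (rule sum.cong[OF refl], rule sum.swap)
  also have "\<dots> = (\<Sum>z\<in>Z. \<Sum>k\<in>Kpr. \<Sum>s\<in>?S. if shifts s z k then chi g z else 0)"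
    by (rule sum.swap)
  also have "\<dots> = (\<Sum>z\<in>Z. \<Sum>k\<in>Kpr. chi g z * of_nat (card {s. s permutes N \<and> s \<circ> s = perm g \<and> shifts s z k}))"
  proof (intro sum.cong refl)
    fix z k
    have "(\<Sum>s\<in>?S. if shifts s z k then chi g z else 0) = (\<Sum>s\<in>{s \<in> ?S. shifts s z k}. chi g z)"
      using finS by (intro sum.inter_filter[symmetric])
    also have "{s \<in> ?S. shifts s z k} = {s. s permutes N \<and> s \<circ> s = perm g \<and> shifts s z k}" by blast
    finally show "(\<Sum>s\<in>?S. if shifts s z k then chi g z else 0)
        = chi g z * of_nat (card {s. s permutes N \<and> s \<circ> s = perm g \<and> shifts s z k})"
      by (simp only: sum_constant mult.commute)
  qed
  finally show ?thesis by (simp only: sum_distrib_left)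
qed

text \<open>A class is fixed when conjugation changes its lift at most by a scalar in
  \<open>Cp\<close>; the color of this scalar is, modulo \<open>r\<close>, the shift
  \<open>k\<close> along \<open>|g|\<close>.\<close>

lemma fixed_coset_iff:
  assumes g: "g \<in> carrier Grn" and w: "w \<in> carrier Grn"
  shows "conj_class r n g (Cp #>\<^bsub>Grn\<^esub> w) = Cp #>\<^bsub>Grn\<^esub> w \<longleftrightarrow>
    perm w \<circ> perm g = perm g \<circ> perm w \<and> (\<exists>k\<in>Kpr. shifts (perm g) (color w) k)"
proof -
  note cc = conj_abs_carrier[OF g w]
  have "conj_class r n g (Cp #>\<^bsub>Grn\<^esub> w) = Cp #>\<^bsub>Grn\<^esub> w \<longleftrightarrow> w \<in> Cp #>\<^bsub>Grn\<^esub> conj_abs g w"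
    using coset_self[OF w] coset_cong[OF cc, of w] unfolding conj_class_coset[OF g w] by auto
  also have "\<dots> \<longleftrightarrow> (\<exists>k\<in>Kpr. w = translate k (conj_abs g w))" by (auto simp: coset_eq[OF cc])
  also have "\<dots> \<longleftrightarrow> (\<exists>k\<in>Kpr. perm w \<circ> perm g = perm g \<circ> perm w \<and> shifts (perm g) (color w) k)"
  proof (intro bex_cong refl)
    fix k
    have "w = translate k (conj_abs g w) \<longleftrightarrow> perm w = perm (translate k (conj_abs g w)) \<and>
        (\<forall>i\<in>N. color w i = color (translate k (conj_abs g w)) i)"
      using w by (intro colperm_eq_iff) (auto simp: translate_def G_rn_carrier_iff PiE_iff)
    also have "perm (translate k (conj_abs g w)) = perm (conj_abs g w)" by (simp add: translate_def)
    also have "perm w = perm (conj_abs g w) \<longleftrightarrow> perm w \<circ> perm g = perm g \<circ> perm w"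
    proof
      assume "perm w = perm (conj_abs g w)"
      then have "perm w \<circ> perm g = perm (conj_abs g w) \<circ> perm g" by simp
      then show "perm w \<circ> perm g = perm g \<circ> perm w"
        using permD(5)[OF g] by (simp add: conj_abs_def fun_eq_iff)
    next
      assume "perm w \<circ> perm g = perm g \<circ> perm w"
      then show "perm w = perm (conj_abs g w)"
        using permD(4)[OF g] by (simp add: conj_abs_def fun_eq_iff) (metis comp_apply)
    qed
    also have "(\<forall>i\<in>N. color w i = color (translate k (conj_abs g w)) i) \<longleftrightarrow> shifts (perm g) (color w) k"
    proof -
      have "color w (perm g i) = color (translate k (conj_abs g w)) (perm g i) \<longleftrightarrow>
          int r dvd color w (perm g i) - color w i - k" if i: "i \<in> N" for i
      proof -
        have gi: "perm g i \<in> N" using permD(2)[OF g] i by simp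
        have "color (translate k (conj_abs g w)) (perm g i) = (color w i + k) mod int r"
          using gi permD(5)[OF g] by (simp add: translate_def conj_abs_def del: atLeastAtMost_iff)
        then show ?thesis using color_range[OF w gi] by (metis mod_eq_dvd_iff diff_diff_eq)
      qed
      then have "(\<forall>i\<in>perm g ` N. color w i = color (translate k (conj_abs g w)) i) \<longleftrightarrow> shifts (perm g) (color w) k"
        by simp
      then show ?thesis by (simp only: permutes_image[OF permD(1)[OF g]])
    qed
    finally show "w = translate k (conj_abs g w) \<longleftrightarrow>
        perm w \<circ> perm g = perm g \<circ> perm w \<and> shifts (perm g) (color w) k" .
  qed
  finally show ?thesis by blast
qed

lemma shifts_unique:
  assumes "shifts s z k" "shifts s z l" "k \<in> Kpr" "l \<in> Kpr"
  shows "k = l"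
proof -
  have "1 \<in> N" using n by simp
  then have "int r dvd (z (s 1) - z 1 - k) - (z (s 1) - z 1 - l)" using assms(1,2) dvd_diff by blast
  then have "l mod int r = k mod int r" by (simp add: mod_eq_dvd_iff)
  then show ?thesis using assms(3,4) by (simp add: scalar_colors_def)
qed

abbreviation "swaps g z l \<equiv> finite_perm.color_involutions N (perm g) z (\<lambda>x. (x + l) mod int r)"

lemma swaps_iff:
  assumes g: "g \<in> carrier Grn" and z: "z \<in> Z"
  shows "t \<in> swaps g z l \<longleftrightarrow> t permutes N \<and> t \<circ> perm g = perm g \<circ> t \<and> t \<circ> t = id \<and> shifts t z l"
proof -
  interpret finite_perm N "perm g" using permD(1)[OF g] by unfold_locales auto
  have "z (t i) = (z i + l) mod int r \<longleftrightarrow> int r dvd z (t i) - z i - l" if "i \<in> N" "t permutes N" for i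
  proof -
    have "t i \<in> N" using permutes_in_image[OF that(2)] that(1) by simp
    then have "z (t i) mod int r = z (t i)" using z by (auto simp: PiE_iff)
    then show ?thesis by (metis mod_eq_dvd_iff diff_diff_eq)
  qed
  then show ?thesis by (auto simp: color_involutions_def commutes_def simp del: atLeastAtMost_iff)
qed

text \<open>Only fixed classes contribute to the trace of a monomial matrix, and each is counted
  through its \<open>p\<close> lifts, which share one coefficient.\<close>

lemma trace_rho:
  assumes g: "g \<in> carrier Grpn"
  shows "of_nat p * trace_on Inv (rho r p n g) =
    (\<Sum>z\<in>Z. chi g z * (\<Sum>l\<in>Kpr. \<Sum>k\<in>Kpr. \<Sum>t\<in>swaps g z l.
      if shifts (perm g) z k then if l = 0 then of_int (pair_sign N (perm g) t) else zeta r powi k else 0))"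
proof -
  note gc = Grpn_subset[OF g]
  let ?fix = "\<lambda>w. conj_class r n g (Cp #>\<^bsub>Grn\<^esub> w) = Cp #>\<^bsub>Grn\<^esub> w"
  let ?term = "\<lambda>l k t z. if shifts (perm g) z k
      then chi g z * (if l = 0 then of_int (pair_sign N (perm g) t) else zeta r powi k) else 0"
  let ?L = "{w \<in> lifts. perm w \<circ> perm g = perm g \<circ> perm w}"
  let ?D = "SIGMA z:Z. SIGMA l:Kpr. swaps g z l"
  have fin_swaps: "finite (swaps g z l)" for z l
  proof -
    interpret finite_perm N "perm g" using permD(1)[OF gc] by unfold_locales auto
    show ?thesis by (rule finite_color_involutions)
  qed
  have "of_nat p * trace_on Inv (rho r p n g)
      = (\<Sum>v\<in>Inv. of_nat p * (if conj_class r n g v = v then rho_coeff r n g v else 0))"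
  proof -
    have "rho r p n g (basis_vec v) v = (if conj_class r n g v = v then rho_coeff r n g v else 0)" if "v \<in> Inv" for v
      unfolding rho_basis_vec[OF that] by (auto simp: cscale_def basis_vec_def)
    then show ?thesis by (simp add: trace_on_def sum_distrib_left)
  qed
  also have "\<dots> = (\<Sum>v\<in>Inv. \<Sum>w\<in>v. if ?fix w then lift_coeff g w else 0)"
  proof (intro sum.cong refl)
    fix v assume v: "v \<in> Inv"
    then have "card v = p" by (auto simp: Inv_eq card_coset lifts_carrier)
    moreover have "(if ?fix w then lift_coeff g w else 0) = (if conj_class r n g v = v then rho_coeff r n g v else 0)"
      if "w \<in> v" for w
      using rho_coeff_eq[OF v that g] Inv_memD(2)[OF v that] by simp
    ultimately show "of_nat p * (if conj_class r n g v = v then rho_coeff r n g v else 0)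
        = (\<Sum>w\<in>v. if ?fix w then lift_coeff g w else 0)" by simp
  qed
  also have "\<dots> = (\<Sum>w\<in>lifts. if ?fix w then lift_coeff g w else 0)" by (rule sum_lifts)
  also have "\<dots> = (\<Sum>w\<in>?L. if ?fix w then lift_coeff g w else 0)"
  proof (rule sum.mono_neutral_right)
    show "finite lifts" using finite_subset[OF _ finite_G_rn[of r n]] lifts_carrier by blast
    show "\<forall>w\<in>lifts - ?L. (if ?fix w then lift_coeff g w else 0) = 0"
      using fixed_coset_iff[OF gc lifts_carrier] by auto
  qed blast
  also have "\<dots> = (\<Sum>(z, l, t)\<in>?D. \<Sum>k\<in>Kpr. ?term l k t z)"
  \<comment> \<open>A lift is its coloring together with its permutation; the shift
    \<open>l\<close>, which these determine, is recorded so that the sum can be regrouped by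
    \<open>z\<close> and \<open>l\<close>.\<close>
  proof (rule sum.reindex_bij_witness[of _ "\<lambda>(z, l, t). (t, z)"
      "\<lambda>w. (color w, (SOME l. l \<in> Kpr \<and> shifts (perm w) (color w) l), perm w)"])
    fix w assume w: "w \<in> ?L"
    let ?P = "\<lambda>l. l \<in> Kpr \<and> shifts (perm w) (color w) l"
    have wl: "w \<in> lifts" and wc: "w \<in> carrier Grn" and z: "color w \<in> Z"
      using w by (auto simp: lifts_def G_rn_carrier_iff)
    have "\<exists>l. ?P l" using wl by (auto simp: lifts_def)
    then have l: "?P (Eps ?P)" by (rule someI_ex)
    then have "perm w \<in> swaps g (color w) (Eps ?P)"
      unfolding swaps_iff[OF gc z] using w permD(1)[OF wc] by (auto simp: lifts_def)
    then show "(color w, Eps ?P, perm w) \<in> ?D" using z l by blast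
    show "(case (color w, Eps ?P, perm w) of (z, l, t) \<Rightarrow> (t, z)) = w" by simp
    have "(\<Sum>k\<in>Kpr. ?term (Eps ?P) k (perm w) (color w)) = (if ?fix w then lift_coeff g w else 0)"
    proof (cases "\<exists>k\<in>Kpr. shifts (perm g) (color w) k")
      case False
      have "(\<Sum>k\<in>Kpr. ?term (Eps ?P) k (perm w) (color w)) = 0"
      proof (intro sum.neutral ballI)
        fix k assume "k \<in> Kpr"
        then have "\<not> shifts (perm g) (color w) k" using False by blast
        then show "?term (Eps ?P) k (perm w) (color w) = 0" by (simp only: if_False)
      qed
      moreover have "\<not> ?fix w" unfolding fixed_coset_iff[OF gc wc] using False by blast
      ultimately show ?thesis by (simp only: if_False)
    next
      case True
      then obtain k where k: "k \<in> Kpr" "shifts (perm g) (color w) k" by blast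
      have "?term (Eps ?P) k' (perm w) (color w) = 0" if "k' \<in> Kpr - {k}" for k'
      proof -
        have "\<not> shifts (perm g) (color w) k'" using shifts_unique[OF k(2) _ k(1)] that by blast
        then show ?thesis by (simp only: if_False)
      qed
      then have "(\<Sum>k\<in>Kpr. ?term (Eps ?P) k (perm w) (color w)) = (\<Sum>k\<in>{k}. ?term (Eps ?P) k (perm w) (color w))"
        using k(1) by (intro sum.mono_neutral_right finite_scalar_colors) auto
      also have "\<dots> = chi g (color w) * (if Eps ?P = 0 then of_int (pair_sign N (perm g) (perm w)) else zeta r powi k)"
        using k(2) by simp
      \<comment> \<open>The exponent \<open>u\<close> compares the colors at 1 and at its preimage
        under \<open>|g|\<close>, so it equals the shift \<open>k\<close> modulo
        \<open>r\<close>.\<close>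
      also have "zeta r powi k = zeta r powi (color w 1 - color w (inv_into UNIV (perm g) 1))"
      proof (rule zeta_powi_cong[OF r])
        let ?j = "inv_into UNIV (perm g) 1"
        have "1 \<in> N" using n by simp
        then have "?j \<in> N" using permD(3)[OF gc, of 1] by simp
        then have "int r dvd color w (perm g ?j) - color w ?j - k" using k(2) by blast
        then have "int r dvd color w 1 - color w ?j - k" by (simp only: permD(4)[OF gc])
        then show "int r dvd k - (color w 1 - color w ?j)" by (metis dvd_minus_iff minus_diff_eq)
      qed
      also have "chi g (color w) * (if Eps ?P = 0 then of_int (pair_sign N (perm g) (perm w))
          else zeta r powi (color w 1 - color w (inv_into UNIV (perm g) 1))) = lift_coeff g w"
        using symmetric_iff(1)[OF wl, of "Eps ?P"] l by (simp add: lift_coeff_def del: atLeastAtMost_iff)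
      finally show ?thesis using True fixed_coset_iff[OF gc wc] w by auto
    qed
    then show "(case (color w, Eps ?P, perm w) of (z, l, t) \<Rightarrow> \<Sum>k\<in>Kpr. ?term l k t z)
        = (if ?fix w then lift_coeff g w else 0)" by simp
  next
    fix d assume d: "d \<in> ?D"
    then obtain z l t where d_eq: "d = (z, l, t)" and z: "z \<in> Z" and l: "l \<in> Kpr" and t: "t \<in> swaps g z l" by blast
    note t' = t[unfolded swaps_iff[OF gc z]]
    show "(case d of (z, l, t) \<Rightarrow> (t, z)) \<in> ?L"
      using t' z l by (auto simp: d_eq lifts_def G_rn_carrier_iff)
    have "(SOME l. l \<in> Kpr \<and> shifts t z l) = l"
      using l t' shifts_unique by (intro some_equality) blast+
    then show "(color (case d of (z, l, t) \<Rightarrow> (t, z)),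
        (SOME l. l \<in> Kpr \<and> shifts (perm (case d of (z, l, t) \<Rightarrow> (t, z))) (color (case d of (z, l, t) \<Rightarrow> (t, z))) l),
        perm (case d of (z, l, t) \<Rightarrow> (t, z))) = d" by (simp add: d_eq)
  qed
  also have "\<dots> = (\<Sum>z\<in>Z. \<Sum>l\<in>Kpr. \<Sum>t\<in>swaps g z l. \<Sum>k\<in>Kpr. ?term l k t z)"
  proof -
    have "(\<Sum>(z, l, t)\<in>?D. F z l t) = (\<Sum>z\<in>Z. \<Sum>l\<in>Kpr. \<Sum>t\<in>swaps g z l. F z l t)"
      for F :: "(nat \<Rightarrow> int) \<Rightarrow> int \<Rightarrow> (nat \<Rightarrow> nat) \<Rightarrow> complex"
    proof -
      have "(\<Sum>l\<in>Kpr. \<Sum>t\<in>swaps g z l. F z l t) = (\<Sum>(l, t)\<in>(SIGMA l:Kpr. swaps g z l). F z l t)" for z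
        using fin_swaps by (intro sum.Sigma finite_scalar_colors) blast
      moreover have "(\<Sum>z\<in>Z. \<Sum>(l, t)\<in>(SIGMA l:Kpr. swaps g z l). F z l t) = (\<Sum>(z, l, t)\<in>?D. F z l t)"
        using fin_swaps by (intro sum.Sigma finite_Z ballI finite_SigmaI finite_scalar_colors)
      ultimately show ?thesis by (simp only:)
    qed
    then show ?thesis .
  qed
  also have "\<dots> = (\<Sum>z\<in>Z. \<Sum>l\<in>Kpr. \<Sum>k\<in>Kpr. \<Sum>t\<in>swaps g z l. ?term l k t z)"
    by (rule sum.cong[OF refl], rule sum.cong[OF refl], rule sum.swap)
  finally show ?thesis unfolding sum_distrib_left by (simp add: if_distrib[of "(*) _"] cong: if_cong)
qed

text \<open>Both expansions carry the weight \<open>chi g z\<close>, so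
  \<open>coloring_identity\<close> compares them one coloring at a time.\<close>

theorem trace_rho_eq_count:
  assumes g: "g \<in> carrier Grpn" and gcd: "gcd p n dvd 2"
  shows "trace_on Inv (rho r p n g) = of_nat (card {h \<in> carrier Grpn. h \<otimes>\<^bsub>Grn\<^esub> conj_elt r n h = g})"
proof -
  note gc = Grpn_subset[OF g]
  have "(\<Sum>k\<in>Kpr. of_nat (card {s. s permutes N \<and> s \<circ> s = perm g \<and> shifts s z k})) =
    (\<Sum>l\<in>Kpr. \<Sum>k\<in>Kpr. \<Sum>t\<in>swaps g z l.
      if shifts (perm g) z k then if l = 0 then of_int (pair_sign N (perm g) t) else zeta r powi k else 0)"
    if z: "z \<in> Z" for z
  proof -
    interpret c: coloring N "perm g" z r p
      using permD(1)[OF gc] z r n gcd by unfold_locales auto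
    have "c.shift l = (\<lambda>x. (x + l) mod int r)" for l by (rule ext) (rule c.shift_def)
    then show ?thesis using c.coloring_identity by (simp only:)
  qed
  then have "of_nat p * trace_on Inv (rho r p n g)
      = of_nat p * of_nat (card {h \<in> carrier Grpn. h \<otimes>\<^bsub>Grn\<^esub> conj_elt r n h = g})"
    unfolding trace_rho[OF g] count_twisted_square_roots[OF gc] by (intro sum.cong refl) simp
  then show ?thesis using p by simp
qed

lemma conj_elt_hom: "conj_elt r n \<in> hom Grpn Grpn"
proof (rule homI)
  fix g assume g: "g \<in> carrier Grpn"
  have "(\<Sum>i\<in>N. - color g i) = - (\<Sum>i\<in>N. color g i)" by (rule sum_negf)
  then show "conj_elt r n g \<in> carrier Grpn"
    using g r p_dvd_mod_sum[of "\<lambda>i. - color g i" N]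
    by (auto simp: Grpn_carrier_iff G_rn_carrier_iff conj_elt_def simp del: atLeastAtMost_iff)
  fix h assume h: "h \<in> carrier Grpn"
  show "conj_elt r n (g \<otimes>\<^bsub>Grpn\<^esub> h) = conj_elt r n g \<otimes>\<^bsub>Grpn\<^esub> conj_elt r n h"
    using permD(2)[OF Grpn_subset[OF h]]
    by (auto intro!: colperm_eqI[of _ _ N] simp: G_rn_mult conj_elt_def mod_simps simp del: atLeastAtMost_iff)
qed

lemma conj_elt_conj_elt:
  assumes "g \<in> carrier Grpn"
  shows "conj_elt r n (conj_elt r n g) = g"
  using color_range[OF Grpn_subset[OF assms]] Grpn_subset[OF assms]
  by (auto intro!: colperm_eqI[of _ _ N] simp: conj_elt_def mod_simps G_rn_carrier_iff PiE_iff
      simp del: atLeastAtMost_iff)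

theorem rho_is_model:
  assumes gcd: "gcd p n dvd 2"
  shows "is_model Grpn Inv (rho r p n)"
proof (rule model_of_twisted_square_roots[OF group_Grpn is_rep_rho finite_Grpn conj_elt_hom conj_elt_conj_elt])
  interpret H: group Grpn by (rule group_Grpn)
  fix g assume g: "g \<in> carrier Grpn"
  obtain h where h: "h \<in> carrier Grpn" "conj_elt r n g \<otimes>\<^bsub>Grpn\<^esub> (h \<otimes>\<^bsub>Grpn\<^esub> g) = h"
    using conj_elt_conjugate_inverse[OF r p_dvd_r gcd g] by auto
  have c: "conj_elt r n g \<in> carrier Grpn" using conj_elt_hom g by (rule hom_in_carrier)
  have "h \<otimes>\<^bsub>Grpn\<^esub> inv\<^bsub>Grpn\<^esub> g = conj_elt r n g \<otimes>\<^bsub>Grpn\<^esub> (h \<otimes>\<^bsub>Grpn\<^esub> g) \<otimes>\<^bsub>Grpn\<^esub> inv\<^bsub>Grpn\<^esub> g"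
    by (simp only: h(2))
  also have "\<dots> = conj_elt r n g \<otimes>\<^bsub>Grpn\<^esub> h"
    using c h(1) g by (simp add: H.m_assoc del: Grpn_ops)
  finally show "\<exists>h\<in>carrier Grpn. h \<otimes>\<^bsub>Grpn\<^esub> inv\<^bsub>Grpn\<^esub> g = conj_elt r n g \<otimes>\<^bsub>Grpn\<^esub> h"
    using h(1) by blast
  show "trace_on Inv (rho r p n g) = of_nat (card {h \<in> carrier Grpn. h \<otimes>\<^bsub>Grpn\<^esub> conj_elt r n h = g})"
    using trace_rho_eq_count[OF g gcd] by simp
qed

end

theorem theorem5p4:
  fixes r p n :: nat
  assumes "0 < r" and "0 < p" and "0 < n"
    and "p dvd r" and "gcd p n \<in> {1, 2}"
  shows "(\<forall>v\<in>abs_involutions r p n.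
            symmetric_class n v \<longleftrightarrow> \<not> antisymmetric_class r n v) \<and>
         is_model (G_rpn r p n) (abs_involutions r p n) (rho r p n)"
proof -
  interpret crg r p n using assms by unfold_locales
  have "gcd p n dvd 2" using assms(5) by auto
  then show ?thesis using symmetric_xor_antisymmetric rho_is_model by blast
qed

end
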